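(* For each $n$, let $p=p(n)$, $m=m(n)\le p$, and let $\rho^1,\dots,\rho^m\in\mathbb{R}^p$ (depending on $n$) be mutually orthogonal with $\|\rho^1\|>\|\rho^2\|\ge\cdots\ge\|\rho^m\|$. Let $\sigma>0$ be fixed. Observe $x_1,\dots,x_n\in\mathbb{R}^p$ from the multicomponent model $$x_i=\sum_{j=1}^m v_i^j\rho^j+\sigma z_i,\qquad i=1,\dots,n,$$ where the $v_i^j$ ($j=1,\dots,m$, $i=1,\dots,n$) are independent $N(0,1)$, the $z_i$ are independent $N_p(0,I_p)$, and the $z_i$ are independent of the $\{v_i^j\}$. Assume that the sequences of norms converge in $\ell_1(\mathbb{N})$: $$(\|\rho^1(n)\|,\dots,\|\rho^{m(n)}(n)\|,0,0,\dots)\to\varrho=(\varrho_1,\varrho_2,\dots)\quad\text{in }\ell_1,$$ and write $\varrho_+=\sum_j\varrho_j$. Assume $p(n)/n\to c\in[0,\infty)$. Let $S=n^{-1}\sum_{i=1}^nx_ix_i^T$ and let $\hat\rho^1$ be a unit eigenvector of $S$ associated with its largest eigenvalue. Then $$\limsup_{n\to\infty}\sin\angle(\hat\rho^1,\rho^1)\le\frac{4\sigma\sqrt c}{\varrho_1^2-\varrho_2^2}\bigl[\varrho_++(2+\sqrt c)\sigma\bigr]$$ so long as the right side is at most $4/5$. Moreover, if $c>0$, then $$\liminf_{n\to\infty}E\,\angle(\hat\rho^1,\rho^1)>0.$$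
   Context: For nonzero $\xi,\eta\in\mathbb{R}^p$, the angle is $\angle(\xi,\eta)=\cos^{-1}\bigl(|\xi^T\eta|/(\|\xi\|_2\|\eta\|_2)\bigr)\in[0,\pi/2]$. The mean of the model is known and taken to be zero. The quantities $p,m,\rho^j$ may depend on $n$; $\sigma$ does not. *)

theory Defs
  imports "HOL-Probability.Probability"
begin

text \<open>Vectors in R^p are represented as functions nat => real; only the
coordinates k < p are relevant.  Matrices are nat => nat => real.\<close>

definition vdot :: "nat \<Rightarrow> (nat \<Rightarrow> real) \<Rightarrow> (nat \<Rightarrow> real) \<Rightarrow> real" where
  "vdot p u v = (\<Sum>k<p. u k * v k)"

definition vnorm :: "nat \<Rightarrow> (nat \<Rightarrow> real) \<Rightarrow> real" where
  "vnorm p u = sqrt (vdot p u u)"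

definition vangle :: "nat \<Rightarrow> (nat \<Rightarrow> real) \<Rightarrow> (nat \<Rightarrow> real) \<Rightarrow> real" where
  "vangle p u v = arccos (\<bar>vdot p u v\<bar> / (vnorm p u * vnorm p v))"

definition mat_vec :: "nat \<Rightarrow> (nat \<Rightarrow> nat \<Rightarrow> real) \<Rightarrow> (nat \<Rightarrow> real) \<Rightarrow> (nat \<Rightarrow> real)" where
  "mat_vec p A v = (\<lambda>i. \<Sum>k<p. A i k * v k)"

definition is_eigenpair :: "nat \<Rightarrow> (nat \<Rightarrow> nat \<Rightarrow> real) \<Rightarrow> real \<Rightarrow> (nat \<Rightarrow> real) \<Rightarrow> bool" where
  "is_eigenpair p A lam v \<longleftrightarrow> (\<exists>k<p. v k \<noteq> 0) \<and> (\<forall>i<p. mat_vec p A v i = lam * v i)"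

definition is_top_unit_eigvec :: "nat \<Rightarrow> (nat \<Rightarrow> nat \<Rightarrow> real) \<Rightarrow> (nat \<Rightarrow> real) \<Rightarrow> bool" where
  "is_top_unit_eigvec p A v \<longleftrightarrow> vnorm p v = 1 \<and>
     (\<exists>lam. is_eigenpair p A lam v \<and> (\<forall>mu w. is_eigenpair p A mu w \<longrightarrow> mu \<le> lam))"

definition sample_cov :: "nat \<Rightarrow> (nat \<Rightarrow> nat \<Rightarrow> real) \<Rightarrow> (nat \<Rightarrow> nat \<Rightarrow> real)" where
  "sample_cov n x = (\<lambda>i k. (\<Sum>t<n. x t i * x t k) / real n)"

end

theory Submission
  imports Defs "HOL-Real_Asymp.Real_Asymp"
begin

text \<open>
  Write \<open>u\<close> for the direction of \<open>\<rho>\<^sup>1\<close>, \<open>v\<close> for the top sample eigenvector and \<open>E\<close> for the difference between the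
  sample and the population covariance. Since \<open>v\<close> maximises the Rayleigh quotient,
  \<open>(\<parallel>\<rho>\<^sup>1\<parallel>\<^sup>2 - \<parallel>\<rho>\<^sup>2\<parallel>\<^sup>2) sin\<^sup>2 \<le> v\<^sup>T E v - u\<^sup>T E u\<close>, and the right-hand side is at most \<open>sin\<close> times the width of the
  numerical range of \<open>E\<close>. That range splits into a factor part, which vanishes, a cross part of width at most
  \<open>2 \<sigma> \<Sum>\<^sub>j \<parallel>\<rho>\<^sup>j\<parallel> \<parallel>Z\<^sup>T v\<^sup>j\<parallel> / n\<close>, and the noise part \<open>\<sigma>\<^sup>2 (Z\<^sup>T Z / n - I)\<close>. For the noise part the bound
  \<open>3.6 sqrt c + 3.2 c\<close> on the operator norm is enough; it follows by comparing high moments of \<open>g\<^sup>T (Z\<^sup>T Z / n - I) h\<close>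
  for auxiliary independent Gaussian vectors \<open>g\<close> and \<open>h\<close>. All exceptional probabilities are summable in \<open>n\<close>, so
  the Borel-Cantelli lemma applies without any assumption on the joint law for different \<open>n\<close>.

  For the lower bound, the angle is bounded below in terms of the component of \<open>S u\<close> orthogonal to \<open>u\<close>. Flipping the
  sign of half of the noise coordinates preserves the law but changes this component by a vector whose norm
  stays bounded away from zero when \<open>c > 0\<close>, so the component is large with probability close to at least one half.
\<close>

section \<open>Gaussian families and chi-square concentration\<close>

text \<open>Multiplied by the gap, the claimed bound is 4 \<sigma> sqrt c \<varrho>_+ + \<sigma>^2
  (8 sqrt c + 4 c), and these two terms fix all constants. The cross part can afford the crude bound
  2 sqrt c for the norm of Z^T v / n because each form 2 (r.x) (z.x) has a numerical range of length
  only 2 |r| |z|, centred at r.z and not at 0. In the noise part the lower end is at least -1, a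
  Gram form being nonnegative, so a norm bound B suffices as soon as B + min B 1 is at most 8 sqrt c
  + 4 c. This is weaker than the sharp edge 2 sqrt c + c, and the slack is spent on uniformity over
  directions: no net is used, since the moment averaged over g and h is one random variable that
  dominates every unit direction, and Markov's inequality is applied to it once. The price is a
  factor 4 in the norm and moments of order 2 k at least p. The second claim needs no spectral
  limit: an exact symmetry replaces an analysis of how the noise acts on u.\<close>

definition std_normals :: "'w measure \<Rightarrow> ('i \<Rightarrow> 'w \<Rightarrow> real) \<Rightarrow> 'i set \<Rightarrow> bool" where
  "std_normals M X I \<longleftrightarrow> prob_space.indep_vars M (\<lambda>_. borel) X I \<and>
     (\<forall>i\<in>I. distributed M lborel (X i) std_normal_density)"

context prob_space
begin

lemma std_normals_measurable:
  assumes "std_normals M X I" "i \<in> I"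
  shows "X i \<in> borel_measurable M"
  using assms unfolding std_normals_def indep_vars_def by auto

lemma distributed_std_normal_combination:
  assumes "indep_vars (\<lambda>_. borel) X K" and "finite K"
    and "\<And>i. i \<in> K \<Longrightarrow> distributed M lborel (X i) std_normal_density"
    and "(\<Sum>i\<in>K. (a i)\<^sup>2) = 1"
  shows "distributed M lborel (\<lambda>w. \<Sum>i\<in>K. a i * X i w) std_normal_density"
proof -
  \<comment> \<open>Zero coefficients are dropped because every summand in
    \<open>sum_indep_normal\<close> must have a positive standard deviation.\<close>
  define K' where "K' = {i\<in>K. a i \<noteq> 0}"
  have s1: "(\<Sum>i\<in>K'. (a i)\<^sup>2) = 1"
    using assms(4) unfolding K'_def
    by (subst (asm) sum.mono_neutral_right[of K "{i\<in>K. a i \<noteq> 0}"]) (use assms(2) in auto)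
  have eq: "(\<Sum>i\<in>K. a i * X i w) = (\<Sum>i\<in>K'. a i * X i w)" for w
    unfolding K'_def by (rule sum.mono_neutral_right) (use assms(2) in auto)
  have "finite K'" using assms(2) by (simp add: K'_def)
  moreover have "K' \<noteq> {}" using s1 by auto
  moreover have "indep_vars (\<lambda>_. borel) (\<lambda>i w. a i * X i w) K'"
    by (rule indep_vars_compose2[where Y = "\<lambda>i x. a i * x" and M' = "\<lambda>_. borel"])
       (auto intro: indep_vars_subset[OF assms(1)] simp: K'_def)
  moreover have "distributed M lborel (\<lambda>w. a i * X i w) (normal_density 0 \<bar>a i\<bar>)" if "i \<in> K'" for i
    using normal_density_affine[of "X i" 0 1 "a i" 0] that assms(3) by (auto simp: K'_def)
  ultimately have "distributed M lborel (\<lambda>w. \<Sum>i\<in>K'. a i * X i w)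
      (normal_density (\<Sum>i\<in>K'. 0) (sqrt (\<Sum>i\<in>K'. \<bar>a i\<bar>\<^sup>2)))"
    by (intro sum_indep_normal) (auto simp: K'_def)
  then show ?thesis using s1 by (simp add: eq)
qed

text \<open>Blocks without a common index use independent parts of the family, and unit coefficient
  vectors keep the variance 1. Reindexing, sign flips and the projections of rows and columns below
  are all instances.\<close>

lemma std_normals_combinations:
  assumes X: "std_normals M X I"
    and K: "\<And>t. t \<in> T \<Longrightarrow> K t \<subseteq> I" "\<And>t. t \<in> T \<Longrightarrow> finite (K t)" "disjoint_family_on K T"
    and a: "\<And>t. t \<in> T \<Longrightarrow> (\<Sum>i\<in>K t. (a t i)\<^sup>2) = 1"
  shows "std_normals M (\<lambda>t w. \<Sum>i\<in>K t. a t i * X i w) T"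
proof -
  have ind: "indep_vars (\<lambda>_. borel) X I" using X by (simp add: std_normals_def)
  have "indep_vars (\<lambda>_. borel) (\<lambda>t w. (\<lambda>f. \<Sum>i\<in>K t. a t i * f i) (restrict (\<lambda>i. X i w) (K t))) T"
    by (rule indep_vars_compose2[OF indep_vars_restrict[OF ind K(1) K(3)]]) measurable
  then have "indep_vars (\<lambda>_. borel) (\<lambda>t w. \<Sum>i\<in>K t. a t i * X i w) T" by simp
  moreover have "distributed M lborel (\<lambda>w. \<Sum>i\<in>K t. a t i * X i w) std_normal_density" if "t \<in> T" for t
    using X K(1)[OF that] K(2)[OF that] a[OF that]
    by (intro distributed_std_normal_combination indep_vars_subset[OF ind])
       (auto simp: std_normals_def)
  ultimately show ?thesis by (simp add: std_normals_def)
qed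

lemma std_normals_reindex:
  assumes "std_normals M X I" "inj_on f T" "f ` T \<subseteq> I"
  shows "std_normals M (\<lambda>t. X (f t)) T"
proof -
  have "std_normals M (\<lambda>t w. \<Sum>i\<in>{f t}. 1 * X i w) T"
    by (rule std_normals_combinations[OF assms(1)])
       (use assms in \<open>auto simp: disjoint_family_on_def inj_on_def\<close>)
  then show ?thesis by simp
qed

lemma std_normals_flip:
  assumes "std_normals M X I" "\<And>i. i \<in> I \<Longrightarrow> \<bar>\<epsilon> i\<bar> = 1"
  shows "std_normals M (\<lambda>i w. \<epsilon> i * X i w) I"
proof -
  have "(\<epsilon> i)\<^sup>2 = 1" if "i \<in> I" for i
    using assms(2)[OF that] by (metis abs_square_eq_1)
  then have "std_normals M (\<lambda>t w. \<Sum>i\<in>{t}. \<epsilon> i * X i w) I"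
    by (intro std_normals_combinations[OF assms(1)]) (auto simp: disjoint_family_on_def)
  then show ?thesis by simp
qed

text \<open>Both families push \<open>M\<close> forward to the same product of standard normal laws.
  The equality concerns the joint law, so the probability of any event that is a measurable function
  of the family can be transferred.\<close>

lemma std_normals_same_law:
  assumes X: "std_normals M X I" and Y: "std_normals M Y I" and I: "I \<noteq> {}"
  shows "distr M (PiM I (\<lambda>_. borel)) (\<lambda>w. \<lambda>i\<in>I. X i w) =
         distr M (PiM I (\<lambda>_. borel)) (\<lambda>w. \<lambda>i\<in>I. Y i w)"
proof -
  have *: "distr M (PiM I (\<lambda>_. borel)) (\<lambda>w. \<lambda>i\<in>I. X i w) =
     PiM I (\<lambda>_. density lborel std_normal_density)" if X: "std_normals M X I" for X :: "_ \<Rightarrow> 'a \<Rightarrow> real"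
  proof -
    have "distr M (PiM I (\<lambda>_. borel)) (\<lambda>w. \<lambda>i\<in>I. X i w) = (\<Pi>\<^sub>M i\<in>I. distr M borel (X i))"
      using X std_normals_measurable[OF X]
      by (subst indep_vars_iff_distr_eq_PiM'[OF I, symmetric]) (auto simp: std_normals_def)
    also have "\<dots> = PiM I (\<lambda>_. density lborel std_normal_density)"
    proof (rule PiM_cong[OF refl])
      fix i assume "i \<in> I"
      then have "distr M lborel (X i) = density lborel std_normal_density"
        using X by (auto simp: std_normals_def distributed_def)
      moreover have "distr M borel (X i) = distr M lborel (X i)"
        by (rule distr_cong) auto
      ultimately show "distr M borel (X i) = density lborel std_normal_density" by simp
    qed
    finally show ?thesis .
  qed
  show ?thesis using *[OF X] *[OF Y] by simp
qed

end

section \<open>Exponential moments of squared normals and the tails and power moments they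
  imply\<close>

lemma gauss_square_mgf:
  assumes "\<theta> < 1/2"
  shows "(\<integral>\<^sup>+x. ennreal (std_normal_density x) * ennreal (exp (\<theta> * x\<^sup>2)) \<partial>lborel)
     = ennreal ((1 - 2 * \<theta>) powr (- 1/2))"
proof -
  \<comment> \<open>Tilting keeps the density Gaussian up to a factor: exp (\<theta> x^2) times the
    standard density is s times the normal density with standard deviation s.\<close>
  define s where "s = 1 / sqrt (1 - 2*\<theta>)"
  have s: "s > 0" "s\<^sup>2 = 1 / (1 - 2*\<theta>)" using assms by (auto simp: s_def power_divide)
  have "std_normal_density x * exp (\<theta> * x\<^sup>2) = s * normal_density 0 s x" for x
  proof -
    have "- (x\<^sup>2) / 2 + \<theta> * x\<^sup>2 = - (x\<^sup>2) / (2 * s\<^sup>2)"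
      using assms by (simp add: s(2) field_simps)
    then show ?thesis using s(1)
      unfolding normal_density_def by (simp add: exp_add[symmetric] real_sqrt_mult field_simps)
  qed
  then have "(\<integral>\<^sup>+x. ennreal (std_normal_density x) * ennreal (exp (\<theta> * x\<^sup>2)) \<partial>lborel)
     = (\<integral>\<^sup>+x. ennreal s * ennreal (normal_density 0 s x) \<partial>lborel)"
    using s by (intro nn_integral_cong) (simp add: ennreal_mult[symmetric])
  also have "\<dots> = ennreal s * (\<integral>\<^sup>+x. ennreal (normal_density 0 s x) \<partial>lborel)"
    by (rule nn_integral_cmult) simp
  also have "(\<integral>\<^sup>+x. ennreal (normal_density 0 s x) \<partial>lborel) = 1"
    using s(1) by (subst nn_integral_eq_integral) auto
  also have "ennreal s * 1 = ennreal ((1 - 2 * \<theta>) powr (- 1/2))"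
    using assms by (simp add: s_def powr_minus powr_half_sqrt divide_simps)
  finally show ?thesis .
qed

context prob_space
begin

lemma chi_square_mgf:
  assumes X: "std_normals M X T" and "finite T" and \<theta>: "\<theta> < 1/2"
  shows "(\<integral>\<^sup>+w. ennreal (exp (\<theta> * (\<Sum>t\<in>T. (X t w)\<^sup>2))) \<partial>M)
     = ennreal ((1 - 2 * \<theta>) powr (- real (card T) / 2))"
proof -
  have "(\<integral>\<^sup>+w. ennreal (exp (\<theta> * (\<Sum>t\<in>T. (X t w)\<^sup>2))) \<partial>M)
     = (\<integral>\<^sup>+w. (\<Prod>t\<in>T. ennreal (exp (\<theta> * (X t w)\<^sup>2))) \<partial>M)"
    by (simp add: sum_distrib_left exp_sum \<open>finite T\<close> prod_ennreal)
  also have "\<dots> = (\<Prod>t\<in>T. \<integral>\<^sup>+w. ennreal (exp (\<theta> * (X t w)\<^sup>2)) \<partial>M)"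
  proof (rule indep_vars_nn_integral[OF \<open>finite T\<close>])
    show "indep_vars (\<lambda>_. borel) (\<lambda>t w. ennreal (exp (\<theta> * (X t w)\<^sup>2))) T"
      by (rule indep_vars_compose2[where Y = "\<lambda>_ x. ennreal (exp (\<theta> * x\<^sup>2))" and M' = "\<lambda>_. borel"])
         (use X in \<open>auto simp: std_normals_def\<close>)
  qed auto
  also have "\<dots> = (\<Prod>t\<in>T. ennreal ((1 - 2 * \<theta>) powr (- 1/2)))"
  proof (rule prod.cong[OF refl])
    fix t assume "t \<in> T"
    then have "distributed M lborel (X t) std_normal_density"
      using X by (simp add: std_normals_def)
    from distributed_nn_integral[OF this, of "\<lambda>x. ennreal (exp (\<theta> * x\<^sup>2))"]
    show "(\<integral>\<^sup>+w. ennreal (exp (\<theta> * (X t w)\<^sup>2)) \<partial>M) = ennreal ((1 - 2 * \<theta>) powr (- 1/2))"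
      using gauss_square_mgf[OF \<theta>] by simp
  qed
  also have "\<dots> = ennreal (((1 - 2 * \<theta>) powr (- 1/2)) ^ card T)"
    by (simp add: ennreal_power)
  also have "((1 - 2 * \<theta>) powr (- 1/2)) ^ card T = (1 - 2 * \<theta>) powr (- real (card T) / 2)"
    using \<theta> by (simp add: powr_realpow[symmetric] powr_powr)
  finally show ?thesis .
qed

text \<open>The combination has the law of |a| times a standard normal, whose moment of order 2k is
  (2k)! / (2^k k!). That this is an equality matters later: the moment over the Gaussian vector
  recovers the Euclidean norm of the coefficient vector, which is how norms are read off in the
  decoupling argument.\<close>

lemma gaussian_moment_even:
  assumes "std_normals M X K" "finite K"
  shows "(\<integral>\<^sup>+w. ennreal ((\<Sum>i\<in>K. a i * X i w) ^ (2*k)) \<partial>M)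
      = ennreal ((\<Sum>i\<in>K. (a i)\<^sup>2) ^ k * (fact (2 * k) / (2^k * fact k)))"
proof (cases "(\<Sum>i\<in>K. (a i)\<^sup>2) = 0")
  case True
  then have "a i = 0" if "i \<in> K" for i using that assms(2) by (simp add: sum_nonneg_eq_0_iff)
  then have "(\<Sum>i\<in>K. a i * X i w) = 0" for w by simp
  then show ?thesis using True by (cases k) (auto simp: emeasure_space_1)
next
  case False
  define s where "s = sqrt (\<Sum>i\<in>K. (a i)\<^sup>2)"
  have s: "s > 0" "s\<^sup>2 = (\<Sum>i\<in>K. (a i)\<^sup>2)" using False unfolding s_def
    by (auto simp: sum_nonneg less_le)
  have "distributed M lborel (\<lambda>w. \<Sum>i\<in>K. (a i / s) * X i w) std_normal_density"
    using assms s False by (intro distributed_std_normal_combination)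
      (auto simp: std_normals_def power_divide sum_divide_distrib[symmetric])
  from distributed_nn_integral[OF this, of "\<lambda>x. ennreal (x ^ (2*k))"]
  have "(\<integral>\<^sup>+w. ennreal ((\<Sum>i\<in>K. (a i / s) * X i w) ^ (2*k)) \<partial>M)
     = (\<integral>\<^sup>+x. ennreal (std_normal_density x * x ^ (2*k)) \<partial>lborel)"
    by (simp add: ennreal_mult)
  also have "\<dots> = ennreal (fact (2 * k) / (2^k * fact k))"
    using std_normal_moment_even[of k] 
    by (intro nn_integral_eq_integral[THEN trans]) (auto simp: has_bochner_integral_iff)
  finally have 1: "(\<integral>\<^sup>+w. ennreal ((\<Sum>i\<in>K. (a i / s) * X i w) ^ (2*k)) \<partial>M) = ennreal (fact (2 * k) / (2^k * fact k))" .
  have [measurable]: "X i \<in> borel_measurable M" if "i \<in> K" for i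
    using std_normals_measurable[OF assms(1) that] .
  have "(\<Sum>i\<in>K. a i * X i w) = s * (\<Sum>i\<in>K. (a i / s) * X i w)" for w
    using s(1) by (simp add: sum_distrib_left)
  then have "(\<integral>\<^sup>+w. ennreal ((\<Sum>i\<in>K. a i * X i w) ^ (2*k)) \<partial>M)
     = (\<integral>\<^sup>+w. ennreal (s^(2*k)) * ennreal ((\<Sum>i\<in>K. (a i / s) * X i w) ^ (2*k)) \<partial>M)"
    using s by (simp add: power_mult_distrib ennreal_mult)
  also have "\<dots> = ennreal (s^(2*k)) * (\<integral>\<^sup>+w. ennreal ((\<Sum>i\<in>K. (a i / s) * X i w) ^ (2*k)) \<partial>M)"
    by (rule nn_integral_cmult) measurable
  also have "\<dots> = ennreal ((\<Sum>i\<in>K. (a i)\<^sup>2) ^ k * (fact (2 * k) / (2^k * fact k)))"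
    unfolding 1 using s by (subst ennreal_mult[symmetric]) (auto simp: power_mult sum_nonneg)
  finally show ?thesis .
qed

end

text \<open>The right side minus the left side vanishes at 0 and has the derivative x^2 / (2 (1 -
  x)^2).\<close>

lemma neg_ln_one_minus_le:
  fixes s :: real
  assumes "0 \<le> s" "s < 1"
  shows "- s - ln (1 - s) \<le> s\<^sup>2 / (2 * (1 - s))"
proof -
  define h where "h x = x\<^sup>2 / (2 * (1 - x)) + x + ln (1 - x)" for x :: real
  have "h 0 \<le> h s"
  proof (rule DERIV_nonneg_imp_nondecreasing[OF assms(1)])
    fix x assume x: "0 \<le> x" "x \<le> s"
    then have x1: "x < 1" using assms by simp
    have "(h has_real_derivative (2 * x * (2 * (1 - x)) - x\<^sup>2 * (- 2)) / (2 * (1 - x))\<^sup>2 + 1 - 1 / (1 - x)) (at x)"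
      unfolding h_def using x1
      by (auto intro!: derivative_eq_intros) (simp add: power2_eq_square)?
    moreover have "(2 * x * (2 * (1 - x)) - x\<^sup>2 * (- 2)) / (2 * (1 - x))\<^sup>2 + 1 - 1 / (1 - x) = x\<^sup>2 / (2 * (1 - x)\<^sup>2)"
      using x1 by (simp add: divide_simps) (simp add: power2_eq_square algebra_simps)?
    ultimately show "\<exists>y. (h has_real_derivative y) (at x) \<and> 0 \<le> y"
      by (intro exI[of _ "x\<^sup>2 / (2 * (1 - x)\<^sup>2)"]) auto
  qed
  then show ?thesis by (simp add: h_def)
qed

lemma minus_ln_one_plus_le:
  fixes s :: real
  assumes "0 \<le> s"
  shows "s - ln (1 + s) \<le> s\<^sup>2 / 2"
proof -
  define h where "h x = x\<^sup>2 / 2 - x + ln (1 + x)" for x :: real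
  have "h 0 \<le> h s"
  proof (rule DERIV_nonneg_imp_nondecreasing[OF assms(1)])
    fix x assume x: "0 \<le> x" "x \<le> s"
    have "(h has_real_derivative x - 1 + 1 / (1 + x)) (at x)"
      unfolding h_def using x by (auto intro!: derivative_eq_intros)
    moreover have "x - 1 + 1 / (1 + x) = x\<^sup>2 / (1 + x)"
      using x by (simp add: divide_simps) (simp add: power2_eq_square algebra_simps)?
    ultimately show "\<exists>y. (h has_real_derivative y) (at x) \<and> 0 \<le> y"
      using x by (intro exI[of _ "x\<^sup>2 / (1 + x)"]) auto
  qed
  then show ?thesis by (simp add: h_def)
qed

text \<open>The inequality y \<le> exp (y - 1) at y = |x| / (2k), raised to the power 2k; the
  constant is the maximum of |x|^(2k) exp (-|x|). It turns exponential moments of both signs into a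
  power moment of high order.\<close>

lemma even_power_le_cosh:
  fixes x :: real
  assumes "k \<ge> 1"
  shows "x ^ (2*k) \<le> (2 * real k / exp 1) ^ (2*k) * (exp x + exp (- x))"
proof -
  define q where "q = 2 * real k"
  have q: "q > 0" using assms by (simp add: q_def)
  have "\<bar>x\<bar> / q \<le> exp (\<bar>x\<bar> / q - 1)" using exp_ge_add_one_self[of "\<bar>x\<bar> / q - 1"] by simp
  then have "\<bar>x\<bar> \<le> q / exp 1 * exp (\<bar>x\<bar> / q)" unfolding exp_diff using q by (simp add: divide_simps mult_ac)
  then have "\<bar>x\<bar> ^ (2*k) \<le> (q / exp 1 * exp (\<bar>x\<bar> / q)) ^ (2*k)" by (intro power_mono) auto
  also have "\<dots> = (q / exp 1) ^ (2*k) * exp (\<bar>x\<bar>)"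
    using q unfolding power_mult_distrib exp_of_nat_mult[symmetric] by (simp add: q_def)
  also have "\<dots> \<le> (q / exp 1) ^ (2*k) * (exp x + exp (- x))"
    by (intro mult_left_mono) (auto simp: abs_if q_def)
  finally show ?thesis by (simp add: q_def power_even_abs)
qed

lemma power_le_exp:
  fixes x :: real
  assumes "k \<ge> 1" "x \<ge> 0"
  shows "x ^ k \<le> (real k / exp 1) ^ k * exp x"
proof -
  have q: "real k > 0" using assms by simp
  have "x / k \<le> exp (x / k - 1)" using exp_ge_add_one_self[of "x / k - 1"] by simp
  then have "x \<le> k / exp 1 * exp (x / k)" unfolding exp_diff using q by (simp add: divide_simps mult_ac)
  then have "x ^ k \<le> (k / exp 1 * exp (x / k)) ^ k" using assms by (intro power_mono) auto
  also have "\<dots> = (k / exp 1) ^ k * exp x"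
    using q unfolding power_mult_distrib exp_of_nat_mult[symmetric] by simp
  finally show ?thesis .
qed

context prob_space
begin

text \<open>The sign e treats both tails at once, with \<theta> = e s / 2 in the chi-square
  transform. Its logarithm is (n / 2) (- e s - ln (1 - e s)); the estimate with the pole at s = 1 is
  the one for e = 1, and it also covers e = -1, where s^2 / 2 would do.\<close>

lemma centered_chi_square_mgf:
  assumes X: "std_normals M X T" and "finite T" and "T \<noteq> {}" and s: "0 \<le> s" "s < 1" and e: "\<bar>e\<bar> = 1"
  defines "n \<equiv> real (card T)"
  shows "(\<integral>\<^sup>+w. ennreal (exp (e * (n * s / 2 * ((\<Sum>t\<in>T. (X t w)\<^sup>2) / n - 1)))) \<partial>M)
     \<le> ennreal (exp (n * s\<^sup>2 / (4 * (1 - s))))"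
proof -
  have n: "n > 0" using assms by (simp add: n_def card_gt_0_iff)
  have es: "e * s < 1" using e s by (cases "e \<ge> 0") auto
  have [measurable]: "\<And>t. t \<in> T \<Longrightarrow> X t \<in> borel_measurable M"
    using std_normals_measurable[OF X] .
  have eq: "exp (e * (n * s / 2 * ((\<Sum>t\<in>T. (X t w)\<^sup>2) / n - 1)))
     = exp (- n * (e * s) / 2) * exp (e * s / 2 * (\<Sum>t\<in>T. (X t w)\<^sup>2))" for w
    using n unfolding exp_add[symmetric] by (simp add: field_simps)
  have "(\<integral>\<^sup>+w. ennreal (exp (e * (n * s / 2 * ((\<Sum>t\<in>T. (X t w)\<^sup>2) / n - 1)))) \<partial>M)
    = (\<integral>\<^sup>+w. ennreal (exp (- n * (e * s) / 2)) * ennreal (exp (e * s / 2 * (\<Sum>t\<in>T. (X t w)\<^sup>2))) \<partial>M)"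
    unfolding eq by (simp add: ennreal_mult)
  also have "\<dots> = ennreal (exp (- n * (e * s) / 2)) * ennreal ((1 - 2 * (e * s / 2)) powr (- n / 2))"
    using chi_square_mgf[OF X \<open>finite T\<close>, of "e * s / 2"] es
    by (subst nn_integral_cmult) (simp_all add: n_def)
  also have "\<dots> = ennreal (exp (n / 2 * (- (e * s) - ln (1 - e * s))))"
    using es by (simp add: ennreal_mult[symmetric] powr_def exp_add[symmetric] algebra_simps)
  also have "\<dots> \<le> ennreal (exp (n * s\<^sup>2 / (4 * (1 - s))))"
  proof (intro ennreal_leI iffD2[OF exp_le_cancel_iff])
    have "- (e * s) - ln (1 - e * s) \<le> s\<^sup>2 / (2 * (1 - s))"
    proof (cases "e \<ge> 0")
      case True then show ?thesis using neg_ln_one_minus_le[OF s] e by simp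
    next
      case False
      then have "e = -1" using e by simp
      moreover have "s\<^sup>2 / 2 \<le> s\<^sup>2 / (2 * (1 - s))" using s by (intro divide_left_mono) auto
      moreover note minus_ln_one_plus_le[OF s(1)]
      ultimately have "e = -1 \<and> s - ln (1 + s) \<le> s\<^sup>2 / (2 * (1 - s))" by linarith
      then show ?thesis by simp
    qed
    then have "n / 2 * (- (e * s) - ln (1 - e * s)) \<le> n / 2 * (s\<^sup>2 / (2 * (1 - s)))"
      using n by (intro mult_left_mono) auto
    then show "n / 2 * (- (e * s) - ln (1 - e * s)) \<le> n * s\<^sup>2 / (4 * (1 - s))"
      by (simp add: field_simps)
  qed
  finally show ?thesis .
qed

lemma chernoff_bound:
  assumes [measurable]: "f \<in> borel_measurable M"
    and "(\<integral>\<^sup>+w. ennreal (exp (f w)) \<partial>M) \<le> ennreal b" "0 \<le> b"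
  shows "prob {w\<in>space M. a \<le> f w} \<le> b * exp (- a)"
proof -
  have "emeasure M {w\<in>space M. a \<le> f w} \<le> emeasure M ({w\<in>space M. 1 \<le> ennreal (exp (- a)) * ennreal (exp (f w))} \<inter> space M)"
  proof (rule emeasure_mono)
    have "1 \<le> exp (- a) * exp (f w)" if "a \<le> f w" for w
      using that unfolding exp_add[symmetric] by simp
    then show "{w\<in>space M. a \<le> f w} \<subseteq> {w\<in>space M. 1 \<le> ennreal (exp (- a)) * ennreal (exp (f w))} \<inter> space M"
      by (auto simp: ennreal_mult[symmetric])
  qed measurable
  also have "\<dots> \<le> ennreal (exp (- a)) * (\<integral>\<^sup>+w. ennreal (exp (f w)) * indicator (space M) w \<partial>M)"
    using nn_integral_Markov_inequality[of "\<lambda>w. ennreal (exp (f w))" "space M" M "ennreal (exp (- a))"] by simp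
  also have "(\<integral>\<^sup>+w. ennreal (exp (f w)) * indicator (space M) w \<partial>M) = (\<integral>\<^sup>+w. ennreal (exp (f w)) \<partial>M)"
    by (rule nn_integral_cong) simp
  also have "ennreal (exp (- a)) * (\<integral>\<^sup>+w. ennreal (exp (f w)) \<partial>M) \<le> ennreal (exp (- a)) * ennreal b"
    using assms by (intro mult_left_mono) auto
  also have "\<dots> = ennreal (b * exp (- a))" using assms by (simp add: ennreal_mult[symmetric] mult.commute)
  finally show ?thesis using assms by (simp add: emeasure_eq_measure)
qed

lemma chi_square_concentration:
  assumes X: "std_normals M X T" and "finite T" and "T \<noteq> {}" and e: "0 < e" "e \<le> 1"
  shows "prob {w\<in>space M. e \<le> \<bar>(\<Sum>t\<in>T. (X t w)\<^sup>2) / real (card T) - 1\<bar>} \<le> 2 * exp (- real (card T) * e\<^sup>2 / 8)"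
proof -
  define n where "n = real (card T)"
  define z where "z w = (\<Sum>t\<in>T. (X t w)\<^sup>2) / n - 1" for w
  have n: "n > 0" using assms by (simp add: n_def card_gt_0_iff)
  have [measurable]: "\<And>t. t \<in> T \<Longrightarrow> X t \<in> borel_measurable M"
    using std_normals_measurable[OF X] .
  have [measurable]: "z \<in> borel_measurable M" unfolding z_def by measurable
  \<comment> \<open>Here s = e / 2. Since 1 - e / 2 \<ge> 1/2, the transform costs at most n e^2 / 8
    in the exponent, while the threshold gains n e^2 / 4.\<close>
  have *: "prob {w\<in>space M. n * (e/2) / 2 * e \<le> d * (n * (e/2) / 2 * z w)} \<le> exp (- n * e\<^sup>2 / 8)"
    if "\<bar>d\<bar> = 1" for d
  proof -
    have "prob {w\<in>space M. n * (e/2) / 2 * e \<le> d * (n * (e/2) / 2 * z w)}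
      \<le> exp (n * (e/2)\<^sup>2 / (4 * (1 - e/2))) * exp (- (n * (e/2) / 2 * e))"
      by (rule chernoff_bound)
         (use centered_chi_square_mgf[OF X \<open>finite T\<close> \<open>T \<noteq> {}\<close>, of "e/2" d] e that in \<open>auto simp: z_def n_def\<close>)
    also have "\<dots> \<le> exp (- n * e\<^sup>2 / 8)"
      unfolding exp_add[symmetric] exp_le_cancel_iff
    proof -
      have "n * (e/2)\<^sup>2 / (4 * (1 - e/2)) \<le> n * (e/2)\<^sup>2 / (4 * (1/2))"
        using e n by (intro divide_left_mono) auto
      also have "\<dots> = n * e\<^sup>2 / 8" by (simp add: power2_eq_square)
      finally have "n * (e/2)\<^sup>2 / (4 * (1 - e/2)) \<le> n * e\<^sup>2 / 8" .
      moreover have "n * (e/2) / 2 * e = 2 * (n * e\<^sup>2 / 8)" by (simp add: power2_eq_square)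
      ultimately show "n * (e/2)\<^sup>2 / (4 * (1 - e/2)) + - (n * (e/2) / 2 * e) \<le> - n * e\<^sup>2 / 8"
        by linarith
    qed
    finally show ?thesis .
  qed
  have "{w\<in>space M. e \<le> \<bar>z w\<bar>} \<subseteq> {w\<in>space M. n * (e/2) / 2 * e \<le> 1 * (n * (e/2) / 2 * z w)}
      \<union> {w\<in>space M. n * (e/2) / 2 * e \<le> (-1) * (n * (e/2) / 2 * z w)}"
  proof (clarsimp)
    fix w assume "e \<le> \<bar>z w\<bar>" "w \<in> space M" and ne: "\<not> n * e * e \<le> - (n * e * z w)"
    show "n * e * e \<le> n * e * z w"
    proof (cases "z w \<ge> 0")
      case True
      then show ?thesis using \<open>e \<le> \<bar>z w\<bar>\<close> n e by (intro mult_left_mono) auto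
    next
      case False
      then have "n * e * e \<le> n * e * (- z w)" using \<open>e \<le> \<bar>z w\<bar>\<close> n e by (intro mult_left_mono) auto
      then show ?thesis using ne by simp
    qed
  qed
  then have "prob {w\<in>space M. e \<le> \<bar>z w\<bar>} \<le> prob ({w\<in>space M. n * (e/2) / 2 * e \<le> 1 * (n * (e/2) / 2 * z w)}
      \<union> {w\<in>space M. n * (e/2) / 2 * e \<le> (-1) * (n * (e/2) / 2 * z w)})"
    by (intro finite_measure_mono) measurable
  also have "\<dots> \<le> prob {w\<in>space M. n * (e/2) / 2 * e \<le> 1 * (n * (e/2) / 2 * z w)}
      + prob {w\<in>space M. n * (e/2) / 2 * e \<le> (-1) * (n * (e/2) / 2 * z w)}"
    by (rule measure_Un_le) measurable
  also have "\<dots> \<le> exp (- n * e\<^sup>2 / 8) + exp (- n * e\<^sup>2 / 8)"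
    by (intro add_mono *) auto
  finally show ?thesis by (simp add: z_def n_def)
qed

text \<open>The parameter s stays free: the factor s^(-2k) favours a large s and the exponential a
  small one, and the balance depends on the ratio of k to n, which is fixed only when the norm bound
  is evaluated.\<close>

lemma centered_chi_square_moment:
  assumes X: "std_normals M X T" and "finite T" and "T \<noteq> {}" and s: "0 < s" "s < 1" and k: "k \<ge> 1"
  defines "n \<equiv> real (card T)"
  shows "(\<integral>\<^sup>+w. ennreal (((\<Sum>t\<in>T. (X t w)\<^sup>2) / n - 1) ^ (2*k)) \<partial>M)
     \<le> ennreal (2 * (4 * real k / (exp 1 * s * n)) ^ (2*k) * exp (n * s\<^sup>2 / (4 * (1 - s))))"
proof -
  define z where "z w = (\<Sum>t\<in>T. (X t w)\<^sup>2) / n - 1" for w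
  have n: "n > 0" using assms by (simp add: n_def card_gt_0_iff)
  define B where "B = (4 * real k / (exp 1 * s * n)) ^ (2*k)"
  have B: "B \<ge> 0" unfolding B_def using s n by simp
  have [measurable]: "\<And>t. t \<in> T \<Longrightarrow> X t \<in> borel_measurable M"
    using std_normals_measurable[OF X] .
  have [measurable]: "z \<in> borel_measurable M" unfolding z_def by measurable
  have pw: "z w ^ (2*k) \<le> B * (exp (1 * (n * s / 2 * z w)) + exp ((-1) * (n * s / 2 * z w)))" for w
  proof -
    have "z w ^ (2*k) = (2 / (n * s)) ^ (2*k) * (n * s / 2 * z w) ^ (2*k)"
      using n s unfolding power_mult_distrib[symmetric] by simp
    also have "\<dots> \<le> (2 / (n * s)) ^ (2*k) * ((2 * real k / exp 1) ^ (2*k) * (exp (n * s / 2 * z w) + exp (- (n * s / 2 * z w))))"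
      using n s by (intro mult_left_mono even_power_le_cosh[OF k]) auto
    also have "\<dots> = B * (exp (1 * (n * s / 2 * z w)) + exp ((-1) * (n * s / 2 * z w)))"
      unfolding B_def mult.assoc[symmetric] power_mult_distrib[symmetric] by (simp add: field_simps)
    finally show ?thesis .
  qed
  have "(\<integral>\<^sup>+w. ennreal (z w ^ (2*k)) \<partial>M) \<le>
     (\<integral>\<^sup>+w. ennreal B * (ennreal (exp (1 * (n * s / 2 * z w))) + ennreal (exp ((-1) * (n * s / 2 * z w)))) \<partial>M)"
    using pw B by (intro nn_integral_mono) (simp add: ennreal_mult[symmetric] ennreal_plus[symmetric] del: ennreal_plus)
  also have "\<dots> = ennreal B * ((\<integral>\<^sup>+w. ennreal (exp (1 * (n * s / 2 * z w))) \<partial>M) + (\<integral>\<^sup>+w. ennreal (exp ((-1) * (n * s / 2 * z w))) \<partial>M))"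
    by (subst nn_integral_cmult) (auto simp: nn_integral_add)
  also have "\<dots> \<le> ennreal B * (ennreal (exp (n * s\<^sup>2 / (4 * (1 - s)))) + ennreal (exp (n * s\<^sup>2 / (4 * (1 - s)))))"
    unfolding z_def n_def
    by (intro mult_left_mono add_mono centered_chi_square_mgf[OF X \<open>finite T\<close> \<open>T \<noteq> {}\<close>]) (use s in auto)
  also have "\<dots> = ennreal (2 * B * exp (n * s\<^sup>2 / (4 * (1 - s))))"
    using B by (simp add: ennreal_mult[symmetric] ennreal_plus[symmetric] del: ennreal_plus)
  finally show ?thesis by (simp add: z_def B_def)
qed

end

section \<open>Gaussian matrices\<close>

text \<open>Normalising g and h before polarising makes the errors scale with a b instead of a^2 +
  b^2. The first identity is the parallelogram law; through it N 1 / 4 and N (-1) / 4 become convex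
  weights in the moment bound.\<close>

lemma normalized_polarization:
  fixes g h :: "'j \<Rightarrow> real" and x :: "nat \<Rightarrow> 'j \<Rightarrow> real" and n :: nat
  assumes ab: "a > 0" "b > 0" and a2: "(\<Sum>j\<in>J. (g j)\<^sup>2) = a\<^sup>2" and b2: "(\<Sum>j\<in>J. (h j)\<^sup>2) = b\<^sup>2"
  defines "u \<equiv> \<lambda>d j. g j / a + d * (h j / b)"
  defines "N \<equiv> \<lambda>d. \<Sum>j\<in>J. (u d j)\<^sup>2"
  defines "Q \<equiv> \<lambda>d. (\<Sum>i<n. (\<Sum>j\<in>J. u d j * x i j)\<^sup>2) / n - N d"
  shows "N 1 + N (-1) = 4"
    and "Q 1 - Q (-1) = 4 * ((\<Sum>i<n. (\<Sum>j\<in>J. g j * x i j) * (\<Sum>j\<in>J. h j * x i j)) / n - (\<Sum>j\<in>J. g j * h j)) / (a * b)"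
proof -
  have lin: "(\<Sum>j\<in>J. u d j * x i j) = (\<Sum>j\<in>J. g j * x i j) / a + d * ((\<Sum>j\<in>J. h j * x i j) / b)" for d i
    by (simp add: u_def algebra_simps sum.distrib sum_distrib_left sum_divide_distrib)
  have sq: "(y / a + 1 * (z / b))\<^sup>2 - (y / a + (-1) * (z / b))\<^sup>2 = 4 / (a * b) * (y * z)"
    "(y / a + 1 * (z / b))\<^sup>2 + (y / a + (-1) * (z / b))\<^sup>2 = 2 / a\<^sup>2 * y\<^sup>2 + 2 / b\<^sup>2 * z\<^sup>2" for y z
    using ab by (simp_all add: power2_eq_square divide_simps) (simp_all add: algebra_simps)
  have "N 1 + N (-1) = (\<Sum>j\<in>J. 2 / a\<^sup>2 * (g j)\<^sup>2 + 2 / b\<^sup>2 * (h j)\<^sup>2)"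
    unfolding N_def sum.distrib[symmetric] u_def sq ..
  then show "N 1 + N (-1) = 4"
    unfolding sum.distrib sum_distrib_left[symmetric] a2 b2 using ab by simp
  have 1: "(\<Sum>i<n. (\<Sum>j\<in>J. u 1 j * x i j)\<^sup>2) - (\<Sum>i<n. (\<Sum>j\<in>J. u (-1) j * x i j)\<^sup>2)
    = (\<Sum>i<n. 4 / (a * b) * ((\<Sum>j\<in>J. g j * x i j) * (\<Sum>j\<in>J. h j * x i j)))"
    unfolding lin sum_subtractf[symmetric] sq ..
  have 2: "N 1 - N (-1) = (\<Sum>j\<in>J. 4 / (a * b) * (g j * h j))"
    unfolding N_def sum_subtractf[symmetric] u_def sq ..
  have "Q 1 - Q (-1) = ((\<Sum>i<n. (\<Sum>j\<in>J. u 1 j * x i j)\<^sup>2) - (\<Sum>i<n. (\<Sum>j\<in>J. u (-1) j * x i j)\<^sup>2)) / n - (N 1 - N (-1))"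
    by (simp add: Q_def diff_divide_distrib)
  then show "Q 1 - Q (-1) = 4 * ((\<Sum>i<n. (\<Sum>j\<in>J. g j * x i j) * (\<Sum>j\<in>J. h j * x i j)) / n - (\<Sum>j\<in>J. g j * h j)) / (a * b)"
    unfolding 1 2 sum_distrib_left[symmetric] by (simp add: algebra_simps diff_divide_distrib)
qed

context prob_space
begin

lemma std_normals_rows:
  fixes n :: nat
  assumes X: "std_normals M X ({..<n} \<times> J)" and "finite J" and g: "(\<Sum>j\<in>J. (g j)\<^sup>2) = 1"
  shows "std_normals M (\<lambda>i w. \<Sum>j\<in>J. g j * X (i, j) w) {..<n}"
proof -
  have eq: "(\<Sum>a\<in>{i} \<times> J. f a) = (\<Sum>j\<in>J. f (i, j))" for f :: "_ \<Rightarrow> real" and i :: nat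
    using sum.cartesian_product[of "\<lambda>i j. f (i, j)" J "{i}", symmetric] by simp
  have "std_normals M (\<lambda>i w. \<Sum>a\<in>{i} \<times> J. g (snd a) * X a w) {..<n}"
    using assms by (intro std_normals_combinations[OF X]) (auto simp: disjoint_family_on_def eq)
  then show ?thesis by (simp add: eq)
qed

text \<open>For a unit vector g the row projections are independent standard normals, and scaling
  does the rest. The inequality in the event is strict so that g = 0, which cannot be normalised,
  gives the empty event.\<close>

lemma gaussian_quadratic_concentration:
  assumes X: "std_normals M X ({..<n} \<times> J)" and "finite J" and "n > 0" and e: "0 < e" "e \<le> 1"
  shows "prob {w\<in>space M. e * (\<Sum>j\<in>J. (g j)\<^sup>2) < \<bar>(\<Sum>i<n. (\<Sum>j\<in>J. g j * X (i, j) w)\<^sup>2) / n - (\<Sum>j\<in>J. (g j)\<^sup>2)\<bar>}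
     \<le> 2 * exp (- real n * e\<^sup>2 / 8)"
proof (cases "(\<Sum>j\<in>J. (g j)\<^sup>2) = 0")
  case True
  then have "g j = 0" if "j \<in> J" for j using that assms(2) by (simp add: sum_nonneg_eq_0_iff)
  then show ?thesis by simp
next
  case False
  define s where "s = sqrt (\<Sum>j\<in>J. (g j)\<^sup>2)"
  have s: "s > 0" "s\<^sup>2 = (\<Sum>j\<in>J. (g j)\<^sup>2)" using False unfolding s_def
    by (auto simp: sum_nonneg less_le)
  have [measurable]: "X (i, j) \<in> borel_measurable M" if "i < n" "j \<in> J" for i j
    using std_normals_measurable[OF X] that by auto
  have "std_normals M (\<lambda>i w. \<Sum>j\<in>J. (g j / s) * X (i, j) w) {..<n}"
    using s False by (intro std_normals_rows[OF X \<open>finite J\<close>]) (auto simp: power_divide sum_divide_distrib[symmetric])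
  from chi_square_concentration[OF this _ _ e] \<open>n > 0\<close>
  have *: "prob {w\<in>space M. e \<le> \<bar>(\<Sum>i<n. (\<Sum>j\<in>J. (g j / s) * X (i, j) w)\<^sup>2) / n - 1\<bar>}
     \<le> 2 * exp (- real n * e\<^sup>2 / 8)" by (auto simp: lessThan_empty_iff)
  have eq: "(\<Sum>i<n. (\<Sum>j\<in>J. g j * X (i, j) w)\<^sup>2) / n - s\<^sup>2
     = s\<^sup>2 * ((\<Sum>i<n. (\<Sum>j\<in>J. (g j / s) * X (i, j) w)\<^sup>2) / n - 1)" for w
  proof -
    have "(\<Sum>j\<in>J. g j * X (i, j) w) = s * (\<Sum>j\<in>J. (g j / s) * X (i, j) w)" for i
      using s(1) by (simp add: sum_distrib_left)
    then show ?thesis by (simp add: power_mult_distrib sum_distrib_left[symmetric] algebra_simps)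
  qed
  have "prob {w\<in>space M. e * s\<^sup>2 < \<bar>(\<Sum>i<n. (\<Sum>j\<in>J. g j * X (i, j) w)\<^sup>2) / n - s\<^sup>2\<bar>}
    \<le> prob {w\<in>space M. e \<le> \<bar>(\<Sum>i<n. (\<Sum>j\<in>J. (g j / s) * X (i, j) w)\<^sup>2) / n - 1\<bar>}"
    unfolding eq abs_mult using s(1)
    by (intro finite_measure_mono) (auto simp: mult.commute[of e])
  then show ?thesis using * s(2) by simp
qed

lemma gaussian_bilinear_concentration:
  assumes X: "std_normals M X ({..<n} \<times> J)" and "finite J" and "n > 0" and e: "0 < e" "e \<le> 1"
  shows "prob {w\<in>space M. e * (L2_set g J * L2_set h J) <
       \<bar>(\<Sum>i<n. (\<Sum>j\<in>J. g j * X (i, j) w) * (\<Sum>j\<in>J. h j * X (i, j) w)) / n - (\<Sum>j\<in>J. g j * h j)\<bar>}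
     \<le> 4 * exp (- real n * e\<^sup>2 / 8)"
proof (cases "L2_set g J = 0 \<or> L2_set h J = 0")
  case True
  then have "(\<forall>j\<in>J. g j = 0) \<or> (\<forall>j\<in>J. h j = 0)"
    using assms(2) by (simp add: L2_set_eq_0_iff)
  then show ?thesis using True by auto
next
  case False
  define a b where "a = L2_set g J" and "b = L2_set h J"
  have ab: "a > 0" "b > 0" using False L2_set_nonneg[of g J] L2_set_nonneg[of h J] by (auto simp: a_def b_def less_le)
  have a2: "(\<Sum>j\<in>J. (g j)\<^sup>2) = a\<^sup>2" and b2: "(\<Sum>j\<in>J. (h j)\<^sup>2) = b\<^sup>2"
    by (auto simp: a_def b_def L2_set_def sum_nonneg)
  have [measurable]: "X (i, j) \<in> borel_measurable M" if "i < n" "j \<in> J" for i j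
    using std_normals_measurable[OF X] that by auto
  define u where "u d j = g j / a + d * (h j / b)" for d j
  define N where "N d = (\<Sum>j\<in>J. (u d j)\<^sup>2)" for d
  define Q where "Q d w = (\<Sum>i<n. (\<Sum>j\<in>J. u d j * X (i, j) w)\<^sup>2) / n - N d" for d w
  define P where "P w = (\<Sum>i<n. (\<Sum>j\<in>J. g j * X (i, j) w) * (\<Sum>j\<in>J. h j * X (i, j) w)) / n - (\<Sum>j\<in>J. g j * h j)" for w
  have [measurable]: "Q d \<in> borel_measurable M" for d unfolding Q_def by measurable
  have [measurable]: "P \<in> borel_measurable M" unfolding P_def by measurable
  have pol: "Q 1 w - Q (-1) w = 4 * P w / (a * b)" for w
    unfolding Q_def N_def u_def P_def by (rule normalized_polarization(2)[OF ab a2 b2])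
  have par: "N 1 + N (-1) = 4"
    unfolding N_def u_def by (rule normalized_polarization(1)[OF ab a2 b2])
  \<comment> \<open>If both quadratic errors are at most e N, polarisation gives |P| \<le> a b e (N
    1 + N (-1)) / 4 = e a b.\<close>
  have "{w\<in>space M. e * (a * b) < \<bar>P w\<bar>} \<subseteq> {w\<in>space M. e * N 1 < \<bar>Q 1 w\<bar>} \<union> {w\<in>space M. e * N (-1) < \<bar>Q (-1) w\<bar>}"
  proof (rule ccontr)
    assume "\<not> ?thesis"
    then obtain w where w: "e * (a * b) < \<bar>P w\<bar>" "\<bar>Q 1 w\<bar> \<le> e * N 1" "\<bar>Q (-1) w\<bar> \<le> e * N (-1)"
      by fastforce
    have "\<bar>4 * P w / (a * b)\<bar> \<le> e * (N 1 + N (-1))" using w(2,3) pol[of w] by (simp add: algebra_simps)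
    then have "\<bar>P w\<bar> \<le> e * (a * b)" using ab par by (simp add: abs_mult divide_simps) 
    then show False using w(1) by simp
  qed
  then have "prob {w\<in>space M. e * (a * b) < \<bar>P w\<bar>} \<le> prob ({w\<in>space M. e * N 1 < \<bar>Q 1 w\<bar>} \<union> {w\<in>space M. e * N (-1) < \<bar>Q (-1) w\<bar>})"
    by (intro finite_measure_mono) measurable
  also have "\<dots> \<le> prob {w\<in>space M. e * N 1 < \<bar>Q 1 w\<bar>} + prob {w\<in>space M. e * N (-1) < \<bar>Q (-1) w\<bar>}"
    by (rule measure_Un_le) measurable
  also have "\<dots> \<le> 2 * exp (- real n * e\<^sup>2 / 8) + 2 * exp (- real n * e\<^sup>2 / 8)"
    unfolding N_def Q_def
    by (intro add_mono gaussian_quadratic_concentration[OF X \<open>finite J\<close> \<open>n > 0\<close> e])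
  finally show ?thesis by (simp add: P_def a_def b_def)
qed

text \<open>Conditionally on the combination \<open>y\<close> of the columns in \<open>G\<close>, the inner products of \<open>y / \<parallel>y\<parallel>\<close> with
  the columns in \<open>K\<close> are independent standard normals.\<close>

lemma projected_columns_mgf:
  fixes g :: "'j \<Rightarrow> real" and n :: nat
  assumes X: "std_normals M X ({..<n} \<times> J)" and G: "G \<subseteq> J" "finite G" and K: "K \<subseteq> J" "finite K" and GK: "G \<inter> K = {}"
    and \<theta>: "\<theta> < 1/2"
  defines "y \<equiv> \<lambda>i w. \<Sum>j\<in>G. g j * X (i, j) w"
  shows "(\<integral>\<^sup>+w. ennreal (exp (\<theta> * ((\<Sum>k\<in>K. (\<Sum>i<n. y i w * X (i, k) w)\<^sup>2) / (\<Sum>i<n. (y i w)\<^sup>2)))) *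
            indicator {w. 0 < (\<Sum>i<n. (y i w)\<^sup>2)} w \<partial>M)
     \<le> ennreal ((1 - 2 * \<theta>) powr (- real (card K) / 2))"
proof -
  let ?A = "{..<n} \<times> G" and ?B = "{..<n} \<times> K"
  let ?PA = "PiM ?A (\<lambda>_. borel :: real measure)" and ?PB = "PiM ?B (\<lambda>_. borel :: real measure)"
  let ?XA = "\<lambda>w. \<lambda>a\<in>?A. X a w" and ?XB = "\<lambda>w. \<lambda>a\<in>?B. X a w"
  define Y where "Y i f = (\<Sum>j\<in>G. g j * f (i, j))" for i :: nat and f :: "nat \<times> 'j \<Rightarrow> real"
  \<comment> \<open>As a function of the two blocks of columns the integrand can be integrated by
    Fubini over the product of their laws, which replaces conditioning on the columns in
    \<open>G\<close>. The last factor excludes y = 0, where the direction of y is undefined.\<close>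
  define F where "F f h = ennreal (exp (\<theta> * ((\<Sum>k\<in>K. (\<Sum>i<n. Y i f * h (i, k))\<^sup>2) / (\<Sum>i<n. (Y i f)\<^sup>2)))) *
      (if 0 < (\<Sum>i<n. (Y i f)\<^sup>2) then 1 else 0)" for f h
  have ind: "indep_var ?PA ?XA ?PB ?XB"
    using X G K GK by (intro indep_var_restrict[where I = "{..<n} \<times> J"]) (auto simp: std_normals_def)
  then have rv[measurable]: "?XA \<in> M \<rightarrow>\<^sub>M ?PA" "?XB \<in> M \<rightarrow>\<^sub>M ?PB"
    and eq: "distr M ?PA ?XA \<Otimes>\<^sub>M distr M ?PB ?XB = distr M (?PA \<Otimes>\<^sub>M ?PB) (\<lambda>x. (?XA x, ?XB x))"
    unfolding indep_var_distribution_eq by auto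
  have Ym[measurable]: "Y i \<in> ?PA \<rightarrow>\<^sub>M borel" if "i < n" for i
    unfolding Y_def using that
    by (intro borel_measurable_sum borel_measurable_times borel_measurable_const measurable_component_singleton) auto
  have hm[measurable]: "(\<lambda>h. h (i, k)) \<in> ?PB \<rightarrow>\<^sub>M borel" if "i < n" "k \<in> K" for i k
    using that by (intro measurable_component_singleton) auto
  have Fm[measurable]: "(\<lambda>(f, h). F f h) \<in> ?PA \<Otimes>\<^sub>M ?PB \<rightarrow>\<^sub>M borel"
    unfolding F_def by measurable
  interpret XB: prob_space "distr M ?PB ?XB" by (rule prob_space_distr) fact
  interpret XA: prob_space "distr M ?PA ?XA" by (rule prob_space_distr) fact
  have yY: "y i w = Y i (?XA w)" if "i < n" for i w
    using that by (auto simp: y_def Y_def intro!: sum.cong)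
  have "(\<integral>\<^sup>+w. ennreal (exp (\<theta> * ((\<Sum>k\<in>K. (\<Sum>i<n. y i w * X (i, k) w)\<^sup>2) / (\<Sum>i<n. (y i w)\<^sup>2)))) *
            indicator {w. 0 < (\<Sum>i<n. (y i w)\<^sup>2)} w \<partial>M) = (\<integral>\<^sup>+w. F (?XA w) (?XB w) \<partial>M)"
    unfolding F_def by (intro nn_integral_cong) (simp add: yY indicator_def)
  also have "\<dots> = (\<integral>\<^sup>+z. (\<lambda>(f, h). F f h) z \<partial>distr M (?PA \<Otimes>\<^sub>M ?PB) (\<lambda>x. (?XA x, ?XB x)))"
    by (subst nn_integral_distr) auto
  also have "\<dots> = (\<integral>\<^sup>+f. \<integral>\<^sup>+h. F f h \<partial>distr M ?PB ?XB \<partial>distr M ?PA ?XA)"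
    unfolding eq[symmetric] by (subst XB.nn_integral_fst[symmetric]) auto
  also have "\<dots> \<le> (\<integral>\<^sup>+f. ennreal ((1 - 2 * \<theta>) powr (- real (card K) / 2)) \<partial>distr M ?PA ?XA)"
  proof (rule nn_integral_mono)
    fix f assume "f \<in> space (distr M ?PA ?XA)"
    then have f: "f \<in> space ?PA" by simp
    have [measurable]: "(\<lambda>h. F f h) \<in> ?PB \<rightarrow>\<^sub>M borel"
      unfolding F_def by measurable
    have "(\<integral>\<^sup>+h. F f h \<partial>distr M ?PB ?XB) = (\<integral>\<^sup>+w. F f (?XB w) \<partial>M)"
      by (subst nn_integral_distr) auto
    also have "\<dots> \<le> ennreal ((1 - 2 * \<theta>) powr (- real (card K) / 2))"
    proof (cases "0 < (\<Sum>i<n. (Y i f)\<^sup>2)")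
      case False
      then show ?thesis by (simp add: F_def)
    next
      case True
      define r where "r = sqrt (\<Sum>i<n. (Y i f)\<^sup>2)"
      have r: "r > 0" "r\<^sup>2 = (\<Sum>i<n. (Y i f)\<^sup>2)" using True by (auto simp: r_def)
      have eqs: "(\<Sum>a\<in>{..<n} \<times> {k}. \<phi> a) = (\<Sum>i<n. \<phi> (i, k))" for \<phi> :: "_ \<Rightarrow> real" and k :: 'j
        using sum.cartesian_product[of "\<lambda>i j. \<phi> (i, j)" "{k}" "{..<n}", symmetric] by simp
      have "std_normals M (\<lambda>k w. \<Sum>a\<in>{..<n} \<times> {k}. (Y (fst a) f / r) * X a w) K"
        using K r by (intro std_normals_combinations[OF X])
          (auto simp: disjoint_family_on_def eqs power_divide sum_divide_distrib[symmetric])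
      then have "std_normals M (\<lambda>k w. \<Sum>i<n. (Y i f / r) * X (i, k) w) K" by (simp add: eqs)
      from chi_square_mgf[OF this \<open>finite K\<close> \<theta>]
      have 1: "(\<integral>\<^sup>+w. ennreal (exp (\<theta> * (\<Sum>k\<in>K. (\<Sum>i<n. (Y i f / r) * X (i, k) w)\<^sup>2))) \<partial>M)
         = ennreal ((1 - 2 * \<theta>) powr (- real (card K) / 2))" .
      have "F f (?XB w) = ennreal (exp (\<theta> * (\<Sum>k\<in>K. (\<Sum>i<n. (Y i f / r) * X (i, k) w)\<^sup>2)))" for w
      proof -
        have "(\<Sum>i<n. (Y i f / r) * X (i, k) w) = (\<Sum>i<n. Y i f * X (i, k) w) / r" for k
          by (simp add: sum_divide_distrib)
        then have "(\<Sum>k\<in>K. (\<Sum>i<n. (Y i f / r) * X (i, k) w)\<^sup>2) = (\<Sum>k\<in>K. (\<Sum>i<n. Y i f * X (i, k) w)\<^sup>2) / (\<Sum>i<n. (Y i f)\<^sup>2)"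
          by (simp only: power_divide r(2) sum_divide_distrib[symmetric])
        then show ?thesis using True by (simp add: F_def)
      qed
      then show ?thesis using 1 by simp
    qed
    finally show "(\<integral>\<^sup>+h. F f h \<partial>distr M ?PB ?XB) \<le> ennreal ((1 - 2 * \<theta>) powr (- real (card K) / 2))" .
  qed
  also have "\<dots> = ennreal ((1 - 2 * \<theta>) powr (- real (card K) / 2))"
    using XA.emeasure_space_1 by simp
  finally show ?thesis .
qed

text \<open>Multiplication by \<theta> lets one statement serve both tails: a positive \<theta>
  bounds the projected energy from above, a negative one from below.\<close>

lemma projected_columns_tail:
  fixes g :: "'j \<Rightarrow> real" and n :: nat
  assumes X: "std_normals M X ({..<n} \<times> J)" and G: "G \<subseteq> J" "finite G" and K: "K \<subseteq> J" "finite K" and GK: "G \<inter> K = {}"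
    and \<theta>: "\<theta> < 1/2"
  defines "y \<equiv> \<lambda>i w. \<Sum>j\<in>G. g j * X (i, j) w"
  shows "prob {w\<in>space M. 0 < (\<Sum>i<n. (y i w)\<^sup>2) \<and>
       \<theta> * t * (\<Sum>i<n. (y i w)\<^sup>2) \<le> \<theta> * (\<Sum>k\<in>K. (\<Sum>i<n. y i w * X (i, k) w)\<^sup>2)}
     \<le> exp (- \<theta> * t) * (1 - 2 * \<theta>) powr (- real (card K) / 2)"
proof -
  have [measurable]: "X (i, j) \<in> borel_measurable M" if "i < n" "j \<in> G" for i j
    using std_normals_measurable[OF X] that G by auto
  have [measurable]: "X (i, j) \<in> borel_measurable M" if "i < n" "j \<in> K" for i j
    using std_normals_measurable[OF X] that K by auto
  have [measurable]: "y i \<in> borel_measurable M" if "i < n" for i unfolding y_def using that by measurable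
  define N where "N w = (\<Sum>i<n. (y i w)\<^sup>2)" for w
  define Q where "Q w = (\<Sum>k\<in>K. (\<Sum>i<n. y i w * X (i, k) w)\<^sup>2)" for w
  have [measurable]: "N \<in> borel_measurable M" "Q \<in> borel_measurable M" unfolding N_def Q_def by measurable
  define f where "f w = ennreal (exp (\<theta> * (Q w / N w))) * indicator {w. 0 < N w} w" for w
  have [measurable]: "f \<in> borel_measurable M" unfolding f_def by measurable
  have "emeasure M {w\<in>space M. 0 < N w \<and> \<theta> * t * N w \<le> \<theta> * Q w}
     \<le> emeasure M ({w\<in>space M. 1 \<le> ennreal (exp (- \<theta> * t)) * f w})"
  proof (rule emeasure_mono)
    show "{w\<in>space M. 0 < N w \<and> \<theta> * t * N w \<le> \<theta> * Q w} \<subseteq> {w\<in>space M. 1 \<le> ennreal (exp (- \<theta> * t)) * f w}"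
    proof clarsimp
      fix w assume "0 < N w" "\<theta> * t * N w \<le> \<theta> * Q w"
      then have "1 \<le> exp (- \<theta> * t) * exp (\<theta> * (Q w / N w))"
        unfolding exp_add[symmetric] one_le_exp_iff by (simp add: field_simps)
      then show "1 \<le> ennreal (exp (- (\<theta> * t))) * f w"
        using \<open>0 < N w\<close> by (simp add: f_def ennreal_mult[symmetric])
    qed
  qed measurable
  also have "\<dots> \<le> ennreal (exp (- \<theta> * t)) * (\<integral>\<^sup>+w. f w * indicator (space M) w \<partial>M)"
    using nn_integral_Markov_inequality[of f "space M" M "ennreal (exp (- \<theta> * t))"] by simp
  also have "(\<integral>\<^sup>+w. f w * indicator (space M) w \<partial>M) = (\<integral>\<^sup>+w. f w \<partial>M)"
    by (rule nn_integral_cong) simp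
  also have "ennreal (exp (- \<theta> * t)) * (\<integral>\<^sup>+w. f w \<partial>M) \<le> ennreal (exp (- \<theta> * t)) * ennreal ((1 - 2 * \<theta>) powr (- real (card K) / 2))"
    unfolding f_def Q_def N_def y_def
    by (intro mult_left_mono projected_columns_mgf[OF X G K GK \<theta>]) auto
  also have "\<dots> = ennreal (exp (- \<theta> * t) * (1 - 2 * \<theta>) powr (- real (card K) / 2))" by (simp add: ennreal_mult[symmetric])
  finally show ?thesis by (simp add: emeasure_eq_measure N_def Q_def)
qed

end

section \<open>The operator norm of a Gaussian sample covariance\<close>

text \<open>From k to k + 1 the left side grows at most by the factor 2 (k + 1), because (1 + 1/k)^k
  \<le> e, while (2k)! / (2^k k!) grows by 2k + 1; the factor k + 1 makes up the difference. The
  loss is polynomial and thus harmless against an exponential tail.\<close>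

lemma double_factorial_lower:
  "(2 * real k / exp 1) ^ k \<le> (real k + 1) * (fact (2 * k) / (2^k * fact k))"
proof (induction k)
  case 0 then show ?case by simp
next
  case (Suc k)
  define d where "d k = (fact (2 * k) / (2^k * fact k) :: real)" for k
  have d0: "d k \<ge> 0" for k by (simp add: d_def)
  have dS: "d (Suc k) = (2 * real k + 1) * d k"
  proof -
    have "fact (2 * Suc k) = (2 * real k + 2) * (2 * real k + 1) * fact (2 * k)"
      by (simp add: algebra_simps)
    then show ?thesis by (simp add: d_def divide_simps) (simp add: algebra_simps)?
  qed
  have e: "(1 + 1 / real k) ^ k \<le> exp 1" if "k > 0"
    using exp_ge_one_plus_x_over_n_power_n[of k 1] that by simp
  have "(2 * real (Suc k) / exp 1) ^ Suc k \<le> (2 * real (Suc k)) * (2 * real k / exp 1) ^ k"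
  proof (cases "k = 0")
    case True then show ?thesis by (simp add: divide_simps)
  next
    case False
    have "(2 * real (Suc k) / exp 1) ^ Suc k = 2 * real (Suc k) / exp 1 * ((2 * real k / exp 1) * (1 + 1 / real k)) ^ k"
    proof -
      have "2 * real (Suc k) / exp 1 = (2 * real k / exp 1) * (1 + 1 / real k)"
        using False by (simp add: field_simps)
      then show ?thesis by (simp only: power_Suc)
    qed
    also have "\<dots> = 2 * real (Suc k) * (2 * real k / exp 1) ^ k * ((1 + 1 / real k) ^ k / exp 1)"
      by (simp only: power_mult_distrib) (simp add: field_simps)
    also have "\<dots> \<le> 2 * real (Suc k) * (2 * real k / exp 1) ^ k * 1"
      using e False by (intro mult_left_mono) (auto simp: divide_le_eq_1)
    finally show ?thesis by simp
  qed
  also have "\<dots> \<le> (2 * real (Suc k)) * ((real k + 1) * d k)"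
    using Suc by (intro mult_left_mono) (auto simp: d_def)
  also have "\<dots> \<le> (real k + 2) * (2 * real k + 1) * d k"
    using d0[of k] by (simp add: algebra_simps)
  also have "\<dots> = (real (Suc k) + 1) * d (Suc k)" unfolding dS by simp
  finally show ?case by (simp add: d_def)
qed

section \<open>Decoupling by auxiliary Gaussian vectors\<close>

definition gauss_product :: "'j set \<Rightarrow> ('j \<Rightarrow> real) measure" where
  "gauss_product J = PiM J (\<lambda>_. density lborel std_normal_density)"

lemma prob_space_gauss_product: "prob_space (gauss_product J)"
  unfolding gauss_product_def by (intro prob_space_PiM prob_space_normal_density) simp

lemma measurable_gauss_product_component:
  "j \<in> J \<Longrightarrow> (\<lambda>f. f j) \<in> borel_measurable (gauss_product J)"
proof -
  assume "j \<in> J"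
  then have "(\<lambda>f. f j) \<in> gauss_product J \<rightarrow>\<^sub>M density lborel std_normal_density"
    unfolding gauss_product_def by (rule measurable_component_singleton)
  then show ?thesis by simp
qed

lemma std_normals_gauss_product:
  assumes "J \<noteq> {}"
  shows "std_normals (gauss_product J) (\<lambda>j f. f j) J"
proof -
  let ?D = "density lborel std_normal_density"
  interpret prob_space "gauss_product J" by (rule prob_space_gauss_product)
  have d: "distr (gauss_product J) borel (\<lambda>f. f j) = ?D" if "j \<in> J" for j
  proof -
    have "distr (gauss_product J) ?D (\<lambda>f. f j) = ?D"
      unfolding gauss_product_def by (rule distr_PiM_component) (use that in \<open>auto intro: prob_space_normal_density\<close>)
    moreover have "distr (gauss_product J) ?D (\<lambda>f. f j) = distr (gauss_product J) borel (\<lambda>f. f j)"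
      by (rule distr_cong) auto
    ultimately show ?thesis by simp
  qed
  have "distr (gauss_product J) (PiM J (\<lambda>_. borel)) (\<lambda>f. \<lambda>j\<in>J. f j) = distr (gauss_product J) (gauss_product J) (\<lambda>f. f)"
    by (rule distr_cong) (auto simp: gauss_product_def space_PiM PiE_def extensional_restrict intro!: sets_PiM_cong)
  also have "\<dots> = gauss_product J" by (rule distr_id2) simp
  also have "\<dots> = PiM J (\<lambda>j. distr (gauss_product J) borel (\<lambda>f. f j))"
  proof -
    have "PiM J (\<lambda>_. ?D) = PiM J (\<lambda>j. distr (gauss_product J) borel (\<lambda>f. f j))"
      by (rule PiM_cong[OF refl]) (simp only: d)
    then show ?thesis by (simp only: gauss_product_def[symmetric])
  qed
  finally have "indep_vars (\<lambda>_. borel) (\<lambda>j f. f j) J"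
    by (subst indep_vars_iff_distr_eq_PiM'[OF assms]) (auto simp: measurable_gauss_product_component)
  moreover have "distributed (gauss_product J) lborel (\<lambda>f. f j) std_normal_density" if "j \<in> J" for j
  proof -
    have "distr (gauss_product J) lborel (\<lambda>f. f j) = distr (gauss_product J) borel (\<lambda>f. f j)"
      by (rule distr_cong) auto
    then show ?thesis using d[OF that] that by (auto simp: distributed_def measurable_gauss_product_component)
  qed
  ultimately show ?thesis by (simp add: std_normals_def)
qed

text \<open>The bound x^k \<le> (k/e)^k exp x at x = |f|^2 / 4 leaves the chi-square transform at
  \<theta> = 1/4. That is 2^(card J / 2), hence at most 2^k: an order of moment comparable to the
  dimension costs only a constant in the base.\<close>

lemma gauss_product_norm_moment:
  assumes "finite J" "J \<noteq> {}" "card J \<le> 2 * k"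
  shows "(\<integral>\<^sup>+f. ennreal ((\<Sum>j\<in>J. (f j)\<^sup>2) ^ k) \<partial>gauss_product J) \<le> ennreal ((8 * real k / exp 1) ^ k)"
proof -
  interpret prob_space "gauss_product J" by (rule prob_space_gauss_product)
  note [measurable] = measurable_gauss_product_component[of _ J]
  have k: "k \<ge> 1" using assms by (cases k) auto
  have pw: "(\<Sum>j\<in>J. (f j)\<^sup>2) ^ k \<le> (4 * real k / exp 1) ^ k * exp (1/4 * (\<Sum>j\<in>J. (f j)\<^sup>2))" for f :: "_ \<Rightarrow> real"
  proof -
    have "(\<Sum>j\<in>J. (f j)\<^sup>2) ^ k = 4 ^ k * (1/4 * (\<Sum>j\<in>J. (f j)\<^sup>2)) ^ k"
      unfolding power_mult_distrib[symmetric] by simp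
    also have "\<dots> \<le> 4 ^ k * ((real k / exp 1) ^ k * exp (1/4 * (\<Sum>j\<in>J. (f j)\<^sup>2)))"
      by (intro mult_left_mono power_le_exp k) (auto intro: sum_nonneg)
    also have "\<dots> = (4 * real k / exp 1) ^ k * exp (1/4 * (\<Sum>j\<in>J. (f j)\<^sup>2))"
      unfolding mult.assoc[symmetric] power_mult_distrib[symmetric] by simp
    finally show ?thesis .
  qed
  have "(\<integral>\<^sup>+f. ennreal ((\<Sum>j\<in>J. (f j)\<^sup>2) ^ k) \<partial>gauss_product J)
    \<le> (\<integral>\<^sup>+f. ennreal ((4 * real k / exp 1) ^ k) * ennreal (exp (1/4 * (\<Sum>j\<in>J. (f j)\<^sup>2))) \<partial>gauss_product J)"
    by (intro nn_integral_mono) (use pw in \<open>simp add: ennreal_mult[symmetric]\<close>)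
  also have "\<dots> = ennreal ((4 * real k / exp 1) ^ k) * ennreal ((1 - 2 * (1/4)) powr (- real (card J) / 2))"
    using chi_square_mgf[OF std_normals_gauss_product[OF assms(2)] assms(1), of "1/4"]
    by (subst nn_integral_cmult) auto
  also have "\<dots> \<le> ennreal ((4 * real k / exp 1) ^ k) * ennreal (2 ^ k)"
  proof (intro mult_left_mono ennreal_leI)
    have "(1 - 2 * (1/4)) powr (- real (card J) / 2) = (2::real) powr (real (card J) / 2)"
      by (simp add: powr_minus powr_divide)
    also have "\<dots> \<le> 2 powr real k" using assms by (intro powr_mono) auto
    finally show "(1 - 2 * (1/4)) powr (- real (card J) / 2) \<le> (2::real) ^ k" by (simp add: powr_realpow)
  qed auto
  also have "\<dots> = ennreal ((8 * real k / exp 1) ^ k)"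
    by (subst ennreal_mult[symmetric]) (auto simp: power_mult_distrib[symmetric])
  finally show ?thesis .
qed

text \<open>Replacing the quadratic form by the bilinear form at two independent Gaussian vectors costs only
  the two Gaussian moments: fixing one vector, the moment in the other is an Euclidean norm, which
  dominates the inner product with \<open>x\<close>.\<close>

lemma decoupled_moment_lower:
  fixes C :: "'j \<Rightarrow> 'j \<Rightarrow> real" and k :: nat
  assumes "finite J" "J \<noteq> {}" and x: "(\<Sum>j\<in>J. (x j)\<^sup>2) = 1"
  defines "d \<equiv> (fact (2 * k) / (2^k * fact k) :: real)"
  shows "ennreal (d\<^sup>2 * (\<Sum>i\<in>J. \<Sum>j\<in>J. x i * C i j * x j) ^ (2*k))
     \<le> (\<integral>\<^sup>+g. \<integral>\<^sup>+h. ennreal ((\<Sum>i\<in>J. \<Sum>j\<in>J. g i * C i j * h j) ^ (2*k)) \<partial>gauss_product J \<partial>gauss_product J)"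
proof -
  interpret prob_space "gauss_product J" by (rule prob_space_gauss_product)
  note [measurable] = measurable_gauss_product_component[of _ J]
  note N = std_normals_gauss_product[OF assms(2)]
  have d0: "d \<ge> 0" by (simp add: d_def)
  have CS: "(\<Sum>j\<in>J. u j * v j)\<^sup>2 \<le> (\<Sum>j\<in>J. (u j)\<^sup>2) * (\<Sum>j\<in>J. (v j)\<^sup>2)" for u v :: "'j \<Rightarrow> real"
    by (rule Cauchy_Schwarz_ineq_sum)
  define a where "a g j = (\<Sum>i\<in>J. g i * C i j)" for g j
  define b where "b i = (\<Sum>j\<in>J. C i j * x j)" for i
  have gh: "(\<Sum>i\<in>J. \<Sum>j\<in>J. g i * C i j * h j) = (\<Sum>j\<in>J. a g j * h j)" for g h
    unfolding a_def sum_distrib_right by (rule sum.swap)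
  have gx: "(\<Sum>i\<in>J. \<Sum>j\<in>J. g i * C i j * x j) = (\<Sum>j\<in>J. b j * g j)" for g
    unfolding b_def sum_distrib_right by (simp add: mult_ac)
  have inner: "(\<integral>\<^sup>+h. ennreal ((\<Sum>i\<in>J. \<Sum>j\<in>J. g i * C i j * h j) ^ (2*k)) \<partial>gauss_product J)
     \<ge> ennreal d * ennreal ((\<Sum>j\<in>J. b j * g j) ^ (2*k))" for g
  proof -
    have "(\<Sum>j\<in>J. b j * g j)\<^sup>2 \<le> (\<Sum>j\<in>J. (a g j)\<^sup>2)"
      using CS[of "a g" x] x unfolding gx[symmetric] gh by simp
    then have "(\<Sum>j\<in>J. b j * g j) ^ (2*k) \<le> (\<Sum>j\<in>J. (a g j)\<^sup>2) ^ k"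
      unfolding power_mult by (intro power_mono) auto
    then have "ennreal d * ennreal ((\<Sum>j\<in>J. b j * g j) ^ (2*k)) \<le> ennreal ((\<Sum>j\<in>J. (a g j)\<^sup>2) ^ k * d)"
      using d0 by (subst ennreal_mult[symmetric]) (auto simp: mult.commute[of d] intro!: mult_right_mono ennreal_leI)
    also have "\<dots> = (\<integral>\<^sup>+h. ennreal ((\<Sum>i\<in>J. \<Sum>j\<in>J. g i * C i j * h j) ^ (2*k)) \<partial>gauss_product J)"
      using gaussian_moment_even[OF N assms(1), of "a g" k] unfolding gh d_def by simp
    finally show ?thesis .
  qed
  have "(\<Sum>i\<in>J. \<Sum>j\<in>J. x i * C i j * x j)\<^sup>2 \<le> (\<Sum>j\<in>J. (b j)\<^sup>2)"
    using CS[of b x] x unfolding gx by simp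
  then have "(\<Sum>i\<in>J. \<Sum>j\<in>J. x i * C i j * x j) ^ (2*k) \<le> (\<Sum>j\<in>J. (b j)\<^sup>2) ^ k"
    unfolding power_mult by (intro power_mono) auto
  then have "ennreal (d\<^sup>2 * (\<Sum>i\<in>J. \<Sum>j\<in>J. x i * C i j * x j) ^ (2*k)) \<le> ennreal (d\<^sup>2 * (\<Sum>j\<in>J. (b j)\<^sup>2) ^ k)"
    by (intro ennreal_leI mult_left_mono) auto
  also have "\<dots> = ennreal d * ennreal ((\<Sum>j\<in>J. (b j)\<^sup>2) ^ k * d)"
    using d0 by (subst ennreal_mult[symmetric]) (auto simp: power2_eq_square[of d] mult_ac sum_nonneg)
  also have "\<dots> = ennreal d * (\<integral>\<^sup>+g. ennreal ((\<Sum>j\<in>J. b j * g j) ^ (2*k)) \<partial>gauss_product J)"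
    using gaussian_moment_even[OF N assms(1), of b k] unfolding d_def by simp
  also have "\<dots> = (\<integral>\<^sup>+g. ennreal d * ennreal ((\<Sum>j\<in>J. b j * g j) ^ (2*k)) \<partial>gauss_product J)"
    by (rule nn_integral_cmult[symmetric]) measurable
  also have "\<dots> \<le> (\<integral>\<^sup>+g. \<integral>\<^sup>+h. ennreal ((\<Sum>i\<in>J. \<Sum>j\<in>J. g i * C i j * h j) ^ (2*k)) \<partial>gauss_product J \<partial>gauss_product J)"
    by (intro nn_integral_mono inner)
  finally show ?thesis .
qed

context prob_space
begin

text \<open>By normalised polarisation the bilinear error is a b times a convex combination of two
  centred chi-square means, one of them with reversed sign. Convexity of the even power then reduces
  its moment to theirs.\<close>

lemma gaussian_bilinear_moment:
  fixes n :: nat and s :: real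
  assumes X: "std_normals M X ({..<n} \<times> J)" and "finite J" and "n > 0" and s: "0 < s" "s < 1" and k: "k \<ge> 1"
  defines "B \<equiv> 2 * (4 * real k / (exp 1 * s * n)) ^ (2*k) * exp (n * s\<^sup>2 / (4 * (1 - s)))"
  shows "(\<integral>\<^sup>+w. ennreal (((\<Sum>i<n. (\<Sum>j\<in>J. g j * X (i, j) w) * (\<Sum>j\<in>J. h j * X (i, j) w)) / n - (\<Sum>j\<in>J. g j * h j)) ^ (2*k)) \<partial>M)
      \<le> ennreal ((\<Sum>j\<in>J. (g j)\<^sup>2) ^ k) * ennreal ((\<Sum>j\<in>J. (h j)\<^sup>2) ^ k) * ennreal B"
proof (cases "L2_set g J = 0 \<or> L2_set h J = 0")
  case True
  then have "(\<forall>j\<in>J. g j = 0) \<or> (\<forall>j\<in>J. h j = 0)"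
    using assms(2) by (simp add: L2_set_eq_0_iff)
  then have "((\<Sum>i<n. (\<Sum>j\<in>J. g j * X (i, j) w) * (\<Sum>j\<in>J. h j * X (i, j) w)) / n - (\<Sum>j\<in>J. g j * h j)) ^ (2*k) = 0" for w
    using k by auto
  then show ?thesis by (simp only: ennreal_0) simp
next
  case False
  define a b where "a = L2_set g J" and "b = L2_set h J"
  have ab: "a > 0" "b > 0" using False L2_set_nonneg[of g J] L2_set_nonneg[of h J] by (auto simp: a_def b_def less_le)
  have a2: "(\<Sum>j\<in>J. (g j)\<^sup>2) = a\<^sup>2" and b2: "(\<Sum>j\<in>J. (h j)\<^sup>2) = b\<^sup>2"
    by (auto simp: a_def b_def L2_set_def sum_nonneg)
  have [measurable]: "X (i, j) \<in> borel_measurable M" if "i < n" "j \<in> J" for i j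
    using std_normals_measurable[OF X] that by auto
  have B0: "B \<ge> 0" using s by (simp add: B_def)
  define u where "u d j = g j / a + d * (h j / b)" for d j
  define N where "N d = (\<Sum>j\<in>J. (u d j)\<^sup>2)" for d
  have N0: "N d \<ge> 0" for d by (simp add: N_def sum_nonneg)
  define Q where "Q d w = (\<Sum>i<n. (\<Sum>j\<in>J. u d j * X (i, j) w)\<^sup>2) / n - N d" for d w
  define P where "P w = (\<Sum>i<n. (\<Sum>j\<in>J. g j * X (i, j) w) * (\<Sum>j\<in>J. h j * X (i, j) w)) / n - (\<Sum>j\<in>J. g j * h j)" for w
  have [measurable]: "Q d \<in> borel_measurable M" for d unfolding Q_def by measurable
  have [measurable]: "P \<in> borel_measurable M" unfolding P_def by measurable
  have pol: "Q 1 w - Q (-1) w = 4 * P w / (a * b)" for w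
    unfolding Q_def N_def u_def P_def by (rule normalized_polarization(2)[OF ab a2 b2])
  have par: "N 1 + N (-1) = 4"
    unfolding N_def u_def by (rule normalized_polarization(1)[OF ab a2 b2])
  \<comment> \<open>z is the centred mean square of the normalised row projections. If
    \<open>u d\<close> vanishes, as it does for one sign when g and h are proportional, z = 0 takes
    its place.\<close>
  have unit: "\<exists>z. z \<in> borel_measurable M \<and> (\<forall>w. Q d w = N d * z w) \<and> (\<integral>\<^sup>+w. ennreal (z w ^ (2*k)) \<partial>M) \<le> ennreal B" for d
  proof (cases "N d = 0")
    case True
    then have "u d j = 0" if "j \<in> J" for j using that assms(2) by (simp add: N_def sum_nonneg_eq_0_iff)
    then have "Q d w = 0" for w using True by (simp add: Q_def)
    moreover have "(0::real) ^ (2*k) = 0" using k by simp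
    ultimately show ?thesis using True by (intro exI[of _ "\<lambda>_. 0"]) (auto simp: zero_power)
  next
    case False
    define r where "r = sqrt (N d)"
    have r: "r > 0" "r\<^sup>2 = N d" using False N0[of d] by (auto simp: r_def less_le)
    define z where "z w = (\<Sum>i<n. (\<Sum>j\<in>J. (u d j / r) * X (i, j) w)\<^sup>2) / real n - 1" for w
    have "std_normals M (\<lambda>i w. \<Sum>j\<in>J. (u d j / r) * X (i, j) w) {..<n}"
      using r False by (intro std_normals_rows[OF X \<open>finite J\<close>])
        (auto simp: power_divide sum_divide_distrib[symmetric] N_def[symmetric])
    from centered_chi_square_moment[OF this, of s k] s k \<open>n > 0\<close>
    have "(\<integral>\<^sup>+w. ennreal (z w ^ (2*k)) \<partial>M) \<le> ennreal B" by (auto simp: z_def B_def lessThan_empty_iff)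
    moreover have "Q d w = N d * z w" for w
    proof -
      have "(\<Sum>j\<in>J. u d j * X (i, j) w) = r * (\<Sum>j\<in>J. (u d j / r) * X (i, j) w)" for i
        using r(1) by (simp add: sum_distrib_left)
      then show ?thesis unfolding Q_def z_def r(2)[symmetric]
        by (simp add: power_mult_distrib sum_distrib_left[symmetric] algebra_simps)
    qed
    moreover have "z \<in> borel_measurable M" unfolding z_def by measurable
    ultimately show ?thesis by blast
  qed
  obtain z1 where z1[measurable]: "z1 \<in> borel_measurable M" and "\<And>w. Q 1 w = N 1 * z1 w" "(\<integral>\<^sup>+w. ennreal (z1 w ^ (2*k)) \<partial>M) \<le> ennreal B"
    using unit[of 1] by blast
  note z1' = this(2,3)
  obtain z2 where z2[measurable]: "z2 \<in> borel_measurable M" and "\<And>w. Q (-1) w = N (-1) * z2 w" "(\<integral>\<^sup>+w. ennreal (z2 w ^ (2*k)) \<partial>M) \<le> ennreal B"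
    using unit[of "-1"] by blast
  note z2' = this(2,3)
  define \<tau> where "\<tau> = N (-1) / 4"
  have \<tau>: "0 \<le> \<tau>" "\<tau> \<le> 1" "N 1 = 4 * (1 - \<tau>)" "N (-1) = 4 * \<tau>" using par N0[of 1] N0[of "-1"] by (auto simp: \<tau>_def)
  have pw: "P w ^ (2*k) \<le> (a * b) ^ (2*k) * ((1 - \<tau>) * z1 w ^ (2*k) + \<tau> * z2 w ^ (2*k))" for w
  proof -
    have "P w = a * b * ((1 - \<tau>) * z1 w + \<tau> * (- z2 w))"
      using pol[of w] ab unfolding z1'(1) z2'(1) \<tau>(3,4) by (simp add: field_simps)
    then have "P w ^ (2*k) = (a * b) ^ (2*k) * ((1 - \<tau>) * z1 w + \<tau> * (- z2 w)) ^ (2*k)"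
      by (simp only: power_mult_distrib)
    also have "((1 - \<tau>) * z1 w + \<tau> * (- z2 w)) ^ (2*k) \<le> (1 - \<tau>) * z1 w ^ (2*k) + \<tau> * (- z2 w) ^ (2*k)"
      using convex_onD[OF convex_power_even[of "2*k"] \<tau>(1,2), of "z1 w" "- z2 w"] by simp
    finally show ?thesis using ab by simp
  qed
  have "(\<integral>\<^sup>+w. ennreal (P w ^ (2*k)) \<partial>M) \<le>
     (\<integral>\<^sup>+w. ennreal ((a * b) ^ (2*k)) * (ennreal (1 - \<tau>) * ennreal (z1 w ^ (2*k)) + ennreal \<tau> * ennreal (z2 w ^ (2*k))) \<partial>M)"
  proof (rule nn_integral_mono)
    fix w
    have aff: "ennreal c * (ennreal p * ennreal q + ennreal r * ennreal t) = ennreal (c * (p * q + r * t))"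
      if "0 \<le> c" "0 \<le> p" "0 \<le> q" "0 \<le> r" "0 \<le> t" for c p q r t :: real
      using that by (simp add: ennreal_mult)
    show "ennreal (P w ^ (2*k)) \<le> ennreal ((a * b) ^ (2*k)) * (ennreal (1 - \<tau>) * ennreal (z1 w ^ (2*k)) + ennreal \<tau> * ennreal (z2 w ^ (2*k)))"
      by (subst aff) (use pw[of w] \<tau> ab in \<open>auto intro!: ennreal_leI\<close>)
  qed
  also have "\<dots> = ennreal ((a * b) ^ (2*k)) * (ennreal (1 - \<tau>) * (\<integral>\<^sup>+w. ennreal (z1 w ^ (2*k)) \<partial>M) + ennreal \<tau> * (\<integral>\<^sup>+w. ennreal (z2 w ^ (2*k)) \<partial>M))"
  proof -
    have "(\<integral>\<^sup>+w. c * (p * f w + q * h w) \<partial>M) = c * (p * (\<integral>\<^sup>+w. f w \<partial>M) + q * (\<integral>\<^sup>+w. h w \<partial>M))"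
      if "f \<in> borel_measurable M" "h \<in> borel_measurable M" for c p q :: ennreal and f h
      using that by (simp add: nn_integral_cmult nn_integral_add)
    from this[OF measurable_compose[OF borel_measurable_power[OF z1] measurable_ennreal]
        measurable_compose[OF borel_measurable_power[OF z2] measurable_ennreal]]
    show ?thesis .
  qed
  also have "\<dots> \<le> ennreal ((a * b) ^ (2*k)) * (ennreal (1 - \<tau>) * ennreal B + ennreal \<tau> * ennreal B)"
    by (intro mult_left_mono add_mono z1' z2') auto
  also have "ennreal (1 - \<tau>) * ennreal B + ennreal \<tau> * ennreal B = ennreal B"
    unfolding distrib_right[symmetric] using \<tau> by (subst ennreal_plus[symmetric]) auto
  also have "ennreal ((a * b) ^ (2*k)) * ennreal B = ennreal ((\<Sum>j\<in>J. (g j)\<^sup>2) ^ k) * ennreal ((\<Sum>j\<in>J. (h j)\<^sup>2) ^ k) * ennreal B"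
  proof -
    have "(a * b) ^ (2*k) = (a\<^sup>2) ^ k * (b\<^sup>2) ^ k" by (simp add: power_mult_distrib power_mult)
    then show ?thesis unfolding a2 b2 by (simp add: ennreal_mult)
  qed
  finally show ?thesis by (simp add: P_def)
qed

text \<open>For each outcome \<open>G\<close> averages the power 2k of the bilinear error over the
  auxiliary g and h. It does not depend on x, yet dominates d^2 times the power 2k of the quadratic
  error at every unit x, so Markov's inequality for \<open>G\<close> alone controls all directions.
  The mean of \<open>G\<close> is bounded by exchanging the integrals and using the moment bound for
  fixed g and h. The quotient (8k/e)^(2k) / d^2 of Gaussian moments is at most 4^(2k) (k + 1)^2,
  which turns the 4 of the chi-square moment into 16.\<close>

lemma gaussian_matrix_norm_tail:
  fixes n :: nat and s t :: real
  assumes X: "std_normals M X ({..<n} \<times> J)" and J: "finite J" "J \<noteq> {}" and n: "n > 0" and s: "0 < s" "s < 1"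
    and k: "card J \<le> 2 * k" and t: "t > 0"
  shows "\<exists>E\<in>sets M. prob E \<le> 2 * (real k + 1)\<^sup>2 * (16 * real k / (exp 1 * s * n * t)) ^ (2*k) * exp (n * s\<^sup>2 / (4 * (1 - s))) \<and>
     (\<forall>w\<in>space M - E. \<forall>x. (\<Sum>j\<in>J. (x j)\<^sup>2) = 1 \<longrightarrow> \<bar>(\<Sum>i<n. (\<Sum>j\<in>J. x j * X (i, j) w)\<^sup>2) / n - 1\<bar> \<le> t)"
proof -
  have k1: "k \<ge> 1" using J k by (cases k) auto
  define d where "d = (fact (2 * k) / (2^k * fact k) :: real)"
  have d0: "d > 0" by (simp add: d_def)
  let ?\<mu> = "gauss_product J"
  interpret \<mu>: prob_space ?\<mu> by (rule prob_space_gauss_product)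
  interpret \<mu>2: pair_prob_space ?\<mu> ?\<mu> ..
  interpret M\<mu>: pair_sigma_finite M "?\<mu> \<Otimes>\<^sub>M ?\<mu>" ..
  have [measurable]: "X (i, j) \<in> borel_measurable M" if "i < n" "j \<in> J" for i j
    using std_normals_measurable[OF X] that by auto
  define L where "L g i w = (\<Sum>j\<in>J. g j * X (i, j) w)" for g i w
  define W where "W w g h = (\<Sum>i<n. L g i w * L h i w) / n - (\<Sum>j\<in>J. g j * h j)" for w g h
  define C where "C w i j = (\<Sum>l<n. X (l, i) w * X (l, j) w) / n - (if i = j then 1 else 0)" for w i j
  have WC: "W w g h = (\<Sum>i\<in>J. \<Sum>j\<in>J. g i * C w i j * h j)" for w g h
  proof -
    have "(\<Sum>i\<in>J. \<Sum>j\<in>J. g i * C w i j * h j)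
       = (\<Sum>i\<in>J. \<Sum>j\<in>J. (\<Sum>l<n. (g i * X (l, i) w) * (h j * X (l, j) w)) / n) - (\<Sum>i\<in>J. \<Sum>j\<in>J. (if i = j then g i * h j else 0))"
      unfolding sum_subtractf[symmetric] C_def
      by (intro sum.cong refl) (auto simp: algebra_simps sum_distrib_left sum_divide_distrib)
    also have "(\<Sum>i\<in>J. \<Sum>j\<in>J. (if i = j then g i * h j else 0)) = (\<Sum>j\<in>J. g j * h j)"
      using J by (simp add: sum.delta')
    also have "(\<Sum>i\<in>J. \<Sum>j\<in>J. (\<Sum>l<n. (g i * X (l, i) w) * (h j * X (l, j) w)) / n)
       = (\<Sum>l<n. \<Sum>i\<in>J. \<Sum>j\<in>J. (g i * X (l, i) w) * (h j * X (l, j) w)) / n"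
    proof -
      have "(\<Sum>i\<in>J. \<Sum>j\<in>J. (\<Sum>l<n. (g i * X (l, i) w) * (h j * X (l, j) w)))
        = (\<Sum>i\<in>J. \<Sum>l<n. \<Sum>j\<in>J. (g i * X (l, i) w) * (h j * X (l, j) w))"
        by (rule sum.cong[OF refl], rule sum.swap)
      also have "\<dots> = (\<Sum>l<n. \<Sum>i\<in>J. \<Sum>j\<in>J. (g i * X (l, i) w) * (h j * X (l, j) w))"
        by (rule sum.swap)
      finally show ?thesis by (simp add: sum_divide_distrib[symmetric])
    qed
    also have "(\<Sum>l<n. \<Sum>i\<in>J. \<Sum>j\<in>J. (g i * X (l, i) w) * (h j * X (l, j) w)) = (\<Sum>l<n. L g l w * L h l w)"
      unfolding L_def sum_product ..
    finally show ?thesis by (simp add: W_def)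
  qed
  have Xm: "(\<lambda>z. X (i, j) (fst z)) \<in> borel_measurable (M \<Otimes>\<^sub>M (?\<mu> \<Otimes>\<^sub>M ?\<mu>))" if "i < n" "j \<in> J" for i j
    using that by (intro measurable_compose[OF measurable_fst] std_normals_measurable[OF X]) auto
  have gm: "(\<lambda>z. fst (snd z) j) \<in> borel_measurable (M \<Otimes>\<^sub>M (?\<mu> \<Otimes>\<^sub>M ?\<mu>))"
    "(\<lambda>z. snd (snd z) j) \<in> borel_measurable (M \<Otimes>\<^sub>M (?\<mu> \<Otimes>\<^sub>M ?\<mu>))" if "j \<in> J" for j
    by (rule measurable_compose[OF measurable_compose[OF measurable_snd measurable_fst] measurable_gauss_product_component[OF that]],
        rule measurable_compose[OF measurable_compose[OF measurable_snd measurable_snd] measurable_gauss_product_component[OF that]])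
  have Wm: "(\<lambda>z. W (fst z) (fst (snd z)) (snd (snd z))) \<in> borel_measurable (M \<Otimes>\<^sub>M (?\<mu> \<Otimes>\<^sub>M ?\<mu>))"
    unfolding W_def L_def
    by (intro borel_measurable_diff borel_measurable_divide borel_measurable_sum borel_measurable_times
        borel_measurable_const Xm gm) auto
  define F where "F z = ennreal (W (fst z) (fst (snd z)) (snd (snd z)) ^ (2*k))" for z
  have Fm[measurable]: "F \<in> borel_measurable (M \<Otimes>\<^sub>M (?\<mu> \<Otimes>\<^sub>M ?\<mu>))"
    unfolding F_def by (intro measurable_compose[OF borel_measurable_power[OF Wm] measurable_ennreal])
  define G where "G w = (\<integral>\<^sup>+y. F (w, y) \<partial>(?\<mu> \<Otimes>\<^sub>M ?\<mu>))" for w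
  have [measurable]: "G \<in> borel_measurable M"
    unfolding G_def by (rule sigma_finite_measure.borel_measurable_nn_integral_fst[OF
        prob_space_imp_sigma_finite[OF prob_space_pair[OF \<mu>.prob_space_axioms \<mu>.prob_space_axioms]] Fm])
  have low: "ennreal (d\<^sup>2 * ((\<Sum>i<n. (L x i w)\<^sup>2) / n - 1) ^ (2*k)) \<le> G w" if w: "w \<in> space M" and x: "(\<Sum>j\<in>J. (x j)\<^sup>2) = 1" for w x
  proof -
    have [measurable]: "(\<lambda>y. F (w, y)) \<in> borel_measurable (?\<mu> \<Otimes>\<^sub>M ?\<mu>)"
      using w Fm by (rule measurable_Pair2[rotated])
    have "(\<Sum>i<n. (L x i w)\<^sup>2) / n - 1 = (\<Sum>i\<in>J. \<Sum>j\<in>J. x i * C w i j * x j)"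
      unfolding WC[symmetric] W_def using x by (simp add: power2_eq_square)
    then have "ennreal (d\<^sup>2 * ((\<Sum>i<n. (L x i w)\<^sup>2) / n - 1) ^ (2*k)) \<le> (\<integral>\<^sup>+g. \<integral>\<^sup>+h. F (w, (g, h)) \<partial>?\<mu> \<partial>?\<mu>)"
      using decoupled_moment_lower[OF J x, of k "C w"] unfolding d_def F_def WC by simp
    also have "\<dots> = G w" unfolding G_def by (rule \<mu>.nn_integral_fst) measurable
    finally show ?thesis .
  qed
  define B where "B = 2 * (4 * real k / (exp 1 * s * n)) ^ (2*k) * exp (n * s\<^sup>2 / (4 * (1 - s)))"
  have B0: "B \<ge> 0" using s by (simp add: B_def)
  define H where "H g = ennreal ((\<Sum>j\<in>J. (g j)\<^sup>2) ^ k)" for g :: "_ \<Rightarrow> real"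
  have [measurable]: "H \<in> borel_measurable ?\<mu>"
    unfolding H_def by (intro measurable_compose[OF _ measurable_ennreal] borel_measurable_power borel_measurable_sum
        measurable_gauss_product_component)
  have "(\<integral>\<^sup>+w. G w \<partial>M) = (\<integral>\<^sup>+y. \<integral>\<^sup>+w. F (w, y) \<partial>M \<partial>(?\<mu> \<Otimes>\<^sub>M ?\<mu>))"
    unfolding G_def by (rule M\<mu>.Fubini[OF Fm, symmetric])
  also have "\<dots> \<le> (\<integral>\<^sup>+y. H (fst y) * H (snd y) * ennreal B \<partial>(?\<mu> \<Otimes>\<^sub>M ?\<mu>))"
    unfolding F_def W_def L_def H_def B_def
    using gaussian_bilinear_moment[OF X J(1) n s k1] by (intro nn_integral_mono) simp
  also have "\<dots> = (\<integral>\<^sup>+y. H (fst y) * H (snd y) \<partial>(?\<mu> \<Otimes>\<^sub>M ?\<mu>)) * ennreal B"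
    by (rule nn_integral_multc) measurable
  also have "(\<integral>\<^sup>+y. H (fst y) * H (snd y) \<partial>(?\<mu> \<Otimes>\<^sub>M ?\<mu>)) = (\<integral>\<^sup>+g. \<integral>\<^sup>+h. H g * H h \<partial>?\<mu> \<partial>?\<mu>)"
    by (subst \<mu>.nn_integral_fst[symmetric]) (auto simp: fst_def snd_def)
  also have "\<dots> = (\<integral>\<^sup>+g. H g \<partial>?\<mu>) * (\<integral>\<^sup>+h. H h \<partial>?\<mu>)"
    by (simp add: nn_integral_cmult nn_integral_multc)
  also have "\<dots> \<le> ennreal ((8 * real k / exp 1) ^ k) * ennreal ((8 * real k / exp 1) ^ k)"
    unfolding H_def by (intro mult_mono gauss_product_norm_moment J k) auto
  also have "\<dots> = ennreal ((8 * real k / exp 1) ^ (2*k))"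
    by (subst ennreal_mult[symmetric]) (auto simp: power_add[symmetric] mult_2)
  also have "ennreal ((8 * real k / exp 1) ^ (2*k)) * ennreal B = ennreal ((8 * real k / exp 1) ^ (2*k) * B)"
    using B0 by (subst ennreal_mult[symmetric]) auto
  finally have up: "(\<integral>\<^sup>+w. G w \<partial>M) \<le> ennreal ((8 * real k / exp 1) ^ (2*k) * B)" by (simp add: mult_right_mono)
  define thr where "thr = d\<^sup>2 * t ^ (2*k)"
  have thr: "thr > 0" using d0 t by (simp add: thr_def)
  define E where "E = {w\<in>space M. 1 \<le> ennreal (1 / thr) * G w}"
  have E: "E \<in> sets M" unfolding E_def by measurable
  have "emeasure M E \<le> ennreal (1 / thr) * (\<integral>\<^sup>+w. G w * indicator (space M) w \<partial>M)"
    using nn_integral_Markov_inequality[of G "space M" M "ennreal (1 / thr)"] by (simp add: E_def)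
  also have "(\<integral>\<^sup>+w. G w * indicator (space M) w \<partial>M) = (\<integral>\<^sup>+w. G w \<partial>M)"
    by (rule nn_integral_cong) simp
  also have "ennreal (1 / thr) * (\<integral>\<^sup>+w. G w \<partial>M) \<le> ennreal (1 / thr) * ennreal ((8 * real k / exp 1) ^ (2*k) * B)"
    by (intro mult_left_mono up) auto
  also have "\<dots> = ennreal ((8 * real k / exp 1) ^ (2*k) * B / thr)"
    using thr B0 by (subst ennreal_mult[symmetric]) auto
  finally have "prob E \<le> (8 * real k / exp 1) ^ (2*k) * B / thr"
    using thr B0 by (simp add: emeasure_eq_measure)
  also have "\<dots> \<le> 2 * (real k + 1)\<^sup>2 * (16 * real k / (exp 1 * s * n * t)) ^ (2*k) * exp (n * s\<^sup>2 / (4 * (1 - s)))"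
  proof -
    have "(8 * real k / exp 1) ^ k = 4 ^ k * (2 * real k / exp 1) ^ k"
      unfolding power_mult_distrib[symmetric] by simp
    also have "\<dots> \<le> 4 ^ k * ((real k + 1) * d)"
      using double_factorial_lower[of k] by (intro mult_left_mono) (auto simp: d_def)
    finally have "((8 * real k / exp 1) ^ k)\<^sup>2 \<le> (4 ^ k * ((real k + 1) * d))\<^sup>2"
      by (intro power_mono) auto
    then have "(8 * real k / exp 1) ^ (2*k) \<le> 4 ^ (2*k) * (real k + 1)\<^sup>2 * d\<^sup>2"
      by (simp add: power_mult_distrib power_mult[symmetric] mult.commute[of k 2])
    then have "(8 * real k / exp 1) ^ (2*k) * B / thr \<le> (4 ^ (2*k) * (real k + 1)\<^sup>2 * d\<^sup>2) * B / thr"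
      using B0 thr by (intro divide_right_mono mult_right_mono) auto
    also have "\<dots> = (real k + 1)\<^sup>2 * (4 ^ (2*k) * B / t ^ (2*k))"
      using d0 by (simp add: thr_def)
    also have "4 ^ (2*k) * B / t ^ (2*k) = 2 * (4 * (4 * real k / (exp 1 * s * n)) / t) ^ (2*k) * exp (n * s\<^sup>2 / (4 * (1 - s)))"
      unfolding B_def power_divide power_mult_distrib by simp
    also have "4 * (4 * real k / (exp 1 * s * n)) / t = 16 * real k / (exp 1 * s * n * t)" by simp
    finally show ?thesis by (simp only: mult_ac)
  qed
  finally have pE: "prob E \<le> 2 * (real k + 1)\<^sup>2 * (16 * real k / (exp 1 * s * n * t)) ^ (2*k) * exp (n * s\<^sup>2 / (4 * (1 - s)))" .
  have "\<bar>(\<Sum>i<n. (L x i w)\<^sup>2) / n - 1\<bar> \<le> t" if w: "w \<in> space M - E" and x: "(\<Sum>j\<in>J. (x j)\<^sup>2) = 1" for w x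
  proof (rule ccontr)
    assume "\<not> ?thesis"
    then have "t ^ (2*k) \<le> \<bar>(\<Sum>i<n. (L x i w)\<^sup>2) / n - 1\<bar> ^ (2*k)" using t by (intro power_mono) auto
    then have "thr \<le> d\<^sup>2 * ((\<Sum>i<n. (L x i w)\<^sup>2) / n - 1) ^ (2*k)"
      unfolding thr_def by (intro mult_left_mono) (auto simp: power_even_abs)
    then have "ennreal thr \<le> G w" using low[OF _ x, of w] w by (meson DiffD1 ennreal_leI order_trans)
    then have "ennreal (1 / thr) * ennreal thr \<le> ennreal (1 / thr) * G w" by (intro mult_left_mono) auto
    then have "1 \<le> ennreal (1 / thr) * G w" using thr by (simp add: ennreal_mult[symmetric])
    then show False using w by (simp add: E_def)
  qed
  then show ?thesis using E pE unfolding L_def by blast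
qed

end

section \<open>Rayleigh quotients and perturbation\<close>

lemma vdot_commute: "vdot p u v = vdot p v u"
  by (simp add: vdot_def mult.commute)

lemma vdot_add_left: "vdot p (\<lambda>k. u k + v k) w = vdot p u w + vdot p v w"
  by (simp add: vdot_def algebra_simps sum.distrib)

lemma vdot_diff_left: "vdot p (\<lambda>k. u k - v k) w = vdot p u w - vdot p v w"
  by (simp add: vdot_def algebra_simps sum_subtractf)

lemma vdot_scale_left: "vdot p (\<lambda>k. c * u k) w = c * vdot p u w"
  by (simp add: vdot_def sum_distrib_left mult.assoc)

lemma vdot_sum_left: "vdot p (\<lambda>k. \<Sum>j\<in>J. f j k) w = (\<Sum>j\<in>J. vdot p (f j) w)"
  unfolding vdot_def sum_distrib_right by (rule sum.swap)

lemma vdot_add_right: "vdot p w (\<lambda>k. u k + v k) = vdot p w u + vdot p w v"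
  by (simp add: vdot_def algebra_simps sum.distrib)

lemma vdot_diff_right: "vdot p w (\<lambda>k. u k - v k) = vdot p w u - vdot p w v"
  by (simp add: vdot_def algebra_simps sum_subtractf)

lemma vdot_scale_right: "vdot p w (\<lambda>k. c * u k) = c * vdot p w u"
  by (simp add: vdot_def sum_distrib_left mult_ac)

lemma vdot_sum_right: "vdot p w (\<lambda>k. \<Sum>j\<in>J. f j k) = (\<Sum>j\<in>J. vdot p w (f j))"
  unfolding vdot_def sum_distrib_left by (rule sum.swap)

lemmas vdot_linear = vdot_add_left vdot_diff_left vdot_scale_left vdot_sum_left
  vdot_add_right vdot_diff_right vdot_scale_right vdot_sum_right

lemma vdot_self_nonneg [simp]: "0 \<le> vdot p u u"
  by (simp add: vdot_def sum_nonneg)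

lemma vdot_self_eq_0_iff: "vdot p u u = 0 \<longleftrightarrow> (\<forall>k<p. u k = 0)"
  unfolding vdot_def by (subst sum_nonneg_eq_0_iff) auto

lemma vnorm_nonneg [simp]: "0 \<le> vnorm p u"
  by (simp add: vnorm_def)

lemma vnorm_power2: "(vnorm p u)\<^sup>2 = vdot p u u"
  by (simp add: vnorm_def)

lemma vdot_abs_le: "\<bar>vdot p u v\<bar> \<le> vnorm p u * vnorm p v"
proof -
  have "(vdot p u v)\<^sup>2 \<le> vdot p u u * vdot p v v"
    using Cauchy_Schwarz_ineq_sum[of u v "{..<p}"] by (simp add: vdot_def power2_eq_square)
  then have "sqrt ((vdot p u v)\<^sup>2) \<le> sqrt (vdot p u u * vdot p v v)" by (rule real_sqrt_le_mono)
  then show ?thesis by (simp add: vnorm_def real_sqrt_mult)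
qed

lemma vdot_mat_vec_commute:
  assumes "\<And>i k. i < p \<Longrightarrow> k < p \<Longrightarrow> A i k = A k i"
  shows "vdot p x (mat_vec p A y) = vdot p y (mat_vec p A x)"
proof -
  have "vdot p x (mat_vec p A y) = (\<Sum>i<p. \<Sum>k<p. x i * A i k * y k)"
    by (simp add: vdot_def mat_vec_def sum_distrib_left mult_ac)
  also have "\<dots> = (\<Sum>k<p. \<Sum>i<p. x i * A i k * y k)" by (rule sum.swap)
  also have "\<dots> = vdot p y (mat_vec p A x)"
    unfolding vdot_def mat_vec_def sum_distrib_left using assms by (intro sum.cong refl) (auto simp: mult_ac)
  finally show ?thesis .
qed

lemma mat_vec_linear:
  "mat_vec p A (\<lambda>k. u k + v k) = (\<lambda>k. mat_vec p A u k + mat_vec p A v k)"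
  "mat_vec p A (\<lambda>k. u k - v k) = (\<lambda>k. mat_vec p A u k - mat_vec p A v k)"
  "mat_vec p A (\<lambda>k. c * u k) = (\<lambda>k. c * mat_vec p A u k)"
  by (auto simp: mat_vec_def algebra_simps sum.distrib sum_subtractf sum_distrib_left)

lemma mat_vec_cong: "(\<And>k. k < p \<Longrightarrow> u k = v k) \<Longrightarrow> mat_vec p A u = mat_vec p A v"
  by (auto simp: mat_vec_def)

lemma vdot_cong: "(\<And>k. k < p \<Longrightarrow> u k = u' k) \<Longrightarrow> (\<And>k. k < p \<Longrightarrow> v k = v' k) \<Longrightarrow> vdot p u v = vdot p u' v'"
  by (auto simp: vdot_def)

text \<open>The first-order condition at a maximum: for \<beta> < 0 the vertex t = - \<alpha> /
  \<beta> has the value - \<alpha>^2 / \<beta>, which is positive unless \<alpha> = 0.\<close>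

lemma quadratic_nonpos_linear_zero:
  fixes \<alpha> \<beta> :: real
  assumes "\<And>t. 2 * t * \<alpha> + t\<^sup>2 * \<beta> \<le> 0"
  shows "\<alpha> = 0"
proof (cases "\<beta> = 0")
  case True
  then show ?thesis using assms[of \<alpha>] by (simp add: mult.assoc) (metis not_square_less_zero order_less_le linorder_not_le mult_eq_0_iff)
next
  case False
  have "\<beta> \<le> 0" using assms[of 1] assms[of "-1"] by simp
  then have b: "\<beta> < 0" using False by simp
  have "2 * (- \<alpha> / \<beta>) * \<alpha> + (- \<alpha> / \<beta>)\<^sup>2 * \<beta> = - (\<alpha>\<^sup>2 / \<beta>)"
    using b by (simp add: power2_eq_square field_simps)
  then have "- (\<alpha>\<^sup>2 / \<beta>) \<le> 0" using assms[of "- \<alpha> / \<beta>"] by simp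
  then have "\<alpha>\<^sup>2 \<le> 0" using b by (simp add: zero_le_divide_iff)
  then show ?thesis by simp
qed

lemma rayleigh_maximizer_exists:
  assumes "p > 0"
  obtains x where "vdot p x x = 1"
    and "\<And>y. vdot p y (mat_vec p A y) \<le> vdot p x (mat_vec p A x) * vdot p y y"
proof -
  \<comment> \<open>Vectors are functions on all natural numbers, so the coordinates from p on are
    pinned to 0. The product of intervals is then compact in the product topology and contains the
    relevant unit sphere as a closed part.\<close>
  define K where "K = PiE UNIV (\<lambda>k::nat. if k < p then {-1..1::real} else {0})"
  define S where "S = K \<inter> {x. vdot p x x = 1}"
  define f where "f x = vdot p x (mat_vec p A x)" for x :: "nat \<Rightarrow> real"
  have "compactin (product_topology (\<lambda>_. euclidean) UNIV) K"
    unfolding K_def compactin_PiE by auto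
  then have "compact K" by (simp add: euclidean_product_topology)
  have coord: "continuous_on T (\<lambda>x::nat \<Rightarrow> real. x k)" for k T
    by (rule continuous_on_subset[OF continuous_on_product_coordinates]) auto
  have cf: "continuous_on T f" for T
    unfolding f_def vdot_def mat_vec_def by (intro continuous_intros coord)
  have "closed {x. vdot p x x = 1}"
    unfolding vdot_def by (intro closed_Collect_eq continuous_intros coord)
  then have "compact S" unfolding S_def using \<open>compact K\<close> by (rule compact_Int_closed[rotated])
  have norm: "(\<lambda>k. if k < p then y k / vnorm p y else 0) \<in> S" if "vdot p y y \<noteq> 0" for y
  proof -
    have n0: "vnorm p y > 0" using that by (simp add: vnorm_def less_le)
    have "-1 \<le> y k / vnorm p y \<and> y k / vnorm p y \<le> 1" if "k < p" for k
    proof -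
      have "(y k)\<^sup>2 \<le> vdot p y y"
        unfolding vdot_def power2_eq_square using that by (intro member_le_sum) auto
      then have "\<bar>y k\<bar> \<le> vnorm p y" unfolding vnorm_def by (rule real_le_rsqrt[of "\<bar>y k\<bar>", simplified])
      then show ?thesis using n0 by (simp add: divide_le_eq le_divide_eq abs_le_iff)
    qed
    then have "(\<lambda>k. if k < p then y k / vnorm p y else 0) \<in> K"
      by (auto simp: K_def)
    moreover have "vdot p (\<lambda>k. if k < p then y k / vnorm p y else 0) (\<lambda>k. if k < p then y k / vnorm p y else 0) = vdot p (\<lambda>k. 1 / vnorm p y * y k) (\<lambda>k. 1 / vnorm p y * y k)"
      by (rule vdot_cong) auto
    moreover have "\<dots> = 1"
      unfolding vdot_linear using n0 by (simp add: vnorm_power2[symmetric] power2_eq_square)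
    ultimately show ?thesis by (simp add: S_def)
  qed
  have "vdot p (\<lambda>k. 1) (\<lambda>k. 1) \<noteq> 0" using assms by (simp add: vdot_def)
  then have "S \<noteq> {}" using norm by blast
  obtain x where x: "x \<in> S" "\<And>y. y \<in> S \<Longrightarrow> f y \<le> f x"
    using continuous_attains_sup[OF \<open>compact S\<close> \<open>S \<noteq> {}\<close> cf] by blast
  have "f y \<le> f x * vdot p y y" for y
  proof (cases "vdot p y y = 0")
    case True
    then have "f y = 0" unfolding vdot_self_eq_0_iff f_def vdot_def[of p y "mat_vec p A y"] by simp
    then show ?thesis using True by simp
  next
    case False
    then have n0: "vnorm p y > 0" by (simp add: vnorm_def less_le)
    have "f (\<lambda>k. if k < p then y k / vnorm p y else 0) = f (\<lambda>k. 1 / vnorm p y * y k)"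
    proof -
      have "mat_vec p A (\<lambda>k. if k < p then y k / vnorm p y else 0) = mat_vec p A (\<lambda>k. 1 / vnorm p y * y k)"
        by (rule mat_vec_cong) simp
      then show ?thesis unfolding f_def by (simp only:) (rule vdot_cong, auto)
    qed
    also have "\<dots> = f y / vdot p y y"
      unfolding f_def mat_vec_linear vdot_linear using n0 by (simp add: vnorm_power2[symmetric] power2_eq_square)
    finally have "f y / vdot p y y \<le> f x" using x(2)[OF norm[OF False]] by simp
    moreover have "vdot p y y > 0" using False by (simp add: less_le)
    ultimately show ?thesis by (simp add: divide_le_eq)
  qed
  then show ?thesis using that[of x] x(1) by (auto simp: S_def f_def)
qed

text \<open>\<open>is_top_unit_eigvec\<close> compares eigenvalues only. A maximiser of the Rayleigh
  quotient satisfies the first-order condition in every direction h and is therefore an eigenvector,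
  so the maximal value is an eigenvalue and cannot exceed \<open>lam\<close>.\<close>

lemma top_unit_eigvec_rayleigh:
  assumes sym: "\<And>i k. i < p \<Longrightarrow> k < p \<Longrightarrow> A i k = A k i" and top: "is_top_unit_eigvec p A v"
  obtains lam where "\<And>i. i < p \<Longrightarrow> mat_vec p A v i = lam * v i"
    and "\<And>y. vdot p y (mat_vec p A y) \<le> lam * vdot p y y"
proof -
  obtain lam where lam: "is_eigenpair p A lam v" "\<And>mu w. is_eigenpair p A mu w \<Longrightarrow> mu \<le> lam"
    using top unfolding is_top_unit_eigvec_def by blast
  then have "p > 0" by (auto simp: is_eigenpair_def)
  obtain x where x1: "vdot p x x = 1"
    and max: "\<And>y. vdot p y (mat_vec p A y) \<le> vdot p x (mat_vec p A x) * vdot p y y"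
    using rayleigh_maximizer_exists[OF \<open>p > 0\<close>, of A] by blast
  define mu where "mu = vdot p x (mat_vec p A x)"
  have crit: "vdot p h (mat_vec p A x) = mu * vdot p h x" for h
  proof -
    have "2 * t * (vdot p h (mat_vec p A x) - mu * vdot p h x) + t\<^sup>2 * (vdot p h (mat_vec p A h) - mu * vdot p h h) \<le> 0" for t
    proof -
      have comm: "vdot p x (mat_vec p A h) = vdot p h (mat_vec p A x)"
        by (rule vdot_mat_vec_commute[OF sym])
      have "vdot p (\<lambda>k. x k + t * h k) (mat_vec p A (\<lambda>k. x k + t * h k))
          = mu + 2 * t * vdot p h (mat_vec p A x) + t\<^sup>2 * vdot p h (mat_vec p A h)"
        unfolding mat_vec_linear vdot_linear mu_def comm
        by (simp add: algebra_simps power2_eq_square)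
      moreover have "vdot p (\<lambda>k. x k + t * h k) (\<lambda>k. x k + t * h k) = 1 + 2 * t * vdot p h x + t\<^sup>2 * vdot p h h"
        unfolding vdot_linear x1 vdot_commute[of p x h] by (simp add: algebra_simps power2_eq_square)
      ultimately have "mu + 2 * t * vdot p h (mat_vec p A x) + t\<^sup>2 * vdot p h (mat_vec p A h)
          \<le> mu * (1 + 2 * t * vdot p h x + t\<^sup>2 * vdot p h h)"
        using max[of "\<lambda>k. x k + t * h k"] by (simp add: mu_def)
      then show ?thesis by (simp add: algebra_simps)
    qed
    from quadratic_nonpos_linear_zero[OF this] show ?thesis by simp
  qed
  have "vdot p (\<lambda>k. mat_vec p A x k - mu * x k) (\<lambda>k. mat_vec p A x k - mu * x k) = 0"
    using crit[of "\<lambda>k. mat_vec p A x k - mu * x k"] vdot_commute[of p x "mat_vec p A x"] by (simp add: vdot_linear)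
  then have "\<forall>k<p. mat_vec p A x k = mu * x k" unfolding vdot_self_eq_0_iff by simp
  moreover have "\<exists>k<p. x k \<noteq> 0" using x1 vdot_self_eq_0_iff[of p x] by force
  ultimately have "is_eigenpair p A mu x" by (simp add: is_eigenpair_def)
  then have "mu \<le> lam" by (rule lam(2))
  then have "vdot p y (mat_vec p A y) \<le> lam * vdot p y y" for y
    using max[of y] mult_right_mono[of mu lam "vdot p y y"] by (simp add: mu_def[symmetric])
  moreover have "mat_vec p A v i = lam * v i" if "i < p" for i
    using lam(1) that by (simp add: is_eigenpair_def)
  ultimately show ?thesis using that by blast
qed

text \<open>With \<open>a = v - u\<close> and \<open>b = v + u\<close>, which are orthogonal, polarisation along \<open>a / \<parallel>a\<parallel> \<plusminus> b / \<parallel>b\<parallel>\<close> gives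
  \<open>a\<^sup>T D b \<le> \<parallel>a\<parallel> \<parallel>b\<parallel> (T + L) / 2\<close>, and \<open>\<parallel>a\<parallel> \<parallel>b\<parallel>\<close> is twice the sine of the angle.\<close>

lemma quadratic_form_difference_le:
  assumes sym: "\<And>i k. i < p \<Longrightarrow> k < p \<Longrightarrow> D i k = D k i"
    and u: "vdot p u u = 1" and v: "vdot p v v = 1"
    and up: "\<And>x. vdot p x (mat_vec p D x) \<le> T * vdot p x x"
    and lo: "\<And>x. - L * vdot p x x \<le> vdot p x (mat_vec p D x)"
  shows "vdot p v (mat_vec p D v) - vdot p u (mat_vec p D u) \<le> (T + L) * sqrt (1 - (vdot p u v)\<^sup>2)"
proof -
  define a b where "a = (\<lambda>k. v k - u k)" and "b = (\<lambda>k. v k + u k)"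
  define R where "R = vdot p a (mat_vec p D b)"
  have ba: "vdot p b (mat_vec p D a) = R" unfolding R_def by (rule vdot_mat_vec_commute[OF sym])
  have uv: "vdot p u (mat_vec p D v) = vdot p v (mat_vec p D u)" by (rule vdot_mat_vec_commute[OF sym])
  have lhs: "vdot p v (mat_vec p D v) - vdot p u (mat_vec p D u) = R"
    unfolding R_def a_def b_def mat_vec_linear vdot_linear uv by simp
  have aa: "vdot p a a = 2 - 2 * vdot p u v" and bb: "vdot p b b = 2 + 2 * vdot p u v" and ab: "vdot p a b = 0"
    unfolding a_def b_def vdot_linear using u v vdot_commute[of p u v] by simp_all
  have ba0: "vdot p b a = 0" using ab vdot_commute[of p a b] by simp
  have prod: "vnorm p a * vnorm p b = 2 * sqrt (1 - (vdot p u v)\<^sup>2)"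
  proof -
    have "vnorm p a * vnorm p b = sqrt (4 * (1 - (vdot p u v)\<^sup>2))"
      unfolding vnorm_def aa bb real_sqrt_mult[symmetric] by (simp add: power2_eq_square algebra_simps)
    then show ?thesis unfolding real_sqrt_mult by simp
  qed
  show ?thesis
  proof (cases "vnorm p a = 0 \<or> vnorm p b = 0")
    case True
    then have "(\<forall>k<p. a k = 0) \<or> (\<forall>k<p. b k = 0)" by (simp add: vnorm_def vdot_self_eq_0_iff)
    then have "R = 0" using ba by (auto simp: R_def vdot_def)
    then show ?thesis using True prod lhs by auto
  next
    case False
    then have n: "vnorm p a > 0" "vnorm p b > 0" by (auto simp: less_le)
    define \<alpha> \<beta> where "\<alpha> = 1 / vnorm p a" and "\<beta> = 1 / vnorm p b"
    have nab: "\<alpha> * \<alpha> * vdot p a a = 1" "\<beta> * \<beta> * vdot p b b = 1"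
      using n by (auto simp: \<alpha>_def \<beta>_def vnorm_power2[symmetric] power2_eq_square)
    define x where "x = (\<lambda>k. \<alpha> * a k + \<beta> * b k)"
    define y where "y = (\<lambda>k. \<alpha> * a k - \<beta> * b k)"
    have "vdot p x x = 2" "vdot p y y = 2"
      unfolding x_def y_def vdot_linear ab ba0 using nab by (simp_all add: mult.assoc)
    then have "vdot p x (mat_vec p D x) - vdot p y (mat_vec p D y) \<le> 2 * (T + L)"
      using up[of x] lo[of y] by simp
    moreover have "vdot p x (mat_vec p D x) - vdot p y (mat_vec p D y) = 4 * (\<alpha> * \<beta> * R)"
      unfolding x_def y_def mat_vec_linear vdot_linear ba R_def[symmetric] by (simp add: algebra_simps)
    ultimately have "\<alpha> * \<beta> * R \<le> (T + L) / 2" by simp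
    moreover have "\<alpha> * \<beta> * R = R / (vnorm p a * vnorm p b)" by (simp add: \<alpha>_def \<beta>_def)
    ultimately have "R \<le> (T + L) / 2 * (vnorm p a * vnorm p b)"
      using n by (simp only: pos_divide_le_eq[OF mult_pos_pos[OF n]])
    then show ?thesis unfolding prod lhs by simp
  qed
qed

text \<open>The squared distance from v to the combination \<open>w\<close> is nonnegative. Norms at
  most 1 are allowed so that the normalisation of a vanishing \<open>rho j\<close>, which is the
  zero vector, is covered.\<close>

lemma bessel_inequality:
  assumes J: "finite J" and orth: "\<And>i j. i \<in> J \<Longrightarrow> j \<in> J \<Longrightarrow> i \<noteq> j \<Longrightarrow> vdot p (e i) (e j) = 0"
    and norm: "\<And>j. j \<in> J \<Longrightarrow> vdot p (e j) (e j) \<le> 1"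
  shows "(\<Sum>j\<in>J. (vdot p (e j) v)\<^sup>2) \<le> vdot p v v"
proof -
  define c where "c j = vdot p (e j) v" for j
  define w where "w = (\<lambda>k. \<Sum>j\<in>J. c j * e j k)"
  have wv: "vdot p w v = (\<Sum>j\<in>J. (c j)\<^sup>2)"
    unfolding w_def vdot_linear by (simp add: c_def power2_eq_square)
  have "vdot p w w = (\<Sum>j\<in>J. c j * (\<Sum>i\<in>J. c i * vdot p (e j) (e i)))"
    unfolding w_def vdot_linear sum_distrib_left ..
  also have "\<dots> = (\<Sum>j\<in>J. c j * (c j * vdot p (e j) (e j)))"
  proof (intro sum.cong refl arg_cong2[where f = "(*)"])
    fix j assume "j \<in> J"
    then show "(\<Sum>i\<in>J. c i * vdot p (e j) (e i)) = c j * vdot p (e j) (e j)"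
      using J orth[of j] by (subst sum.remove[of _ j]) (force intro!: sum.neutral)+
  qed
  also have "\<dots> \<le> (\<Sum>j\<in>J. (c j)\<^sup>2)"
    using norm by (intro sum_mono) (auto simp: power2_eq_square mult.assoc[symmetric] mult_left_le)
  finally have "vdot p w w \<le> (\<Sum>j\<in>J. (c j)\<^sup>2)" .
  moreover have "0 \<le> vdot p (\<lambda>k. v k - w k) (\<lambda>k. v k - w k)" by simp
  ultimately show ?thesis using wv unfolding vdot_linear vdot_commute[of p v w] by (simp add: c_def)
qed

text \<open>The vector \<open>y\<close> is |x|^2 times the reflection of z in the line through x, so
  its norm is |x|^2 |z|, and the left side is |r.y|. On unit vectors the form 2 (r.x) (z.x) thus
  stays within |r| |z| of r.z, an interval half as long as the one obtained by bounding each
  factor.\<close>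

lemma product_form_bound:
  "\<bar>2 * vdot p r x * vdot p z x - vdot p r z * vdot p x x\<bar> \<le> vnorm p r * vnorm p z * vdot p x x"
proof -
  define y where "y = (\<lambda>k. 2 * vdot p z x * x k - vdot p x x * z k)"
  have "vdot p y y = (vdot p x x)\<^sup>2 * vdot p z z"
    unfolding y_def vdot_linear vdot_commute[of p x z] by (simp add: power2_eq_square algebra_simps)
  then have "vnorm p y = vdot p x x * vnorm p z"
    by (simp add: vnorm_def real_sqrt_mult)
  moreover have "vdot p r y = 2 * vdot p r x * vdot p z x - vdot p r z * vdot p x x"
    unfolding y_def vdot_linear by (simp add: algebra_simps)
  ultimately show ?thesis using vdot_abs_le[of p r y] by (simp add: mult_ac)
qed

section \<open>The spiked model for fixed data\<close>

lemma sample_cov_sym: "sample_cov n x i k = sample_cov n x k i"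
  by (simp add: sample_cov_def mult.commute)

lemma mat_vec_sample_cov:
  "mat_vec p (sample_cov n x) u k = (\<Sum>t<n. x t k * vdot p (x t) u) / n"
proof -
  have "mat_vec p (sample_cov n x) u k = (\<Sum>i<p. (\<Sum>t<n. x t k * (x t i * u i)) / n)"
    unfolding mat_vec_def sample_cov_def times_divide_eq_left sum_distrib_right by (simp add: mult_ac)
  also have "\<dots> = (\<Sum>i<p. \<Sum>t<n. x t k * (x t i * u i)) / n"
    by (rule sum_divide_distrib[symmetric])
  also have "(\<Sum>i<p. \<Sum>t<n. x t k * (x t i * u i)) = (\<Sum>t<n. \<Sum>i<p. x t k * (x t i * u i))"
    by (rule sum.swap)
  finally show ?thesis by (simp add: vdot_def sum_distrib_left)
qed

lemma vdot_sample_cov: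
  "vdot p y (mat_vec p (sample_cov n x) u) = (\<Sum>t<n. vdot p (x t) y * vdot p (x t) u) / n"
proof -
  have "vdot p y (mat_vec p (sample_cov n x) u) = (\<Sum>k<p. (\<Sum>t<n. (x t k * y k) * vdot p (x t) u) / n)"
    unfolding vdot_def[of p y] mat_vec_sample_cov by (simp add: sum_distrib_left mult_ac)
  also have "\<dots> = (\<Sum>k<p. \<Sum>t<n. (x t k * y k) * vdot p (x t) u) / n"
    by (rule sum_divide_distrib[symmetric])
  also have "(\<Sum>k<p. \<Sum>t<n. (x t k * y k) * vdot p (x t) u) = (\<Sum>t<n. \<Sum>k<p. (x t k * y k) * vdot p (x t) u)"
    by (rule sum.swap)
  also have "\<dots> = (\<Sum>t<n. vdot p (x t) y * vdot p (x t) u)"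
    by (simp add: vdot_def[of p _ y] sum_distrib_right)
  finally show ?thesis .
qed

lemma sin_vangle:
  assumes "vdot p v v = 1" "vnorm p r > 0"
  shows "sin (vangle p v r) = sqrt (1 - (vdot p (\<lambda>k. 1 / vnorm p r * r k) v)\<^sup>2)"
proof -
  have v1: "vnorm p v = 1" using assms by (simp add: vnorm_def)
  define c where "c = \<bar>vdot p v r\<bar> / vnorm p r"
  have "c \<le> 1" "0 \<le> c" using vdot_abs_le[of p v r] assms v1 by (auto simp: c_def divide_le_eq)
  then have "sin (arccos c) = sqrt (1 - c\<^sup>2)" by (intro sin_arccos) auto
  moreover have "c\<^sup>2 = (vdot p (\<lambda>k. 1 / vnorm p r * r k) v)\<^sup>2"
    unfolding c_def vdot_linear vdot_commute[of p r v] by (simp add: power_divide)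
  ultimately show ?thesis by (simp add: vangle_def v1 c_def)
qed

text \<open>One value of n is fixed. The arrays of scores and noise are arguments of the definitions
  and not parameters, because the same design is evaluated at the original and at the sign-flipped
  noise. Of the ordering of the norms only the positivity of the first is recorded; the bound
  \<open>R\<close> on the others is supplied where the spectral gap enters.\<close>

locale spiked_design =
  fixes p m n :: nat and rho :: "nat \<Rightarrow> nat \<Rightarrow> real" and sigma :: real
  assumes n_pos: "n > 0" and m_pos: "1 \<le> m"
    and orth: "\<And>i j. i \<in> {1..m} \<Longrightarrow> j \<in> {1..m} \<Longrightarrow> i \<noteq> j \<Longrightarrow> vdot p (rho i) (rho j) = 0"
    and rho1_pos: "vnorm p (rho 1) > 0" and sigma_pos: "sigma > 0"
begin

definition obs :: "(nat \<Rightarrow> nat \<Rightarrow> real) \<Rightarrow> (nat \<Rightarrow> nat \<Rightarrow> real) \<Rightarrow> nat \<Rightarrow> nat \<Rightarrow> real" where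
  "obs V Z i k = (\<Sum>j\<in>{1..m}. V i j * rho j k) + sigma * Z i k"

definition total :: real where
  "total = (\<Sum>j\<in>{1..m}. vnorm p (rho j))"

definition dir :: "nat \<Rightarrow> real" where
  "dir k = 1 / vnorm p (rho 1) * rho 1 k"

definition cross :: "(nat \<Rightarrow> nat \<Rightarrow> real) \<Rightarrow> (nat \<Rightarrow> nat \<Rightarrow> real) \<Rightarrow> nat \<Rightarrow> nat \<Rightarrow> real" where
  "cross V Z j k = (\<Sum>i<n. V i j * Z i k) / n"

lemma total_nonneg: "0 \<le> total"
  by (simp add: total_def sum_nonneg)

lemma dir_unit: "vdot p dir dir = 1"
  unfolding dir_def vdot_linear using rho1_pos by (simp add: vnorm_power2[symmetric] power2_eq_square)

lemma vdot_rho_dir: "j \<in> {1..m} \<Longrightarrow> vdot p (rho j) dir = (if j = 1 then vnorm p (rho 1) else 0)"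
  unfolding dir_def vdot_linear using orth[of j 1] m_pos rho1_pos
  by (auto simp: vnorm_power2[symmetric] power2_eq_square)

lemma vdot_obs: "vdot p (obs V Z i) x = (\<Sum>j\<in>{1..m}. V i j * vdot p (rho j) x) + sigma * vdot p (Z i) x"
  unfolding obs_def vdot_linear ..

definition pert :: "(nat \<Rightarrow> nat \<Rightarrow> real) \<Rightarrow> (nat \<Rightarrow> nat \<Rightarrow> real) \<Rightarrow> nat \<Rightarrow> nat \<Rightarrow> real" where
  "pert V Z i k = sample_cov n (obs V Z) i k - (\<Sum>j\<in>{1..m}. rho j i * rho j k) - (if i = k then sigma\<^sup>2 else 0)"

lemma pert_sym: "pert V Z i k = pert V Z k i"
  by (simp add: pert_def sample_cov_sym[of n _ i k] mult.commute)

lemma vdot_pert: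
  "vdot p x (mat_vec p (pert V Z) x) = vdot p x (mat_vec p (sample_cov n (obs V Z)) x)
     - (\<Sum>j\<in>{1..m}. (vdot p (rho j) x)\<^sup>2) - sigma\<^sup>2 * vdot p x x"
proof -
  let ?S = "sample_cov n (obs V Z)"
  have mv: "mat_vec p (pert V Z) x i = mat_vec p ?S x i
     - (\<Sum>j\<in>{1..m}. vdot p (rho j) x * rho j i) - sigma\<^sup>2 * x i" if "i < p" for i
  proof -
    have "mat_vec p (pert V Z) x i = mat_vec p ?S x i
        - (\<Sum>k<p. \<Sum>j\<in>{1..m}. (rho j k * x k) * rho j i) - (\<Sum>k<p. (if i = k then sigma\<^sup>2 * x k else 0))"
      unfolding mat_vec_def pert_def sum_subtractf[symmetric]
      by (intro sum.cong refl) (auto simp: algebra_simps sum_distrib_left)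
    moreover have "(\<Sum>k<p. \<Sum>j\<in>{1..m}. (rho j k * x k) * rho j i) = (\<Sum>j\<in>{1..m}. vdot p (rho j) x * rho j i)"
      unfolding vdot_def sum_distrib_right by (rule sum.swap)
    moreover have "(\<Sum>k<p. (if i = k then sigma\<^sup>2 * x k else 0)) = sigma\<^sup>2 * x i"
      using that by simp
    ultimately show ?thesis by simp
  qed
  have "vdot p x (mat_vec p (pert V Z) x) = vdot p x (\<lambda>i. mat_vec p ?S x i
     - (\<Sum>j\<in>{1..m}. vdot p (rho j) x * rho j i) - sigma\<^sup>2 * x i)"
    by (rule vdot_cong) (auto simp: mv)
  then show ?thesis
    unfolding vdot_linear by (simp add: power2_eq_square vdot_commute[of p x "rho _"])
qed

lemma sample_form_expand:
  "vdot p x (mat_vec p (pert V Z) x) =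
     (\<Sum>j\<in>{1..m}. \<Sum>k\<in>{1..m}. vdot p (rho j) x * vdot p (rho k) x * ((\<Sum>i<n. V i j * V i k) / n - (if j = k then 1 else 0)))
     + sigma * (\<Sum>j\<in>{1..m}. 2 * vdot p (rho j) x * vdot p (cross V Z j) x)
     + sigma\<^sup>2 * ((\<Sum>i<n. (vdot p (Z i) x)\<^sup>2) / n - vdot p x x)"
proof -
  let ?J = "{1..m}"
  define y where "y j = vdot p (rho j) x" for j
  define N where "N i = vdot p (Z i) x" for i
  define P where "P i = (\<Sum>j\<in>?J. V i j * y j)" for i
  have "vdot p x (mat_vec p (sample_cov n (obs V Z)) x) = (\<Sum>i<n. (P i + sigma * N i) * (P i + sigma * N i)) / n"
    unfolding vdot_sample_cov vdot_obs P_def N_def y_def ..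
  also have "\<dots> = (\<Sum>i<n. P i * P i) / n + sigma * ((\<Sum>i<n. 2 * P i * N i) / n) + sigma\<^sup>2 * ((\<Sum>i<n. (N i)\<^sup>2) / n)"
    unfolding times_divide_eq_right sum_distrib_left add_divide_distrib[symmetric] sum.distrib[symmetric]
    by (intro arg_cong2[where f = "(/)"] sum.cong refl) (simp add: power2_eq_square algebra_simps)
  also have "(\<Sum>i<n. 2 * P i * N i) / n = (\<Sum>j\<in>?J. 2 * y j * vdot p (cross V Z j) x)"
  proof -
    have vc: "vdot p (cross V Z j) x = (\<Sum>i<n. V i j * N i) / n" for j
    proof -
      have "cross V Z j = (\<lambda>k. 1 / n * (\<Sum>i<n. V i j * Z i k))" by (auto simp: cross_def)
      then show ?thesis unfolding N_def by (simp only: vdot_linear) simp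
    qed
    have "(\<Sum>i<n. 2 * P i * N i) = (\<Sum>i<n. \<Sum>j\<in>?J. 2 * y j * (V i j * N i))"
      unfolding P_def sum_distrib_left sum_distrib_right by (intro sum.cong refl) (simp add: mult_ac)
    also have "\<dots> = (\<Sum>j\<in>?J. \<Sum>i<n. 2 * y j * (V i j * N i))" by (rule sum.swap)
    finally show ?thesis unfolding vc by (simp add: sum_distrib_left sum_divide_distrib)
  qed
  also have "(\<Sum>i<n. P i * P i) / n = (\<Sum>j\<in>?J. \<Sum>k\<in>?J. y j * y k * ((\<Sum>i<n. V i j * V i k) / n))"
  proof -
    have "(\<Sum>i<n. P i * P i) = (\<Sum>i<n. \<Sum>j\<in>?J. \<Sum>k\<in>?J. y j * y k * (V i j * V i k))"
      unfolding P_def sum_product by (intro sum.cong refl) (simp add: mult_ac)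
    also have "\<dots> = (\<Sum>j\<in>?J. \<Sum>i<n. \<Sum>k\<in>?J. y j * y k * (V i j * V i k))" by (rule sum.swap)
    also have "\<dots> = (\<Sum>j\<in>?J. \<Sum>k\<in>?J. \<Sum>i<n. y j * y k * (V i j * V i k))"
      by (rule sum.cong[OF refl], rule sum.swap)
    finally show ?thesis by (simp add: sum_distrib_left sum_divide_distrib)
  qed
  also have "\<dots> = (\<Sum>j\<in>?J. \<Sum>k\<in>?J. y j * y k * ((\<Sum>i<n. V i j * V i k) / n - (if j = k then 1 else 0))) + (\<Sum>j\<in>?J. (y j)\<^sup>2)"
  proof -
    have "(\<Sum>j\<in>?J. \<Sum>k\<in>?J. y j * y k * (if j = k then 1 else 0)) = (\<Sum>j\<in>?J. (y j)\<^sup>2)"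
      by (rule sum.cong[OF refl], subst sum.remove[of ?J]) (auto simp: power2_eq_square intro!: sum.neutral)
    then show ?thesis by (simp add: right_diff_distrib sum_subtractf)
  qed
  finally show ?thesis unfolding vdot_pert
    by (simp add: y_def N_def right_diff_distrib)
qed

text \<open>The centre \<open>c\<close> of the cross part enters the two bounds with opposite signs
  and cancels in the width of the range. \<open>t1\<close> and \<open>t2\<close> are kept apart
  since the lower end of the noise part admits a better bound for large aspect ratios.\<close>

lemma pert_form_bounds:
  assumes W: "\<And>j k. j \<in> {1..m} \<Longrightarrow> k \<in> {1..m} \<Longrightarrow> \<bar>(\<Sum>i<n. V i j * V i k) / n - (if j = k then 1 else 0)\<bar> \<le> \<eta>"
    and b: "\<And>j. j \<in> {1..m} \<Longrightarrow> vnorm p (cross V Z j) \<le> b"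
    and C: "\<And>x. vdot p x x = 1 \<Longrightarrow> - t2 \<le> (\<Sum>i<n. (vdot p (Z i) x)\<^sup>2) / n - 1 \<and> (\<Sum>i<n. (vdot p (Z i) x)\<^sup>2) / n - 1 \<le> t1"
  defines "c \<equiv> (\<Sum>j\<in>{1..m}. vdot p (rho j) (cross V Z j))"
  shows "vdot p x (mat_vec p (pert V Z) x) \<le> (\<eta> * total\<^sup>2 + sigma * (b * total + c) + sigma\<^sup>2 * t1) * vdot p x x"
    and "- (\<eta> * total\<^sup>2 + sigma * (b * total - c) + sigma\<^sup>2 * t2) * vdot p x x \<le> vdot p x (mat_vec p (pert V Z) x)"
proof -
  let ?J = "{1..m}"
  let ?W = "\<lambda>j k. (\<Sum>i<n. V i j * V i k) / n - (if j = k then 1 else 0)"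
  define X where "X = vdot p x x"
  have X0: "X \<ge> 0" by (simp add: X_def)
  define y where "y j = vdot p (rho j) x" for j
  have y: "\<bar>y j\<bar> \<le> vnorm p (rho j) * sqrt X" for j
    using vdot_abs_le[of p "rho j" x] by (simp add: y_def X_def vnorm_def)
  define a where "a = (\<Sum>j\<in>?J. \<Sum>k\<in>?J. y j * y k * ?W j k)"
  have "\<bar>a\<bar> \<le> (\<Sum>j\<in>?J. \<bar>\<Sum>k\<in>?J. y j * y k * ?W j k\<bar>)"
    unfolding a_def by (rule sum_abs)
  also have "\<dots> \<le> (\<Sum>j\<in>?J. \<Sum>k\<in>?J. (vnorm p (rho j) * sqrt X) * (vnorm p (rho k) * sqrt X) * \<eta>)"
  proof (intro sum_mono)
    fix j assume j: "j \<in> ?J"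
    have "\<bar>\<Sum>k\<in>?J. y j * y k * ?W j k\<bar>
      \<le> (\<Sum>k\<in>?J. \<bar>y j * y k * ?W j k\<bar>)" by (rule sum_abs)
    also have "\<dots> \<le> (\<Sum>k\<in>?J. (vnorm p (rho j) * sqrt X) * (vnorm p (rho k) * sqrt X) * \<eta>)"
      unfolding abs_mult using X0 by (intro sum_mono mult_mono y W j) auto
    finally show "\<bar>\<Sum>k\<in>?J. y j * y k * ?W j k\<bar>
      \<le> (\<Sum>k\<in>?J. (vnorm p (rho j) * sqrt X) * (vnorm p (rho k) * sqrt X) * \<eta>)" .
  qed
  also have "\<dots> = \<eta> * total\<^sup>2 * X"
  proof -
    have "(\<Sum>j\<in>?J. \<Sum>k\<in>?J. (vnorm p (rho j) * sqrt X) * (vnorm p (rho k) * sqrt X) * \<eta>)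
      = (\<Sum>j\<in>?J. \<Sum>k\<in>?J. vnorm p (rho j) * vnorm p (rho k)) * (\<eta> * X)"
      unfolding sum_distrib_right using X0 by (intro sum.cong refl) simp
    also have "(\<Sum>j\<in>?J. \<Sum>k\<in>?J. vnorm p (rho j) * vnorm p (rho k)) = total\<^sup>2"
      unfolding total_def power2_eq_square sum_product ..
    finally show ?thesis by simp
  qed
  finally have A: "\<bar>a\<bar> \<le> \<eta> * total\<^sup>2 * X" .
  define d where "d = (\<Sum>j\<in>?J. 2 * y j * vdot p (cross V Z j) x)"
  have "\<bar>d - c * X\<bar> = \<bar>\<Sum>j\<in>?J. 2 * y j * vdot p (cross V Z j) x - vdot p (rho j) (cross V Z j) * X\<bar>"
    unfolding d_def c_def by (simp add: sum_subtractf sum_distrib_right)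
  also have "\<dots> \<le> (\<Sum>j\<in>?J. \<bar>2 * y j * vdot p (cross V Z j) x - vdot p (rho j) (cross V Z j) * X\<bar>)" by (rule sum_abs)
  also have "\<dots> \<le> (\<Sum>j\<in>?J. vnorm p (rho j) * b * X)"
  proof (intro sum_mono)
    fix j assume "j \<in> ?J"
    have "\<bar>2 * y j * vdot p (cross V Z j) x - vdot p (rho j) (cross V Z j) * X\<bar> \<le> vnorm p (rho j) * vnorm p (cross V Z j) * X"
      unfolding y_def X_def by (rule product_form_bound)
    also have "\<dots> \<le> vnorm p (rho j) * b * X" using b[OF \<open>j \<in> ?J\<close>] X0 by (intro mult_right_mono mult_left_mono) auto
    finally show "\<bar>2 * y j * vdot p (cross V Z j) x - vdot p (rho j) (cross V Z j) * X\<bar> \<le> vnorm p (rho j) * b * X" .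
  qed
  also have "\<dots> = b * total * X" by (simp add: total_def sum_distrib_right[symmetric])
  finally have B: "\<bar>d - c * X\<bar> \<le> b * total * X" .
  define q where "q = (\<Sum>i<n. (vdot p (Z i) x)\<^sup>2) / n - X"
  have Q: "- t2 * X \<le> q \<and> q \<le> t1 * X"
  proof (cases "X = 0")
    case True
    then have "\<forall>k<p. x k = 0" by (simp add: X_def vdot_self_eq_0_iff)
    then have "vdot p (Z i) x = 0" for i by (simp add: vdot_def)
    then show ?thesis using True by (simp add: q_def)
  next
    case False
    then have X1: "X > 0" using X0 by simp
    define x' where "x' = (\<lambda>k. 1 / sqrt X * x k)"
    have "vdot p x' x' = 1" unfolding x'_def vdot_linear X_def[symmetric] using X1 by (simp add: field_simps)
    note C' = C[OF this]
    have "vdot p (Z i) x' = vdot p (Z i) x / sqrt X" for i unfolding x'_def vdot_linear by simp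
    then have "(\<Sum>i<n. (vdot p (Z i) x')\<^sup>2) / n - 1 = q / X"
      using X1 by (simp add: power_divide sum_divide_distrib[symmetric] q_def diff_divide_distrib)
    then show ?thesis using C' X1 by (simp add: le_divide_eq divide_le_eq)
  qed
  have form: "vdot p x (mat_vec p (pert V Z) x) = a + sigma * d + sigma\<^sup>2 * q"
    unfolding sample_form_expand a_def d_def q_def y_def X_def ..
  have "sigma * d \<le> sigma * (c * X + b * total * X)" "sigma * (c * X - b * total * X) \<le> sigma * d"
    using B sigma_pos by auto
  moreover have "sigma\<^sup>2 * q \<le> sigma\<^sup>2 * (t1 * X)" "sigma\<^sup>2 * (- t2 * X) \<le> sigma\<^sup>2 * q"
    using Q mult_left_mono[of q "t1 * X" "sigma\<^sup>2"] mult_left_mono[of "- t2 * X" q "sigma\<^sup>2"] by auto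
  ultimately show "vdot p x (mat_vec p (pert V Z) x) \<le> (\<eta> * total\<^sup>2 + sigma * (b * total + c) + sigma\<^sup>2 * t1) * vdot p x x"
    and "- (\<eta> * total\<^sup>2 + sigma * (b * total - c) + sigma\<^sup>2 * t2) * vdot p x x \<le> vdot p x (mat_vec p (pert V Z) x)"
    using A unfolding form X_def[symmetric] by (auto simp: algebra_simps)
qed

text \<open>With e_j the normalised spikes, the population form at v is the sum of |rho j|^2
  (e_j.v)^2, and by Bessel's inequality the weights with j \<ge> 2 sum to at most 1 - (e_1.v)^2.
  Division by zero turns a vanishing spike into e_j = 0.\<close>

lemma population_gap:
  assumes v: "vdot p v v = 1" and R: "\<And>j. j \<in> {2..m} \<Longrightarrow> vnorm p (rho j) \<le> R"
  shows "(\<Sum>j\<in>{1..m}. (vdot p (rho j) v)\<^sup>2) + ((vnorm p (rho 1))\<^sup>2 - R\<^sup>2) * (1 - (vdot p dir v)\<^sup>2)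
     \<le> (\<Sum>j\<in>{1..m}. (vdot p (rho j) dir)\<^sup>2)"
proof -
  define e where "e j = (\<lambda>k. 1 / vnorm p (rho j) * rho j k)" for j
  define c where "c j = vdot p (e j) v" for j
  have ee: "vdot p (e j) (e j) \<le> 1" for j
    unfolding e_def vdot_linear by (cases "vnorm p (rho j) = 0") (auto simp: vnorm_power2[symmetric] power2_eq_square)
  have "(\<Sum>j\<in>{1..m}. (c j)\<^sup>2) \<le> 1"
    unfolding c_def v[symmetric]
  proof (rule bessel_inequality)
    fix i j assume "i \<in> {1..m}" "j \<in> {1..m}" "i \<noteq> j"
    then show "vdot p (e i) (e j) = 0" unfolding e_def vdot_linear by (simp add: orth)
  qed (auto simp: ee)
  moreover have split: "(\<Sum>j\<in>{1..m}. f j) = f 1 + (\<Sum>j\<in>{2..m}. f j)" for f :: "nat \<Rightarrow> real"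
    using m_pos by (simp add: sum.atLeast_Suc_atMost numeral_2_eq_2)
  ultimately have bes: "(\<Sum>j\<in>{2..m}. (c j)\<^sup>2) \<le> 1 - (c 1)\<^sup>2" by simp
  have rc: "(vdot p (rho j) v)\<^sup>2 = (vnorm p (rho j))\<^sup>2 * (c j)\<^sup>2" for j
  proof (cases "vnorm p (rho j) = 0")
    case True
    then have "vdot p (rho j) v = 0" using vdot_abs_le[of p "rho j" v] by simp
    then show ?thesis using True by simp
  next
    case False then show ?thesis unfolding c_def e_def vdot_linear by (simp add: power_divide)
  qed
  have "(\<Sum>j\<in>{2..m}. (vdot p (rho j) v)\<^sup>2) \<le> (\<Sum>j\<in>{2..m}. R\<^sup>2 * (c j)\<^sup>2)"
    unfolding rc using R by (intro sum_mono mult_right_mono power_mono) auto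
  also have "\<dots> \<le> R\<^sup>2 * (1 - (c 1)\<^sup>2)"
    unfolding sum_distrib_left[symmetric] using bes by (intro mult_left_mono) auto
  finally have "(\<Sum>j\<in>{1..m}. (vdot p (rho j) v)\<^sup>2) \<le> (vnorm p (rho 1))\<^sup>2 * (c 1)\<^sup>2 + R\<^sup>2 * (1 - (c 1)\<^sup>2)"
    unfolding split[of "\<lambda>j. (vdot p (rho j) v)\<^sup>2"] rc[of 1] by simp
  moreover have "(\<Sum>j\<in>{1..m}. (vdot p (rho j) dir)\<^sup>2) = (vnorm p (rho 1))\<^sup>2"
  proof -
    have "(\<Sum>j\<in>{1..m}. (vdot p (rho j) dir)\<^sup>2) = (\<Sum>j\<in>{1..m}. if j = 1 then (vnorm p (rho 1))\<^sup>2 else 0)"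
      by (intro sum.cong refl) (simp add: vdot_rho_dir)
    then show ?thesis using m_pos by simp
  qed
  moreover have "c 1 = vdot p dir v" by (simp add: c_def e_def dir_def[abs_def])
  ultimately show ?thesis by (simp add: algebra_simps)
qed

theorem sin_vangle_le:
  assumes W: "\<And>j k. j \<in> {1..m} \<Longrightarrow> k \<in> {1..m} \<Longrightarrow> \<bar>(\<Sum>i<n. V i j * V i k) / n - (if j = k then 1 else 0)\<bar> \<le> \<eta>"
    and b: "\<And>j. j \<in> {1..m} \<Longrightarrow> vnorm p (cross V Z j) \<le> b"
    and C: "\<And>x. vdot p x x = 1 \<Longrightarrow> - t2 \<le> (\<Sum>i<n. (vdot p (Z i) x)\<^sup>2) / n - 1 \<and> (\<Sum>i<n. (vdot p (Z i) x)\<^sup>2) / n - 1 \<le> t1"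
    and R: "\<And>j. j \<in> {2..m} \<Longrightarrow> vnorm p (rho j) \<le> R"
    and top: "is_top_unit_eigvec p (sample_cov n (obs V Z)) v"
  shows "((vnorm p (rho 1))\<^sup>2 - R\<^sup>2) * sin (vangle p v (rho 1)) \<le> 2 * \<eta> * total\<^sup>2 + 2 * sigma * b * total + sigma\<^sup>2 * (t1 + t2)"
proof -
  let ?S = "sample_cov n (obs V Z)"
  define G where "G = 2 * \<eta> * total\<^sup>2 + 2 * sigma * b * total + sigma\<^sup>2 * (t1 + t2)"
  define s where "s = sqrt (1 - (vdot p dir v)\<^sup>2)"
  have v1: "vdot p v v = 1" using top by (simp add: is_top_unit_eigvec_def vnorm_def)
  have vn: "vnorm p v = 1" "vnorm p dir = 1" using v1 dir_unit by (simp_all add: vnorm_def)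
  have "\<bar>vdot p dir v\<bar> \<le> 1" using vdot_abs_le[of p dir v] vn by simp
  then have s2: "s\<^sup>2 = 1 - (vdot p dir v)\<^sup>2" by (simp add: s_def abs_square_le_1)
  have s0: "s \<ge> 0" using \<open>\<bar>vdot p dir v\<bar> \<le> 1\<close> by (simp add: s_def abs_square_le_1)
  obtain lam where lam: "\<And>i. i < p \<Longrightarrow> mat_vec p ?S v i = lam * v i"
    "\<And>y. vdot p y (mat_vec p ?S y) \<le> lam * vdot p y y"
    using top_unit_eigvec_rayleigh[OF sample_cov_sym top] by blast
  have "vdot p v (mat_vec p ?S v) = vdot p v (\<lambda>k. lam * v k)"
    using lam(1) by (intro vdot_cong) auto
  then have "vdot p dir (mat_vec p ?S dir) \<le> vdot p v (mat_vec p ?S v)"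
    using lam(2)[of dir] by (simp add: vdot_linear v1 dir_unit)
  then have "((vnorm p (rho 1))\<^sup>2 - R\<^sup>2) * s\<^sup>2 \<le> vdot p v (mat_vec p (pert V Z) v) - vdot p dir (mat_vec p (pert V Z) dir)"
    using population_gap[OF v1 R] unfolding vdot_pert s2 by (simp add: v1 dir_unit)
  also have "\<dots> \<le> G * s"
  proof -
    have "vdot p v (mat_vec p (pert V Z) v) - vdot p dir (mat_vec p (pert V Z) dir) \<le>
      ((\<eta> * total\<^sup>2 + sigma * (b * total + (\<Sum>j\<in>{1..m}. vdot p (rho j) (cross V Z j))) + sigma\<^sup>2 * t1)
      + (\<eta> * total\<^sup>2 + sigma * (b * total - (\<Sum>j\<in>{1..m}. vdot p (rho j) (cross V Z j))) + sigma\<^sup>2 * t2)) * s"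
      unfolding s_def
      by (rule quadratic_form_difference_le[OF pert_sym dir_unit v1])
         (use pert_form_bounds[OF W b C] in auto)
    then show ?thesis by (simp add: G_def algebra_simps)
  qed
  finally have fin: "((vnorm p (rho 1))\<^sup>2 - R\<^sup>2) * s\<^sup>2 \<le> G * s" .
  \<comment> \<open>This settles s = 0, where G s cannot be divided by s.\<close>
  have G0: "G \<ge> 0"
  proof -
    have "\<eta> \<ge> 0" using W[of 1 1] m_pos abs_ge_zero[of "(\<Sum>i<n. V i 1 * V i 1) / n - (if (1::nat) = 1 then 1 else 0)"] by force
    moreover have "b \<ge> 0" using order_trans[OF vnorm_nonneg b[of 1]] m_pos by simp
    moreover have "t1 + t2 \<ge> 0" using C[OF dir_unit] by linarith
    ultimately have "0 \<le> \<eta> * total\<^sup>2" "0 \<le> sigma * b * total" "0 \<le> sigma\<^sup>2 * (t1 + t2)"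
      using total_nonneg sigma_pos by (auto simp del: distrib_left_numeral)
    then show ?thesis unfolding G_def by linarith
  qed
  have "((vnorm p (rho 1))\<^sup>2 - R\<^sup>2) * s \<le> G"
  proof (cases "s = 0")
    case False
    then have "s > 0" using s0 by simp
    moreover have "((vnorm p (rho 1))\<^sup>2 - R\<^sup>2) * s * s \<le> G * s" using fin by (simp add: power2_eq_square mult.assoc)
    ultimately show ?thesis by (rule mult_right_le_imp_le[rotated])
  qed (use G0 in simp)
  moreover have "sin (vangle p v (rho 1)) = s"
    using sin_vangle[OF v1 rho1_pos] by (simp add: s_def dir_def[abs_def])
  ultimately show ?thesis by (simp add: G_def)
qed

text \<open>A crude bound on the largest sample eigenvalue. It serves the lower bound for the angle,
  where it matters only that it stays bounded in n.\<close>

lemma sample_form_upper: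
  assumes W: "\<And>j k. j \<in> {1..m} \<Longrightarrow> k \<in> {1..m} \<Longrightarrow> \<bar>(\<Sum>i<n. V i j * V i k) / n - (if j = k then 1 else 0)\<bar> \<le> \<eta>"
    and b: "\<And>j. j \<in> {1..m} \<Longrightarrow> vnorm p (cross V Z j) \<le> b"
    and C: "\<And>x. vdot p x x = 1 \<Longrightarrow> - t2 \<le> (\<Sum>i<n. (vdot p (Z i) x)\<^sup>2) / n - 1 \<and> (\<Sum>i<n. (vdot p (Z i) x)\<^sup>2) / n - 1 \<le> t1"
  shows "vdot p x (mat_vec p (sample_cov n (obs V Z)) x) \<le>
     ((1 + \<eta>) * total\<^sup>2 + 2 * sigma * b * total + sigma\<^sup>2 * (1 + t1)) * vdot p x x"
proof -
  have "(\<Sum>j\<in>{1..m}. (vdot p (rho j) x)\<^sup>2) \<le> (\<Sum>j\<in>{1..m}. \<bar>vdot p (rho j) x\<bar>)\<^sup>2"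
  proof -
    have "(\<Sum>j\<in>{1..m}. \<bar>vdot p (rho j) x\<bar> * \<bar>vdot p (rho j) x\<bar>) \<le> (\<Sum>j\<in>{1..m}. \<bar>vdot p (rho j) x\<bar> * (\<Sum>j\<in>{1..m}. \<bar>vdot p (rho j) x\<bar>))"
      by (intro sum_mono mult_left_mono member_le_sum) auto
    then show ?thesis by (simp add: sum_distrib_right[symmetric] power2_eq_square)
  qed
  also have "\<dots> \<le> (\<Sum>j\<in>{1..m}. vnorm p (rho j) * vnorm p x)\<^sup>2"
    by (intro power_mono sum_mono vdot_abs_le sum_nonneg) auto
  also have "\<dots> = total\<^sup>2 * vdot p x x"
    by (simp add: total_def sum_distrib_right[symmetric] power_mult_distrib vnorm_power2)
  finally have 1: "(\<Sum>j\<in>{1..m}. (vdot p (rho j) x)\<^sup>2) \<le> total\<^sup>2 * vdot p x x" .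
  have "(\<Sum>j\<in>{1..m}. vdot p (rho j) (cross V Z j)) \<le> (\<Sum>j\<in>{1..m}. vnorm p (rho j) * b)"
  proof (intro sum_mono)
    fix j assume "j \<in> {1..m}"
    have "vdot p (rho j) (cross V Z j) \<le> vnorm p (rho j) * vnorm p (cross V Z j)"
      using vdot_abs_le[of p "rho j" "cross V Z j"] by simp
    also have "\<dots> \<le> vnorm p (rho j) * b" using b[OF \<open>j \<in> {1..m}\<close>] by (intro mult_left_mono) auto
    finally show "vdot p (rho j) (cross V Z j) \<le> vnorm p (rho j) * b" .
  qed
  then have c: "(\<Sum>j\<in>{1..m}. vdot p (rho j) (cross V Z j)) \<le> b * total"
    by (simp add: total_def sum_distrib_left mult.commute)
  have "vdot p x (mat_vec p (pert V Z) x) \<le> (\<eta> * total\<^sup>2 + sigma * (b * total + (\<Sum>j\<in>{1..m}. vdot p (rho j) (cross V Z j))) + sigma\<^sup>2 * t1) * vdot p x x"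
    by (rule pert_form_bounds(1)[OF W b C])
  also have "\<dots> \<le> (\<eta> * total\<^sup>2 + sigma * (b * total + b * total) + sigma\<^sup>2 * t1) * vdot p x x"
    using mult_left_mono[OF c, of sigma] sigma_pos by (intro mult_right_mono) (auto simp: algebra_simps)
  finally show ?thesis using 1 unfolding vdot_pert by (simp add: algebra_simps)
qed

end

section \<open>Lower bound for the angle at fixed data\<close>

lemma sample_cov_norm_le:
  assumes form: "\<And>y. vdot p y (mat_vec p (sample_cov n x) y) \<le> lam * vdot p y y" and lam: "0 \<le> lam"
  shows "vnorm p (mat_vec p (sample_cov n x) y) \<le> lam * vnorm p y"
proof -
  define w where "w = mat_vec p (sample_cov n x) y"
  have q: "(\<Sum>t<n. (vdot p (x t) z)\<^sup>2) / n \<le> lam * vdot p z z" for z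
    using form[of z] unfolding vdot_sample_cov by (simp add: power2_eq_square)
  have "vdot p w w = (\<Sum>t<n. vdot p (x t) w * vdot p (x t) y) / n"
    unfolding w_def vdot_sample_cov ..
  then have "(vdot p w w)\<^sup>2 = (\<Sum>t<n. vdot p (x t) w * vdot p (x t) y)\<^sup>2 / n\<^sup>2" by (simp add: power_divide)
  \<comment> \<open>Cauchy-Schwarz across the observations: by the Gram structure the form bounds at
    w and at y together control the norm of S y.\<close>
  also have "\<dots> \<le> ((\<Sum>t<n. (vdot p (x t) w)\<^sup>2) * (\<Sum>t<n. (vdot p (x t) y)\<^sup>2)) / n\<^sup>2"
    by (intro divide_right_mono Cauchy_Schwarz_ineq_sum) auto
  also have "\<dots> = ((\<Sum>t<n. (vdot p (x t) w)\<^sup>2) / n) * ((\<Sum>t<n. (vdot p (x t) y)\<^sup>2) / n)"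
    by (simp add: power2_eq_square)
  also have "\<dots> \<le> (lam * vdot p w w) * (lam * vdot p y y)"
    using lam by (intro mult_mono q) (auto intro!: divide_nonneg_nonneg sum_nonneg mult_nonneg_nonneg)
  finally have "(vdot p w w)\<^sup>2 \<le> vdot p w w * (lam\<^sup>2 * vdot p y y)" by (simp add: power2_eq_square mult_ac)
  then have "vdot p w w \<le> lam\<^sup>2 * vdot p y y"
    by (cases "vdot p w w = 0") (auto simp: power2_eq_square less_le)
  then have "sqrt (vdot p w w) \<le> sqrt (lam\<^sup>2 * vdot p y y)" by (rule real_sqrt_le_mono)
  then show ?thesis using lam by (simp add: w_def vnorm_def real_sqrt_mult)
qed

lemma vnorm_triangle: "vnorm p (\<lambda>k. u k - v k) \<le> vnorm p u + vnorm p v"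
proof (rule power2_le_imp_le)
  show "(vnorm p (\<lambda>k. u k - v k))\<^sup>2 \<le> (vnorm p u + vnorm p v)\<^sup>2"
    using vdot_abs_le[of p u v] unfolding vnorm_power2 vdot_linear power2_sum vdot_commute[of p v u]
    by simp
qed simp

text \<open>Choose the sign e with e (v.u) = \<kappa> \<ge> 0 and put d = u - e v, so that |d|^2 = 2
  - 2 \<kappa>. Since v is an eigenvector, (S - lam) u = (S - lam) d, which has norm at most 2 K
  |d|. The orthogonal component of S u is the shortest among the vectors S u - t u, hence \<delta>
  \<le> 2 K |d| and \<delta>^2 \<le> 8 K^2 (1 - \<kappa>).\<close>

lemma vangle_lower_bound:
  assumes top: "is_top_unit_eigvec p (sample_cov n x) v" and u: "vdot p u u = 1"
    and r: "vnorm p r > 0" "u = (\<lambda>k. 1 / vnorm p r * r k)"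
    and K: "\<And>y. vdot p y (mat_vec p (sample_cov n x) y) \<le> K * vdot p y y"
    and \<delta>: "0 < \<delta>" "\<delta> \<le> K"
      "\<delta> \<le> vnorm p (\<lambda>k. mat_vec p (sample_cov n x) u k - vdot p u (mat_vec p (sample_cov n x) u) * u k)"
  shows "arccos (1 - \<delta>\<^sup>2 / (8 * K\<^sup>2)) \<le> vangle p v r"
proof -
  let ?S = "sample_cov n x"
  have v1: "vdot p v v = 1" using top by (simp add: is_top_unit_eigvec_def vnorm_def)
  have vn: "vnorm p v = 1" "vnorm p u = 1" using v1 u by (simp_all add: vnorm_def)
  obtain lam where lam: "\<And>i. i < p \<Longrightarrow> mat_vec p ?S v i = lam * v i"
    "\<And>y. vdot p y (mat_vec p ?S y) \<le> lam * vdot p y y"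
    using top_unit_eigvec_rayleigh[OF sample_cov_sym top] by blast
  have Sv: "vdot p v (mat_vec p ?S v) = lam"
  proof -
    have "vdot p v (mat_vec p ?S v) = vdot p v (\<lambda>k. lam * v k)" using lam(1) by (intro vdot_cong) auto
    then show ?thesis by (simp add: vdot_linear v1)
  qed
  have lam0: "0 \<le> lam" unfolding Sv[symmetric] vdot_sample_cov by (auto intro!: divide_nonneg_nonneg sum_nonneg)
  have lamK: "lam \<le> K" using K[of v] Sv v1 by simp
  define \<kappa> where "\<kappa> = \<bar>vdot p v u\<bar>"
  have k1: "0 \<le> \<kappa>" "\<kappa> \<le> 1" using vdot_abs_le[of p v u] vn by (auto simp: \<kappa>_def)
  define e where "e = (if vdot p v u \<ge> 0 then 1 else -1 :: real)"
  have e: "e * vdot p v u = \<kappa>" "e * e = 1" by (auto simp: e_def \<kappa>_def)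
  define d where "d = (\<lambda>k. u k - e * v k)"
  have dd: "vdot p d d = 2 - 2 * \<kappa>"
    unfolding d_def vdot_linear vdot_commute[of p u v] u v1 using e by (simp add: algebra_simps)
  define w where "w = (\<lambda>k. mat_vec p ?S u k - lam * u k)"
  have "vnorm p w = vnorm p (\<lambda>k. mat_vec p ?S d k - lam * d k)"
  proof -
    have "w k = mat_vec p ?S d k - lam * d k" if "k < p" for k
      unfolding w_def d_def mat_vec_linear using lam(1)[OF that] by (simp add: algebra_simps)
    then show ?thesis unfolding vnorm_def by (intro arg_cong[where f = sqrt] vdot_cong) auto
  qed
  also have "\<dots> \<le> vnorm p (mat_vec p ?S d) + vnorm p (\<lambda>k. lam * d k)" by (rule vnorm_triangle)
  also have "vnorm p (\<lambda>k. lam * d k) = lam * vnorm p d"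
    unfolding vnorm_def vdot_linear using lam0 by (simp add: real_sqrt_mult mult.assoc[symmetric])
  also have "vnorm p (mat_vec p ?S d) \<le> lam * vnorm p d" by (rule sample_cov_norm_le[OF lam(2) lam0])
  also have "lam * vnorm p d + lam * vnorm p d \<le> 2 * K * vnorm p d"
    using mult_right_mono[OF lamK, of "vnorm p d"] by simp
  finally have w_le: "vnorm p w \<le> 2 * K * vnorm p d" by simp
  define \<mu> where "\<mu> = vdot p u (mat_vec p ?S u)"
  have "vdot p (\<lambda>k. mat_vec p ?S u k - \<mu> * u k) (\<lambda>k. mat_vec p ?S u k - \<mu> * u k) + (\<mu> - lam)\<^sup>2 = vdot p w w"
    unfolding w_def vdot_linear vdot_commute[of p "mat_vec p ?S u" u] \<mu>_def[symmetric] u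
    by (simp add: power2_eq_square algebra_simps)
  then have "vnorm p (\<lambda>k. mat_vec p ?S u k - \<mu> * u k) \<le> vnorm p w"
    unfolding vnorm_def by (intro real_sqrt_le_mono) (metis le_add_same_cancel1 zero_le_power2)
  then have "\<delta> \<le> 2 * K * vnorm p d" using w_le \<delta>(3) by (simp add: \<mu>_def)
  then have "\<delta>\<^sup>2 \<le> (2 * K * vnorm p d)\<^sup>2" using \<delta> by (intro power_mono) auto
  also have "\<dots> = 8 * K\<^sup>2 * (1 - \<kappa>)" by (simp add: power_mult_distrib vnorm_power2 dd)
  finally have "\<kappa> \<le> 1 - \<delta>\<^sup>2 / (8 * K\<^sup>2)" using \<delta> by (simp add: field_simps)
  moreover have "0 \<le> \<delta>\<^sup>2 / (8 * K\<^sup>2)" by simp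
  ultimately have "arccos (1 - \<delta>\<^sup>2 / (8 * K\<^sup>2)) \<le> arccos \<kappa>" using k1 by (intro arccos_le_arccos) linarith+
  moreover have "\<kappa> = \<bar>vdot p v r\<bar> / (vnorm p v * vnorm p r)"
    unfolding \<kappa>_def r(2) vdot_linear using r(1) vn by (simp add: abs_mult)
  ultimately show ?thesis by (simp add: vangle_def)
qed

context spiked_design
begin

definition resid :: "(nat \<Rightarrow> nat \<Rightarrow> real) \<Rightarrow> (nat \<Rightarrow> nat \<Rightarrow> real) \<Rightarrow> nat \<Rightarrow> real" where
  "resid V Z k = mat_vec p (sample_cov n (obs V Z)) dir k - vdot p dir (mat_vec p (sample_cov n (obs V Z)) dir) * dir k"

lemma resid_eq:
  "resid V Z k = (\<Sum>i<n. obs V Z i k * (vnorm p (rho 1) * V i 1 + sigma * vdot p (Z i) dir)) / n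
     - (\<Sum>i<n. (vnorm p (rho 1) * V i 1 + sigma * vdot p (Z i) dir)\<^sup>2) / n * dir k"
proof -
  have "vdot p (obs V Z i) dir = vnorm p (rho 1) * V i 1 + sigma * vdot p (Z i) dir" for i
  proof -
    have "(\<Sum>j\<in>{1..m}. V i j * vdot p (rho j) dir) = (\<Sum>j\<in>{1..m}. if j = 1 then V i j * vnorm p (rho 1) else 0)"
      by (intro sum.cong refl) (simp add: vdot_rho_dir)
    also have "\<dots> = V i 1 * vnorm p (rho 1)" using m_pos by simp
    finally show ?thesis unfolding vdot_obs by simp
  qed
  then show ?thesis unfolding resid_def vdot_sample_cov mat_vec_sample_cov by (simp add: power2_eq_square)
qed

text \<open>\<open>y0\<close> and \<open>y1\<close> are the kept and the flipped part of the inner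
  product of an observation with \<open>dir\<close>. In the difference of the two residuals all
  terms even in the flipped noise cancel. On the coordinates in \<open>K\<close> there remain 2
  \<sigma> times the correlation of the noise with \<open>y0\<close>, which is the main term, and
  the correlations of \<open>y1\<close> with the scores and with \<open>y0\<close>, which are
  small.\<close>

lemma resid_flip_lower:
  fixes V Z :: "nat \<Rightarrow> nat \<Rightarrow> real"
  assumes K: "K \<subseteq> {..<p}"
  defines "y1 \<equiv> \<lambda>i. sigma * (\<Sum>k\<in>K. Z i k * dir k)"
    and "y0 \<equiv> \<lambda>i. vnorm p (rho 1) * V i 1 + sigma * (\<Sum>k\<in>{..<p} - K. Z i k * dir k)"
    and "Z' \<equiv> \<lambda>i k. (if k \<in> K then -1 else 1) * Z i k"
  shows "2 * sigma * L2_set (\<lambda>k. (\<Sum>i<n. y0 i * Z i k) / n) K - 2 * (\<Sum>j\<in>{1..m}. vnorm p (rho j) * \<bar>(\<Sum>i<n. V i j * y1 i) / n\<bar>)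
      - 4 * \<bar>(\<Sum>i<n. y0 i * y1 i) / n\<bar> \<le> vnorm p (resid V Z) + vnorm p (resid V Z')"
proof -
  let ?J = "{1..m}"
  have finK: "finite K" using K finite_subset by blast
  have split: "vdot p f dir = (\<Sum>k\<in>K. f k * dir k) + (\<Sum>k\<in>{..<p} - K. f k * dir k)" for f
    unfolding vdot_def using sum.subset_diff[OF K] by (simp add: add.commute)
  have y: "vnorm p (rho 1) * V i 1 + sigma * vdot p (Z i) dir = y0 i + y1 i" for i
    unfolding split y0_def y1_def by (simp add: algebra_simps)
  have y': "vnorm p (rho 1) * V i 1 + sigma * vdot p (Z' i) dir = y0 i - y1 i" for i
  proof -
    have "(\<Sum>k\<in>K. Z' i k * dir k) = - (\<Sum>k\<in>K. Z i k * dir k)" by (simp add: Z'_def sum_negf)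
    moreover have "(\<Sum>k\<in>{..<p} - K. Z' i k * dir k) = (\<Sum>k\<in>{..<p} - K. Z i k * dir k)"
      by (rule sum.cong) (auto simp: Z'_def)
    ultimately show ?thesis unfolding split y0_def y1_def by (simp add: algebra_simps)
  qed
  define s where "s i k = (\<Sum>j\<in>?J. V i j * rho j k)" for i k
  define \<beta> where "\<beta> j = (\<Sum>i<n. V i j * y1 i) / n" for j
  define \<kappa> where "\<kappa> = (\<Sum>i<n. y0 i * y1 i) / n"
  define \<zeta> where "\<zeta> k = (\<Sum>i<n. y0 i * Z i k) / n" for k
  have diff: "resid V Z k - resid V Z' k = 2 * sigma * \<zeta> k + (2 * (\<Sum>j\<in>?J. \<beta> j * rho j k) - 4 * \<kappa> * dir k)" if "k \<in> K" for k
  proof -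
    have o: "obs V Z i k = s i k + sigma * Z i k" "obs V Z' i k = s i k - sigma * Z i k" for i
      using that by (auto simp: obs_def s_def Z'_def)
    have 1: "(\<Sum>i<n. obs V Z i k * (y0 i + y1 i)) / n - (\<Sum>i<n. obs V Z' i k * (y0 i - y1 i)) / n
       = (\<Sum>i<n. 2 * s i k * y1 i) / n + 2 * sigma * \<zeta> k"
      unfolding \<zeta>_def times_divide_eq_right sum_distrib_left diff_divide_distrib[symmetric] add_divide_distrib[symmetric]
        sum_subtractf[symmetric] sum.distrib[symmetric] o
      by (intro arg_cong2[where f = "(/)"] sum.cong refl) (simp add: algebra_simps)
    have 2: "(\<Sum>i<n. 2 * s i k * y1 i) / n = 2 * (\<Sum>j\<in>?J. \<beta> j * rho j k)"
    proof -
      have "(\<Sum>i<n. 2 * s i k * y1 i) = (\<Sum>i<n. \<Sum>j\<in>?J. 2 * (V i j * y1 i * rho j k))"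
        unfolding s_def sum_distrib_left sum_distrib_right by (intro sum.cong refl) (simp add: mult_ac)
      also have "\<dots> = (\<Sum>j\<in>?J. \<Sum>i<n. 2 * (V i j * y1 i * rho j k))" by (rule sum.swap)
      finally show ?thesis
        unfolding \<beta>_def by (simp add: sum_divide_distrib sum_distrib_left sum_distrib_right)
    qed
    have 3: "(\<Sum>i<n. (y0 i + y1 i)\<^sup>2) / n - (\<Sum>i<n. (y0 i - y1 i)\<^sup>2) / n = 4 * \<kappa>"
      unfolding \<kappa>_def times_divide_eq_right sum_distrib_left diff_divide_distrib[symmetric] sum_subtractf[symmetric]
      by (intro arg_cong2[where f = "(/)"] sum.cong refl) (simp add: power2_eq_square algebra_simps)
    have "resid V Z k - resid V Z' k = ((\<Sum>i<n. obs V Z i k * (y0 i + y1 i)) / n - (\<Sum>i<n. obs V Z' i k * (y0 i - y1 i)) / n)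
      - ((\<Sum>i<n. (y0 i + y1 i)\<^sup>2) / n - (\<Sum>i<n. (y0 i - y1 i)\<^sup>2) / n) * dir k"
      unfolding resid_eq y y' by (simp add: algebra_simps)
    then show ?thesis unfolding 1 2 3 by simp
  qed
  have mono: "L2_set f K \<le> vnorm p f" for f
    unfolding vnorm_def L2_set_def vdot_def power2_eq_square[symmetric]
    by (intro real_sqrt_le_mono sum_mono2 K) auto
  have scale: "L2_set (\<lambda>k. c * f k) K = \<bar>c\<bar> * L2_set f K" for c f
    unfolding L2_set_def power_mult_distrib sum_distrib_left[symmetric] by (simp add: real_sqrt_mult)
  have sumL2: "L2_set (\<lambda>k. \<Sum>j\<in>I. f j k) K \<le> (\<Sum>j\<in>I. L2_set (f j) K)" if "finite I" for I :: "nat set" and f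
    using that
  proof (induction I)
    case empty then show ?case by (simp add: L2_set_def)
  next
    case (insert j I)
    then show ?case using L2_set_triangle_ineq[of "f j" "\<lambda>k. \<Sum>j\<in>I. f j k" K] by simp
  qed
  have "2 * sigma * L2_set \<zeta> K = L2_set (\<lambda>k. 2 * sigma * \<zeta> k) K" using sigma_pos by (simp add: scale)
  also have "\<dots> = L2_set (\<lambda>k. (resid V Z k + (- 1) * resid V Z' k) + ((-2) * (\<Sum>j\<in>?J. \<beta> j * rho j k) + 4 * \<kappa> * dir k)) K"
    using diff by (intro L2_set_cong refl) (force simp: algebra_simps)
  also have "\<dots> \<le> L2_set (\<lambda>k. resid V Z k + (- 1) * resid V Z' k) K + L2_set (\<lambda>k. (-2) * (\<Sum>j\<in>?J. \<beta> j * rho j k) + 4 * \<kappa> * dir k) K"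
    by (rule L2_set_triangle_ineq)
  also have "\<dots> \<le> (L2_set (resid V Z) K + L2_set (\<lambda>k. (- 1) * resid V Z' k) K)
      + (L2_set (\<lambda>k. (-2) * (\<Sum>j\<in>?J. \<beta> j * rho j k)) K + L2_set (\<lambda>k. 4 * \<kappa> * dir k) K)"
    by (intro add_mono L2_set_triangle_ineq)
  also have "\<dots> \<le> (vnorm p (resid V Z) + vnorm p (resid V Z')) + (2 * (\<Sum>j\<in>?J. vnorm p (rho j) * \<bar>\<beta> j\<bar>) + 4 * \<bar>\<kappa>\<bar>)"
  proof (intro add_mono)
    show "L2_set (resid V Z) K \<le> vnorm p (resid V Z)" by (rule mono)
    show "L2_set (\<lambda>k. (- 1) * resid V Z' k) K \<le> vnorm p (resid V Z')" unfolding scale using mono by simp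
    have "L2_set (\<lambda>k. \<Sum>j\<in>?J. \<beta> j * rho j k) K \<le> (\<Sum>j\<in>?J. L2_set (\<lambda>k. \<beta> j * rho j k) K)" by (rule sumL2) simp
    also have "\<dots> \<le> (\<Sum>j\<in>?J. vnorm p (rho j) * \<bar>\<beta> j\<bar>)"
      unfolding scale using mono by (intro sum_mono) (simp add: mult.commute mult_left_mono)
    finally show "L2_set (\<lambda>k. (-2) * (\<Sum>j\<in>?J. \<beta> j * rho j k)) K \<le> 2 * (\<Sum>j\<in>?J. vnorm p (rho j) * \<bar>\<beta> j\<bar>)"
      unfolding scale by simp
    have "L2_set dir K \<le> 1" using mono[of dir] dir_unit by (simp add: vnorm_def)
    then show "L2_set (\<lambda>k. 4 * \<kappa> * dir k) K \<le> 4 * \<bar>\<kappa>\<bar>"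
      unfolding scale by (simp add: abs_mult mult_left_le)
  qed
  finally show ?thesis by (simp add: \<zeta>_def[abs_def] \<beta>_def \<kappa>_def)
qed

end

section \<open>Exceptional events\<close>

text \<open>Only the exceptional set has to be measurable. This permits predicates that quantify
  over uncountably many vectors without a measurability proof for the set where they hold.\<close>

definition except_prob :: "'w measure \<Rightarrow> real \<Rightarrow> ('w \<Rightarrow> bool) \<Rightarrow> bool" where
  "except_prob M b P \<longleftrightarrow> (\<exists>E\<in>sets M. measure M E \<le> b \<and> (\<forall>w\<in>space M - E. P w))"

context prob_space
begin

lemma except_probI:
  assumes "{w\<in>space M. \<not> P w} \<in> sets M" "prob {w\<in>space M. \<not> P w} \<le> b"
  shows "except_prob M b P"
  unfolding except_prob_def using assms by (intro bexI[of _ "{w\<in>space M. \<not> P w}"]) auto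

lemma except_prob_leI:
  fixes f g :: "_ \<Rightarrow> real"
  assumes [measurable]: "f \<in> borel_measurable M" "g \<in> borel_measurable M"
    and "prob {w\<in>space M. g w < f w} \<le> b"
  shows "except_prob M b (\<lambda>w. f w \<le> g w)"
  using assms(3) by (intro except_probI) (auto simp: not_le)

lemma except_prob_mono:
  assumes "except_prob M a P" "a \<le> b" "\<And>w. w \<in> space M \<Longrightarrow> P w \<Longrightarrow> Q w"
  shows "except_prob M b Q"
proof -
  obtain E where "E \<in> sets M" "prob E \<le> a" "\<forall>w\<in>space M - E. P w"
    using assms(1) by (auto simp: except_prob_def)
  then show ?thesis unfolding except_prob_def using assms(2,3) by (intro bexI[of _ E]) auto
qed

lemma except_prob_conj:
  assumes "except_prob M a P" "except_prob M b Q"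
  shows "except_prob M (a + b) (\<lambda>w. P w \<and> Q w)"
proof -
  obtain E where E: "E \<in> sets M" "prob E \<le> a" "\<forall>w\<in>space M - E. P w"
    using assms(1) by (auto simp: except_prob_def)
  obtain F where F: "F \<in> sets M" "prob F \<le> b" "\<forall>w\<in>space M - F. Q w"
    using assms(2) by (auto simp: except_prob_def)
  show ?thesis unfolding except_prob_def
  proof (intro bexI[of _ "E \<union> F"] conjI ballI)
    show "prob (E \<union> F) \<le> a + b" using measure_Un_le[OF E(1) F(1)] E(2) F(2) by simp
  qed (use E F in auto)
qed

lemma except_prob_ball:
  assumes "finite I" "\<And>i. i \<in> I \<Longrightarrow> except_prob M b (P i)"
  shows "except_prob M (real (card I) * b) (\<lambda>w. \<forall>i\<in>I. P i w)"
proof -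
  obtain E where E: "\<And>i. i \<in> I \<Longrightarrow> E i \<in> sets M \<and> prob (E i) \<le> b \<and> (\<forall>w\<in>space M - E i. P i w)"
    using assms(2) unfolding except_prob_def by metis
  show ?thesis unfolding except_prob_def
  proof (intro bexI[of _ "\<Union>i\<in>I. E i"] conjI ballI)
    have "prob (\<Union>i\<in>I. E i) \<le> (\<Sum>i\<in>I. prob (E i))" using E by (intro measure_UNION_le assms) auto
    also have "\<dots> \<le> (\<Sum>i\<in>I. b)" using E by (intro sum_mono) auto
    finally show "prob (\<Union>i\<in>I. E i) \<le> real (card I) * b" by simp
  qed (use E assms in auto)
qed

end

text \<open>Coordinate vectors as coefficients: a single column becomes a combination of columns, so
  the concentration of bilinear forms applies to the entries of a Gram matrix.\<close>

lemma sum_indicator_column: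
  fixes f :: "'a \<Rightarrow> real"
  assumes "finite J" "b \<in> J"
  shows "(\<Sum>a\<in>J. (if a = b then 1 else 0) * f a) = f b"
    and "L2_set (\<lambda>a. if a = b then 1 else 0 :: real) J = 1"
proof -
  have "(\<Sum>a\<in>J. (if a = b then 1 else 0) * f a) = (\<Sum>a\<in>J. if a = b then f a else 0)"
    by (rule sum.cong) auto
  then show "(\<Sum>a\<in>J. (if a = b then 1 else 0) * f a) = f b" using assms by simp
  have "(\<Sum>a\<in>J. (if a = b then 1 else 0 :: real)\<^sup>2) = (\<Sum>a\<in>J. if a = b then 1 else 0)"
    by (rule sum.cong) auto
  then show "L2_set (\<lambda>a. if a = b then 1 else 0 :: real) J = 1" using assms by (simp add: L2_set_def)
qed

section \<open>Numerical constants of the noise bound\<close>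

lemma exp_1_gt: "(2718/1000 :: real) < exp 1"
  using e_approx_32 by (simp add: abs_if split: if_splits)

text \<open>By convexity exp (y / 2) lies below its chord between y = 0 and y = 1, and the square
  root of e is at most 1.65.\<close>

lemma exp_half_le: 
  assumes "0 \<le> y" "y \<le> 1"
  shows "exp (y / 2) \<le> 1 + (65/100) * (y::real)"
proof -
  have "exp ((1 - y) *\<^sub>R 0 + y *\<^sub>R (1/2)) \<le> (1 - y) * exp 0 + y * exp (1/2 :: real)"
    using convex_onD[OF exp_convex, of y "0::real" "1/2"] assms by simp
  moreover have "exp (1/2 :: real) \<le> 165/100"
  proof (rule power2_le_imp_le)
    have "(exp (1/2 :: real))\<^sup>2 = exp 1" by (simp add: power2_eq_square exp_add[symmetric])
    then show "(exp (1/2 :: real))\<^sup>2 \<le> (165/100)\<^sup>2" using e_less_272 by (simp add: power2_eq_square)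
  qed simp
  then have "y * exp (1/2 :: real) \<le> y * (165/100)" using assms by (intro mult_left_mono) auto
  ultimately show ?thesis by simp
qed

text \<open>Two requirements confine the constants: \<open>norm_tail_base\<close> asks for large
  ones, so that the tail decays exponentially, and \<open>norm_bound_le\<close> for small ones, so
  that the width fits the claimed bound.\<close>

definition norm_bound :: "real \<Rightarrow> real" where
  "norm_bound c = 36/10 * sqrt c + 32/10 * c"

text \<open>The base of the exponential tail bound at \<open>s = r / (1 + r)\<close>, \<open>r = sqrt (2 c)\<close>; the numerical factor \<open>404/100\<close> absorbs
  rounding \<open>c n / 2\<close> up to an integer.\<close>

lemma norm_tail_base:
  fixes c :: real
  assumes c: "c > 0"
  defines "r \<equiv> sqrt (2 * c)"
  shows "(404/100) * r\<^sup>2 / (exp 1 * (r / (1 + r)) * norm_bound c) * exp (1 / (2 * (1 + r))) \<le> 97/100"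
proof -
  have r: "r > 0" using c by (simp add: r_def)
  have cr: "c = r\<^sup>2 / 2" using c by (simp add: r_def)
  have sq: "sqrt c = r / sqrt 2" using c by (simp add: r_def real_sqrt_mult)
  have s2: "sqrt 2 \<le> 14143/10000" by (rule real_le_lsqrt) (auto simp: power2_eq_square)
  \<comment> \<open>Since sqrt c = r / sqrt 2, the coefficient is 3.6 / sqrt 2 rounded down. The
    other summand is 3.2 c = 1.6 r^2.\<close>
  have "2545/1000 * r \<le> 36/10 * sqrt c"
  proof -
    have "2545/1000 * sqrt 2 \<le> 36/10" using s2 by simp
    then have "2545/1000 * sqrt 2 * r \<le> 36/10 * r" using r by (intro mult_right_mono) auto
    then show ?thesis unfolding sq by (simp add: field_simps)
  qed
  then have t: "r * (2545/1000 + 16/10 * r) \<le> norm_bound c"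
    by (simp add: norm_bound_def cr power2_eq_square algebra_simps)
  have t0: "0 < r * (2545/1000 + 16/10 * r)" using r by simp
  then have t1: "0 < norm_bound c" using t by linarith
  define y where "y = 1 / (1 + r)"
  have y: "0 \<le> y" "y \<le> 1" "y * (1 + r) = 1" using r by (auto simp: y_def)
  have ey: "(1 + r) * exp (y / 2) \<le> r + 165/100"
  proof -
    have "(1 + r) * exp (y / 2) \<le> (1 + r) * (1 + (65/100) * y)"
      using exp_half_le[OF y(1,2)] r by (intro mult_left_mono) auto
    also have "\<dots> = 1 + r + (65/100) * (y * (1 + r))" by (simp add: algebra_simps)
    finally show ?thesis using y(3) by simp
  qed
  have "(404/100) * r\<^sup>2 / (exp 1 * (r / (1 + r)) * norm_bound c) * exp (1 / (2 * (1 + r)))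
      = (404/100) * r * ((1 + r) * exp (y / 2)) / (exp 1 * norm_bound c)"
    using r t1 by (simp add: y_def power2_eq_square field_simps)
  also have "\<dots> \<le> (404/100) * r * (r + 165/100) / (exp 1 * norm_bound c)"
    using r t1 ey by (intro divide_right_mono mult_left_mono) auto
  also have "\<dots> \<le> (404/100) * r * (r + 165/100) / ((2718/1000) * (r * (2545/1000 + 16/10 * r)))"
    using r t t0 t1 exp_1_gt by (intro divide_left_mono mult_mono mult_pos_pos) auto
  also have "\<dots> = (404/100) * (r + 165/100) / ((2718/1000) * (2545/1000 + 16/10 * r))"
  proof -
    have "a * r * b / (d * (r * e)) = a * b / (d * e)" for a b d e :: real using r by simp
    then show ?thesis .
  qed
  also have "\<dots> \<le> 97/100"
  proof -
    \<comment> \<open>Both sides are affine in r, so coefficients can be compared. The constant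
      terms are the tight ones: about 6.67 against 6.71.\<close>
    have "(404/100) * (r + 165/100) \<le> 97/100 * ((2718/1000) * (2545/1000 + 16/10 * r))"
      using r by (simp add: algebra_simps)
    then show ?thesis using r by (subst pos_divide_le_eq) auto
  qed
  finally show ?thesis .
qed

lemma (in prob_space) gaussian_matrix_norm_except:
  fixes n p :: nat and c :: real
  assumes X: "std_normals M X ({..<n} \<times> {..<p})" and p: "p > 0" and n: "n > 0" and c: "c > 0"
    and pc: "real p \<le> c * n" and nc: "200 \<le> c * n"
  shows "except_prob M (2 * (c * n + 2)\<^sup>2 * (97/100) powr (c * n))
     (\<lambda>w. \<forall>x. vdot p x x = 1 \<longrightarrow> \<bar>(\<Sum>i<n. (vdot p (\<lambda>k. X (i, k) w) x)\<^sup>2) / n - 1\<bar> \<le> norm_bound c)"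
proof -
  define r where "r = sqrt (2 * c)"
  \<comment> \<open>This makes n s^2 / (4 (1 - s)) equal to n c / (2 (1 + r)), a multiple of c n.
    Since 2k is at least c n, and less than c n + 2, the exponential factor can be absorbed into the
    base of the power 2k.\<close>
  define s where "s = r / (1 + r)"
  define k where "k = nat \<lceil>c * n / 2\<rceil>"
  have r: "r > 0" using c by (simp add: r_def)
  have r2: "r\<^sup>2 = 2 * c" using c by (simp add: r_def)
  have s: "0 < s" "s < 1" using r by (auto simp: s_def)
  have k1: "c * n \<le> 2 * real k" using real_nat_ceiling_ge[of "c * n / 2"] by (simp add: k_def)
  have k2: "real k \<le> c * n / 2 + 1" 
  proof -
    have "0 \<le> c * n / 2" using c by simp
    then have "real k = of_int \<lceil>c * n / 2\<rceil>" by (simp add: k_def)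
    then show ?thesis by linarith
  qed
  have t: "norm_bound c > 0" unfolding norm_bound_def using c by (simp add: add_pos_pos)
  have kp: "card {..<p} \<le> 2 * k" using k1 pc by simp
  have ne: "{..<p} \<noteq> {}" using p by auto
  obtain E where E: "E \<in> sets M"
    "prob E \<le> 2 * (real k + 1)\<^sup>2 * (16 * real k / (exp 1 * s * n * norm_bound c)) ^ (2*k) * exp (n * s\<^sup>2 / (4 * (1 - s)))"
    "\<forall>w\<in>space M - E. \<forall>x. (\<Sum>j<p. (x j)\<^sup>2) = 1 \<longrightarrow> \<bar>(\<Sum>i<n. (\<Sum>j<p. x j * X (i, j) w)\<^sup>2) / n - 1\<bar> \<le> norm_bound c"
    using gaussian_matrix_norm_tail[OF X _ ne n s kp t] by auto
  have "prob E \<le> 2 * (c * n + 2)\<^sup>2 * (97/100) powr (c * n)"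
  proof -
    define q where "q = 16 * real k / (exp 1 * s * n * norm_bound c) * exp (1 / (2 * (1 + r)))"
    have q0: "q \<ge> 0" unfolding q_def using s t by simp
    have "n * s\<^sup>2 / (4 * (1 - s)) = n * c / (2 * (1 + r))"
    proof -
      have "1 - s = 1 / (1 + r)" using r by (simp add: s_def field_simps)
      moreover have "(r / a)\<^sup>2 / (1 / a) = r\<^sup>2 / a" for a by (simp add: power2_eq_square)
      ultimately have "s\<^sup>2 / (1 - s) = r\<^sup>2 / (1 + r)" by (simp only: s_def)
      then have "n * (s\<^sup>2 / (1 - s)) / 4 = n * (2 * c / (1 + r)) / 4" by (simp only: r2)
      then show ?thesis using r s by (simp add: field_simps)
    qed
    also have "\<dots> \<le> real (2 * k) * (1 / (2 * (1 + r)))"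
      using k1 r by (simp add: divide_right_mono mult.commute)
    finally have "exp (n * s\<^sup>2 / (4 * (1 - s))) \<le> exp (1 / (2 * (1 + r))) ^ (2*k)"
      unfolding exp_of_nat_mult[symmetric] exp_le_cancel_iff .
    then have "(16 * real k / (exp 1 * s * n * norm_bound c)) ^ (2*k) * exp (n * s\<^sup>2 / (4 * (1 - s)))
       \<le> (16 * real k / (exp 1 * s * n * norm_bound c)) ^ (2*k) * exp (1 / (2 * (1 + r))) ^ (2*k)"
      using s t by (intro mult_left_mono) auto
    also have "\<dots> = q ^ (2*k)" unfolding q_def power_mult_distrib ..
    also have "q \<le> 97/100"
    proof -
      \<comment> \<open>Rounding up gives 16 k \<le> 8 c n + 16. The surplus 16 is at most 0.08 c n
        exactly because c n \<ge> 200, and with r^2 = 2 c the sum is 4.04 r^2 n.\<close>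
      have "16 * real k \<le> (404/100) * r\<^sup>2 * n"
        using k2 nc unfolding r2 by (simp add: algebra_simps)
      then have "q \<le> (404/100) * r\<^sup>2 * n / (exp 1 * s * n * norm_bound c) * exp (1 / (2 * (1 + r)))"
        unfolding q_def using s t by (intro mult_right_mono divide_right_mono) auto
      also have "\<dots> = (404/100) * r\<^sup>2 / (exp 1 * (r / (1 + r)) * norm_bound c) * exp (1 / (2 * (1 + r)))"
        using n by (simp add: s_def mult_ac)
      also have "\<dots> \<le> 97/100" using norm_tail_base[OF c] by (simp add: r_def)
      finally show ?thesis .
    qed
    then have "q ^ (2*k) \<le> (97/100) ^ (2*k)" using q0 by (intro power_mono)
    also have "(97/100 :: real) ^ (2*k) = (97/100) powr (2 * real k)" by (subst powr_realpow[symmetric]) auto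
    also have "\<dots> \<le> (97/100) powr (c * n)" using k1 by (intro powr_mono') auto
    finally have "(16 * real k / (exp 1 * s * n * norm_bound c)) ^ (2*k) * exp (n * s\<^sup>2 / (4 * (1 - s))) \<le> (97/100) powr (c * n)"
      by simp
    moreover have "(real k + 1)\<^sup>2 \<le> (c * n + 2)\<^sup>2" using k2 nc by (intro power_mono) auto
    ultimately have "2 * (real k + 1)\<^sup>2 * ((16 * real k / (exp 1 * s * n * norm_bound c)) ^ (2*k) * exp (n * s\<^sup>2 / (4 * (1 - s))))
       \<le> 2 * (c * n + 2)\<^sup>2 * (97/100) powr (c * n)"
      using s t by (intro mult_mono) auto
    then show ?thesis using E(2) by (simp only: mult.assoc)
  qed
  then show ?thesis unfolding except_prob_def
    using E(1,3) by (intro bexI[of _ E]) (auto simp: vdot_def power2_eq_square mult.commute)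
qed

context spiked_design
begin

text \<open>For p about c n the norm of \<open>cross V Z j\<close> is typically close to sqrt c. The
  bound 2 sqrt c leaves a factor 2 for the squared length of the score vector and another for the
  noise energy projected onto it.\<close>

definition well_behaved :: "real \<Rightarrow> real \<Rightarrow> (nat \<Rightarrow> nat \<Rightarrow> real) \<Rightarrow> (nat \<Rightarrow> nat \<Rightarrow> real) \<Rightarrow> bool" where
  "well_behaved c \<eta> V Z \<longleftrightarrow>
     (\<forall>j\<in>{1..m}. \<forall>k\<in>{1..m}. \<bar>(\<Sum>i<n. V i j * V i k) / n - (if j = k then 1 else 0)\<bar> \<le> \<eta>) \<and>
     (\<forall>j\<in>{1..m}. vnorm p (cross V Z j) \<le> 2 * sqrt c) \<and>
     (\<forall>x. vdot p x x = 1 \<longrightarrow> \<bar>(\<Sum>i<n. (vdot p (Z i) x)\<^sup>2) / n - 1\<bar> \<le> norm_bound c)"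

lemma well_behaved_except:
  fixes c \<eta> :: real
  assumes "prob_space M" and X: "std_normals M X ({..<n} \<times> ({1..m} <+> {..<p}))"
    and mp: "m \<le> p" and c: "c > 0" and pc: "real p \<le> c * n" and nc: "200 \<le> c * n" and \<eta>: "0 < \<eta>" "\<eta> \<le> 1"
  shows "except_prob M (4 * (c * n)\<^sup>2 * exp (- real n * \<eta>\<^sup>2 / 8) + c * n * exp (- c * n / 8) + 2 * (c * n + 2)\<^sup>2 * (97/100) powr (c * n))
     (\<lambda>w. well_behaved c \<eta> (\<lambda>i j. X (i, Inl j) w) (\<lambda>i k. X (i, Inr k) w))"
proof -
  interpret prob_space M by fact
  let ?Q = "\<lambda>j w. \<Sum>k<p. (\<Sum>i<n. X (i, Inl j) w * X (i, Inr k) w)\<^sup>2"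
    and ?N = "\<lambda>j w. \<Sum>i<n. (X (i, Inl j) w)\<^sup>2"
    and ?W = "\<lambda>j k w. \<bar>(\<Sum>i<n. X (i, Inl j) w * X (i, Inl k) w) / n - (if j = k then 1 else 0)\<bar>"
  let ?J = "{1..m} <+> {..<p}"
  have finJ: "finite ?J" by simp
  have p: "p > 0" using mp m_pos by simp
  have XV: "X (i, Inl j) \<in> borel_measurable M" if "i < n" "j \<in> {1..m}" for i j
    using that by (intro std_normals_measurable[OF X]) auto
  have XZ: "X (i, Inr k) \<in> borel_measurable M" if "i < n" "k < p" for i k
    using that by (intro std_normals_measurable[OF X]) auto
  have e1: "except_prob M (4 * exp (- real n * \<eta>\<^sup>2 / 8))
     (\<lambda>w. ?W j k w \<le> \<eta>)"
    if "j \<in> {1..m}" "k \<in> {1..m}" for j k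
  proof (rule except_prob_leI)
    show "(\<lambda>w. ?W j k w) \<in> borel_measurable M"
      using that by (intro borel_measurable_abs borel_measurable_diff borel_measurable_divide borel_measurable_sum
          borel_measurable_times borel_measurable_const XV) auto
    let ?g = "\<lambda>j (a :: nat + nat). if a = Inl j then 1 else 0 :: real"
    have in_J: "Inl j \<in> ?J" "Inl k \<in> ?J" using that by auto
    have s: "(\<Sum>a\<in>?J. ?g j a * X (i, a) w) = X (i, Inl j) w" "(\<Sum>a\<in>?J. ?g k a * X (i, a) w) = X (i, Inl k) w" for i w
      by (rule sum_indicator_column[OF finJ in_J(1)], rule sum_indicator_column[OF finJ in_J(2)])
    have g: "(\<Sum>a\<in>?J. ?g j a * ?g k a) = (if j = k then 1 else 0)"
      using sum_indicator_column(1)[OF finJ in_J(1), of "?g k"] by auto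
    have "prob {w\<in>space M. \<eta> * (L2_set (?g j) ?J * L2_set (?g k) ?J) <
       \<bar>(\<Sum>i<n. (\<Sum>a\<in>?J. ?g j a * X (i, a) w) * (\<Sum>a\<in>?J. ?g k a * X (i, a) w)) / n - (\<Sum>a\<in>?J. ?g j a * ?g k a)\<bar>}
     \<le> 4 * exp (- real n * \<eta>\<^sup>2 / 8)"
      by (rule gaussian_bilinear_concentration[OF X finJ n_pos \<eta>])
    then show "prob {w\<in>space M. \<eta> < ?W j k w} \<le> 4 * exp (- real n * \<eta>\<^sup>2 / 8)"
      unfolding s g sum_indicator_column(2)[OF finJ in_J(1)] sum_indicator_column(2)[OF finJ in_J(2)]
      by simp
  qed simp
  have e2: "except_prob M (exp (- c * n / 8))
     (\<lambda>w. ?Q j w \<le> 2 * c * n * ?N j w)"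
    if j: "j \<in> {1..m}" for j
  proof (rule except_prob_leI)
    show Qm: "(\<lambda>w. \<Sum>k<p. (\<Sum>i<n. X (i, Inl j) w * X (i, Inr k) w)\<^sup>2) \<in> borel_measurable M"
      using j by (intro borel_measurable_sum borel_measurable_power borel_measurable_times XV XZ) auto
    have Nm: "(\<lambda>w. \<Sum>i<n. (X (i, Inl j) w)\<^sup>2) \<in> borel_measurable M"
      using j by (intro borel_measurable_sum borel_measurable_power XV) auto
    show "(\<lambda>w. 2 * c * n * ?N j w) \<in> borel_measurable M"
      by (intro borel_measurable_times borel_measurable_const Nm)
    have set: "{w\<in>space M. 0 < N w \<and> 1/4 * (2 * c * n) * N w \<le> 1/4 * Q w} \<in> sets M"
      if "N \<in> borel_measurable M" "Q \<in> borel_measurable M" for N Q :: "_ \<Rightarrow> real" using that by measurable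
    let ?K = "Inr ` {..<p} :: (nat + nat) set"
    \<comment> \<open>With \<theta> = 1/4 and t = 2 c n the exponent is - c n / 2 + (p / 2) ln 2;
      from p \<le> c n and ln 2 \<le> 3/4 it is at most - c n / 8.\<close>
    have "prob {w\<in>space M. 0 < (\<Sum>i<n. (\<Sum>a\<in>{Inl j}. 1 * X (i, a) w)\<^sup>2) \<and>
       1/4 * (2 * c * n) * (\<Sum>i<n. (\<Sum>a\<in>{Inl j}. 1 * X (i, a) w)\<^sup>2) \<le> 1/4 * (\<Sum>k\<in>?K. (\<Sum>i<n. (\<Sum>a\<in>{Inl j}. 1 * X (i, a) w) * X (i, k) w)\<^sup>2)}
      \<le> exp (- (1/4) * (2 * c * n)) * (1 - 2 * (1/4)) powr (- real (card ?K) / 2)"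
      by (rule projected_columns_tail[OF X]) (use j in auto)
    also have "(\<lambda>f. \<Sum>k\<in>?K. f k) = (\<lambda>f. \<Sum>k<p. f (Inr k) :: real)"
      by (subst sum.reindex) auto
    also have "card ?K = p" by (simp add: card_image)
    also have "exp (- (1/4) * (2 * c * n)) * (1 - 2 * (1/4)) powr (- real p / 2) \<le> exp (- c * n / 8)"
    proof -
      have "(2::real) \<le> exp (3/4)" using exp_lower_Taylor_quadratic[of "3/4 :: real"] by (simp add: power2_eq_square)
      then have "ln 2 \<le> (3/4 :: real)" using ln_le_cancel_iff[of 2 "exp (3/4)"] by simp
      then have "real p / 2 * ln 2 \<le> (c * n) / 2 * (3/4)" using pc by (intro mult_mono) auto
      moreover have "(1 - 2 * (1/4)) powr (- real p / 2) = exp (real p / 2 * ln 2)"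
        by (simp add: powr_def ln_div)
      ultimately show ?thesis unfolding exp_add[symmetric] by (simp add: exp_add[symmetric])
    qed
    finally have *: "prob {w\<in>space M. 0 < ?N j w \<and>
       1/4 * (2 * c * n) * ?N j w \<le> 1/4 * ?Q j w} \<le> exp (- c * n / 8)"
      by simp
    have "prob {w\<in>space M. 2 * c * n * ?N j w < ?Q j w}
       \<le> prob {w\<in>space M. 0 < ?N j w \<and>
       1/4 * (2 * c * n) * ?N j w \<le> 1/4 * ?Q j w}"
    proof (rule finite_measure_mono)
      show "{w\<in>space M. 2 * c * n * ?N j w < ?Q j w}
        \<subseteq> {w\<in>space M. 0 < ?N j w \<and>
       1/4 * (2 * c * n) * ?N j w \<le> 1/4 * ?Q j w}"
      proof clarify
        fix w assume w: "2 * c * n * ?N j w < ?Q j w"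
        have "?N j w \<noteq> 0"
        proof
          assume "?N j w = 0"
          then have "\<forall>i<n. X (i, Inl j) w = 0" by (simp add: sum_nonneg_eq_0_iff)
          then show False using w c by simp
        qed
        moreover have "0 \<le> ?N j w" by (simp add: sum_nonneg)
        ultimately show "0 < ?N j w \<and>
       1/4 * (2 * c * n) * ?N j w \<le> 1/4 * ?Q j w"
          using w by simp
      qed
    qed (rule set[OF Nm Qm])
    then show "prob {w\<in>space M. 2 * c * n * ?N j w < ?Q j w} \<le> exp (- c * n / 8)"
      using * by simp
  qed
  have XZn: "std_normals M (\<lambda>t. X (fst t, Inr (snd t))) ({..<n} \<times> {..<p})"
    by (rule std_normals_reindex[OF X, where f = "\<lambda>t. (fst t, Inr (snd t))"]) (auto simp: inj_on_def)
  have e3: "except_prob M (2 * (c * n + 2)\<^sup>2 * (97/100) powr (c * n))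
     (\<lambda>w. \<forall>x. vdot p x x = 1 \<longrightarrow> \<bar>(\<Sum>i<n. (vdot p (\<lambda>k. X (i, Inr k) w) x)\<^sup>2) / n - 1\<bar> \<le> norm_bound c)"
    using gaussian_matrix_norm_except[OF XZn p n_pos c pc nc] by simp
  have e1': "except_prob M (real (card {1..m}) * (real (card {1..m}) * (4 * exp (- real n * \<eta>\<^sup>2 / 8))))
     (\<lambda>w. \<forall>j\<in>{1..m}. \<forall>k\<in>{1..m}. ?W j k w \<le> \<eta>)"
    by (intro except_prob_ball e1) auto
  have e2': "except_prob M (real (card {1..m}) * exp (- c * n / 8))
     (\<lambda>w. \<forall>j\<in>{1..m}. ?Q j w \<le> 2 * c * n * ?N j w)"
    by (intro except_prob_ball e2) auto
  show ?thesis
  proof (rule except_prob_mono[OF except_prob_conj[OF except_prob_conj[OF e1' e2'] e3]])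
    have mc: "real m \<le> c * n" using mp pc by simp
    have "real m * (real m * (4 * exp (- real n * \<eta>\<^sup>2 / 8))) = 4 * (real m * real m) * exp (- real n * \<eta>\<^sup>2 / 8)" by simp
    also have "\<dots> \<le> 4 * (c * n * (c * n)) * exp (- real n * \<eta>\<^sup>2 / 8)"
      using mc by (intro mult_right_mono mult_left_mono mult_mono) auto
    finally have "real m * (real m * (4 * exp (- real n * \<eta>\<^sup>2 / 8))) \<le> 4 * (c * n)\<^sup>2 * exp (- real n * \<eta>\<^sup>2 / 8)"
      by (simp add: power2_eq_square)
    moreover have "real (card {1..m}) = real m" by simp
    moreover have "real m * exp (- c * n / 8) \<le> c * n * exp (- c * n / 8)"
      using mc by (intro mult_right_mono) auto
    ultimately show "real (card {1..m}) * (real (card {1..m}) * (4 * exp (- real n * \<eta>\<^sup>2 / 8))) + real (card {1..m}) * exp (- c * n / 8) + 2 * (c * n + 2)\<^sup>2 * (97/100) powr (c * n)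
      \<le> 4 * (c * n)\<^sup>2 * exp (- real n * \<eta>\<^sup>2 / 8) + c * n * exp (- c * n / 8) + 2 * (c * n + 2)\<^sup>2 * (97/100) powr (c * n)"
      by (simp only:)
  next
    fix w
    let ?V = "\<lambda>i j. X (i, Inl j) w" and ?Z = "\<lambda>i k. X (i, Inr k) w"
    assume H: "((\<forall>j\<in>{1..m}. \<forall>k\<in>{1..m}. ?W j k w \<le> \<eta>) \<and>
      (\<forall>j\<in>{1..m}. ?Q j w \<le> 2 * c * n * ?N j w)) \<and>
      (\<forall>x. vdot p x x = 1 \<longrightarrow> \<bar>(\<Sum>i<n. (vdot p (\<lambda>k. X (i, Inr k) w) x)\<^sup>2) / n - 1\<bar> \<le> norm_bound c)"
    have "vnorm p (cross ?V ?Z j) \<le> 2 * sqrt c" if j: "j \<in> {1..m}" for j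
    proof -
      have "\<bar>(\<Sum>i<n. ?V i j * ?V i j) / n - (if j = j then 1 else 0)\<bar> \<le> \<eta>"
        using conjunct1[OF conjunct1[OF H]] j by blast
      then have "(\<Sum>i<n. ?V i j * ?V i j) / n \<le> 2" using \<eta> by (simp only: simp_thms if_True)
      then have V2: "(\<Sum>i<n. (?V i j)\<^sup>2) \<le> 2 * n" using n_pos by (simp add: power2_eq_square divide_le_eq)
      have "vdot p (cross ?V ?Z j) (cross ?V ?Z j) = (\<Sum>k<p. (\<Sum>i<n. ?V i j * ?Z i k)\<^sup>2) / n\<^sup>2"
        unfolding vdot_def cross_def by (simp add: power2_eq_square sum_divide_distrib[symmetric])
      also have "\<dots> \<le> 2 * c * n * (\<Sum>i<n. (?V i j)\<^sup>2) / n\<^sup>2"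
        using conjunct2[OF conjunct1[OF H]] j by (intro divide_right_mono) auto
      also have "\<dots> \<le> 2 * c * n * (2 * n) / n\<^sup>2"
        using V2 c by (intro divide_right_mono mult_left_mono) auto
      also have "\<dots> = 2\<^sup>2 * c" using n_pos by (simp add: power2_eq_square)
      finally have "sqrt (vdot p (cross ?V ?Z j) (cross ?V ?Z j)) \<le> sqrt (2\<^sup>2 * c)" by (rule real_sqrt_le_mono)
      then show ?thesis by (simp add: vnorm_def real_sqrt_mult)
    qed
    then show "well_behaved c \<eta> ?V ?Z" using H unfolding well_behaved_def by blast
  qed
qed

text \<open>A mean square is nonnegative, so -1 is always a valid lower end. Taking the better of
  the two lower ends keeps the width below 8 sqrt c + 4 c when c is large, where twice
  \<open>norm_bound c\<close> would exceed it.\<close>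

lemma well_behaved_C:
  assumes "well_behaved c \<eta> V Z" "vdot p x x = 1"
  shows "- min (norm_bound c) 1 \<le> (\<Sum>i<n. (vdot p (Z i) x)\<^sup>2) / n - 1 \<and> (\<Sum>i<n. (vdot p (Z i) x)\<^sup>2) / n - 1 \<le> norm_bound c"
proof -
  have "0 \<le> (\<Sum>i<n. (vdot p (Z i) x)\<^sup>2) / n" by (intro divide_nonneg_nonneg sum_nonneg) auto
  moreover have "\<bar>(\<Sum>i<n. (vdot p (Z i) x)\<^sup>2) / n - 1\<bar> \<le> norm_bound c"
    using assms by (auto simp: well_behaved_def)
  ultimately show ?thesis by (simp add: min_def abs_le_iff)
qed

lemma well_behaved_sin_le:
  assumes wb: "well_behaved c \<eta> V Z"
    and R: "\<And>j. j \<in> {2..m} \<Longrightarrow> vnorm p (rho j) \<le> R"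
    and top: "is_top_unit_eigvec p (sample_cov n (obs V Z)) v"
  shows "((vnorm p (rho 1))\<^sup>2 - R\<^sup>2) * sin (vangle p v (rho 1))
     \<le> 2 * \<eta> * total\<^sup>2 + 4 * sigma * sqrt c * total + sigma\<^sup>2 * (norm_bound c + min (norm_bound c) 1)"
proof -
  have "((vnorm p (rho 1))\<^sup>2 - R\<^sup>2) * sin (vangle p v (rho 1))
     \<le> 2 * \<eta> * total\<^sup>2 + 2 * sigma * (2 * sqrt c) * total + sigma\<^sup>2 * (norm_bound c + min (norm_bound c) 1)"
  proof (rule sin_vangle_le[OF _ _ _ R top])
    show "\<bar>(\<Sum>i<n. V i j * V i k) / n - (if j = k then 1 else 0)\<bar> \<le> \<eta>" if "j \<in> {1..m}" "k \<in> {1..m}" for j k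
      using wb that unfolding well_behaved_def by blast
    show "vnorm p (cross V Z j) \<le> 2 * sqrt c" if "j \<in> {1..m}" for j
      using wb that unfolding well_behaved_def by blast
  qed (use well_behaved_C[OF wb] in auto)
  then show ?thesis by (simp add: mult_ac)
qed

lemma well_behaved_form_upper:
  assumes wb: "well_behaved c \<eta> V Z" and \<eta>: "\<eta> \<le> 1" and c: "0 \<le> c"
  shows "vdot p x (mat_vec p (sample_cov n (obs V Z)) x) \<le>
     (2 * total\<^sup>2 + 4 * sigma * sqrt c * total + sigma\<^sup>2 * (1 + norm_bound c)) * vdot p x x"
proof -
  have "vdot p x (mat_vec p (sample_cov n (obs V Z)) x) \<le>
     ((1 + \<eta>) * total\<^sup>2 + 2 * sigma * (2 * sqrt c) * total + sigma\<^sup>2 * (1 + norm_bound c)) * vdot p x x"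
  proof (rule sample_form_upper)
    show "\<bar>(\<Sum>i<n. V i j * V i k) / n - (if j = k then 1 else 0)\<bar> \<le> \<eta>" if "j \<in> {1..m}" "k \<in> {1..m}" for j k
      using wb that unfolding well_behaved_def by blast
    show "vnorm p (cross V Z j) \<le> 2 * sqrt c" if "j \<in> {1..m}" for j
      using wb that unfolding well_behaved_def by blast
  qed (use well_behaved_C[OF wb] in auto)
  also have "\<dots> \<le> (2 * total\<^sup>2 + 4 * sigma * sqrt c * total + sigma\<^sup>2 * (1 + norm_bound c)) * vdot p x x"
    using mult_right_mono[OF \<eta>, of "total\<^sup>2"] by (intro mult_right_mono) (auto simp: algebra_simps)
  finally show ?thesis .
qed

end

section \<open>Sign flips and the size of the residual\<close>

lemma half_coordinates:
  assumes "(\<Sum>k<p. (u k)\<^sup>2) = (1::real)"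
  obtains K where "K \<subseteq> {..<p}" "p div 2 \<le> card K" "(\<Sum>k\<in>K. (u k)\<^sup>2) \<le> 1/2"
proof -
  have "{..<p} = {..<p div 2} \<union> {p div 2..<p}" by auto
  then have "(\<Sum>k<p. (u k)\<^sup>2) = (\<Sum>k<p div 2. (u k)\<^sup>2) + (\<Sum>k\<in>{p div 2..<p}. (u k)\<^sup>2)"
    by (simp add: sum.union_disjoint ivl_disj_int)
  then consider "(\<Sum>k<p div 2. (u k)\<^sup>2) \<le> 1/2" | "(\<Sum>k\<in>{p div 2..<p}. (u k)\<^sup>2) \<le> 1/2"
    using assms by linarith
  then show ?thesis
  proof cases
    case 1 then show ?thesis by (intro that[of "{..<p div 2}"]) auto
  next
    case 2 then show ?thesis by (intro that[of "{p div 2..<p}"]) auto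
  qed
qed

context spiked_design
begin

lemma resid_norm_cong:
  assumes "\<And>i j. i < n \<Longrightarrow> j \<in> {1..m} \<Longrightarrow> V i j = V' i j" "\<And>i k. i < n \<Longrightarrow> k < p \<Longrightarrow> Z i k = Z' i k"
  shows "vnorm p (resid V Z) = vnorm p (resid V' Z')"
proof -
  have 1: "1 \<in> {1..m}" using m_pos by simp
  have v: "vdot p (Z i) dir = vdot p (Z' i) dir" if "i < n" for i
    using assms(2)[OF that] by (intro vdot_cong) auto
  have "resid V Z k = resid V' Z' k" if "k < p" for k
  proof -
    have o: "obs V Z i k = obs V' Z' i k" if "i < n" for i
      using assms that \<open>k < p\<close> by (auto simp: obs_def)
    have "(\<Sum>i<n. obs V Z i k * (vnorm p (rho 1) * V i 1 + sigma * vdot p (Z i) dir))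
      = (\<Sum>i<n. obs V' Z' i k * (vnorm p (rho 1) * V' i 1 + sigma * vdot p (Z' i) dir))"
      "(\<Sum>i<n. (vnorm p (rho 1) * V i 1 + sigma * vdot p (Z i) dir)\<^sup>2) = (\<Sum>i<n. (vnorm p (rho 1) * V' i 1 + sigma * vdot p (Z' i) dir)\<^sup>2)"
      by (rule sum.cong; use o v assms(1)[OF _ 1] in simp)+
    then show ?thesis unfolding resid_eq by simp
  qed
  then show ?thesis unfolding vnorm_def by (intro arg_cong[where f = sqrt] vdot_cong) auto
qed

lemma resid_norm_measurable:
  assumes "\<And>i j. i < n \<Longrightarrow> j \<in> {1..m} \<Longrightarrow> (\<lambda>w. V w i j) \<in> borel_measurable M"
    "\<And>i k. i < n \<Longrightarrow> k < p \<Longrightarrow> (\<lambda>w. Z w i k) \<in> borel_measurable M"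
  shows "(\<lambda>w. vnorm p (resid (V w) (Z w))) \<in> borel_measurable M"
proof -
  have sqrt_m: "sqrt \<in> borel_measurable borel" by measurable
  show ?thesis
    unfolding vnorm_def vdot_def resid_eq obs_def using m_pos
  by (intro measurable_compose[OF _ sqrt_m] borel_measurable_sum borel_measurable_times borel_measurable_add
      borel_measurable_diff borel_measurable_divide borel_measurable_power borel_measurable_const assms) auto
qed

text \<open>Flipping signs entry by entry preserves the joint law of the family. The norm of the
  residual depends only on the entries in the index set, so it is a measurable function on the
  product space and the equality of laws applies to it.\<close>

lemma resid_norm_flip_law:
  assumes "prob_space M" and X: "std_normals M X ({..<n} \<times> ({1..m} <+> {..<p}))"
  shows "measure M {w\<in>space M. \<delta> \<le> vnorm p (resid (\<lambda>i j. X (i, Inl j) w) (\<lambda>i k. X (i, Inr k) w))}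
     = measure M {w\<in>space M. \<delta> \<le> vnorm p (resid (\<lambda>i j. X (i, Inl j) w) (\<lambda>i k. (if k \<in> K then -1 else 1) * X (i, Inr k) w))}"
proof -
  interpret prob_space M by fact
  let ?I = "{..<n} \<times> ({1..m} <+> {..<p})"
  let ?PI = "PiM ?I (\<lambda>_. borel :: real measure)"
  define \<Phi> where "\<Phi> f = vnorm p (resid (\<lambda>i j. f (i, Inl j)) (\<lambda>i k. f (i, Inr k)))" for f :: "nat \<times> (nat + nat) \<Rightarrow> real"
  have \<Phi>: "\<Phi> \<in> borel_measurable ?PI"
    unfolding \<Phi>_def by (rule resid_norm_measurable; intro measurable_component_singleton; auto)
  have S: "{f\<in>space ?PI. \<delta> \<le> \<Phi> f} \<in> sets ?PI"
    using \<Phi> by measurable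
  define \<epsilon> where "\<epsilon> t = (case snd t of Inl _ \<Rightarrow> 1 | Inr k \<Rightarrow> (if k \<in> K then -1 else 1 :: real))" for t :: "nat \<times> (nat + nat)"
  define Y where "Y t w = \<epsilon> t * X t w" for t w
  have Y: "std_normals M Y ?I"
    unfolding Y_def by (rule std_normals_flip[OF X]) (auto simp: \<epsilon>_def split: sum.split)
  have law: "measure (distr M ?PI (\<lambda>w. \<lambda>t\<in>?I. F t w)) {f\<in>space ?PI. \<delta> \<le> \<Phi> f}
     = measure M {w\<in>space M. \<delta> \<le> vnorm p (resid (\<lambda>i j. F (i, Inl j) w) (\<lambda>i k. F (i, Inr k) w))}"
    if F: "std_normals M F ?I" for F
  proof -
    have Fm: "(\<lambda>w. \<lambda>t\<in>?I. F t w) \<in> M \<rightarrow>\<^sub>M ?PI"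
      by (intro measurable_restrict std_normals_measurable[OF F])
    have "\<Phi> (\<lambda>t\<in>?I. F t w) = vnorm p (resid (\<lambda>i j. F (i, Inl j) w) (\<lambda>i k. F (i, Inr k) w))" for w
      unfolding \<Phi>_def by (rule resid_norm_cong) auto
    then have "(\<lambda>w. \<lambda>t\<in>?I. F t w) -` {f\<in>space ?PI. \<delta> \<le> \<Phi> f} \<inter> space M
      = {w\<in>space M. \<delta> \<le> vnorm p (resid (\<lambda>i j. F (i, Inl j) w) (\<lambda>i k. F (i, Inr k) w))}"
      using measurable_space[OF Fm] by auto
    then show ?thesis by (simp only: measure_distr[OF Fm S])
  qed
  have "?I \<noteq> {}" using n_pos m_pos by auto
  have "measure M {w\<in>space M. \<delta> \<le> vnorm p (resid (\<lambda>i j. X (i, Inl j) w) (\<lambda>i k. X (i, Inr k) w))}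
    = measure M {w\<in>space M. \<delta> \<le> vnorm p (resid (\<lambda>i j. Y (i, Inl j) w) (\<lambda>i k. Y (i, Inr k) w))}"
    unfolding law[OF X, symmetric] law[OF Y, symmetric] std_normals_same_law[OF X Y \<open>?I \<noteq> {}\<close>] ..
  then show ?thesis by (simp add: Y_def \<epsilon>_def)
qed

text \<open>Let \<delta> = \<sigma>^2 sqrt c / 24. Outside the exceptional set the main term of the
  flip comparison is at least 4 \<delta> and the errors are at most 2 \<delta> by
  \<open>small\<close>, so the two residuals have norms with sum at least 2 \<delta> and one of them
  reaches \<delta>. Both events are equally likely, whence the factor 2 before the measure of
  \<open>A\<close>.\<close>

lemma resid_large_prob:
  fixes c \<eta> :: real
  assumes "prob_space M" and X: "std_normals M X ({..<n} \<times> ({1..m} <+> {..<p}))"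
    and c: "c > 0" and pc: "c * n \<le> 8 * real (p div 2)" and \<eta>: "0 < \<eta>" "\<eta> \<le> 1"
    and small: "\<eta> * (2 * total * sigma + 4 * (vnorm p (rho 1) + sigma) * sigma) \<le> sigma\<^sup>2 * sqrt c / 12"
  defines "A \<equiv> {w\<in>space M. sigma\<^sup>2 * sqrt c / 24 \<le> vnorm p (resid (\<lambda>i j. X (i, Inl j) w) (\<lambda>i k. X (i, Inr k) w))}"
  shows "A \<in> sets M"
    and "1 - ((4 * real m + 4) * exp (- real n * \<eta>\<^sup>2 / 8) + 2 * exp (- real n / 32) + exp (- c * n / 32)) \<le> 2 * measure M A"
proof -
  interpret prob_space M by fact
  let ?J = "{1..m} <+> {..<p}"
  let ?\<delta> = "sigma\<^sup>2 * sqrt c / 24"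
  have finJ: "finite ?J" by simp
  have XV: "X (i, Inl j) \<in> borel_measurable M" if "i < n" "j \<in> {1..m}" for i j
    using that by (intro std_normals_measurable[OF X]) auto
  have XZ: "X (i, Inr k) \<in> borel_measurable M" if "i < n" "k < p" for i k
    using that by (intro std_normals_measurable[OF X]) auto
  have Xm: "X (i, a) \<in> borel_measurable M" if "i < n" "a \<in> ?J" for i a
    using that by (intro std_normals_measurable[OF X]) auto
  \<comment> \<open>At most half of the squared length of \<open>dir\<close> lies on
    \<open>K\<close>, so the kept part \<open>y0\<close> retains noise variance at least \<sigma>^2
    / 2, while \<open>K\<close> still has enough coordinates for the main term to be of order sqrt
    c.\<close>
  obtain K where K: "K \<subseteq> {..<p}" "p div 2 \<le> card K" "(\<Sum>k\<in>K. (dir k)\<^sup>2) \<le> 1/2"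
    using half_coordinates[of dir p] dir_unit by (auto simp: vdot_def power2_eq_square)
  have finK: "finite K" using K(1) finite_subset by blast
  have dirK: "0 \<le> (\<Sum>k\<in>K. (dir k)\<^sup>2)" by (simp add: sum_nonneg)
  have dirC: "(\<Sum>k\<in>{..<p} - K. (dir k)\<^sup>2) = 1 - (\<Sum>k\<in>K. (dir k)\<^sup>2)"
    using dir_unit sum.subset_diff[OF K(1), of "\<lambda>k. (dir k)\<^sup>2"] by (simp add: vdot_def power2_eq_square)
  define r1 where "r1 = vnorm p (rho 1)"
  have r1: "r1 > 0" using rho1_pos by (simp add: r1_def)
  define A' where "A' = {w\<in>space M. ?\<delta> \<le> vnorm p (resid (\<lambda>i j. X (i, Inl j) w) (\<lambda>i k. (if k \<in> K then -1 else 1) * X (i, Inr k) w))}"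
  have set: "{w\<in>space M. ?\<delta> \<le> f w} \<in> sets M" if "f \<in> borel_measurable M" for f :: "_ \<Rightarrow> real"
    using that by measurable
  show AM: "A \<in> sets M"
    unfolding A_def by (rule set, rule resid_norm_measurable) (auto intro: XV XZ)
  have A'M: "A' \<in> sets M"
    unfolding A'_def by (rule set, rule resid_norm_measurable) (auto intro: XV XZ borel_measurable_times)
  \<comment> \<open>\<open>g0\<close> and \<open>g1\<close> are the coefficient vectors of
    \<open>y0\<close> and \<open>y1\<close> over the columns of scores and noise together. Their
    supports are disjoint, so both correlations with \<open>y1\<close> are centred at 0.\<close>
  define g0 where "g0 a = (case a of Inl j \<Rightarrow> if j = 1 then r1 else 0 | Inr k \<Rightarrow> if k \<in> K then 0 else sigma * dir k)" for a :: "nat + nat"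
  define g1 where "g1 a = (case a of Inl j \<Rightarrow> 0 | Inr k \<Rightarrow> if k \<in> K then sigma * dir k else 0)" for a :: "nat + nat"
  define y0 where "y0 i w = r1 * X (i, Inl 1) w + sigma * (\<Sum>k\<in>{..<p} - K. X (i, Inr k) w * dir k)" for i w
  define y1 where "y1 i w = sigma * (\<Sum>k\<in>K. X (i, Inr k) w * dir k)" for i w
  let ?N = "\<lambda>w. \<Sum>i<n. (y0 i w)\<^sup>2" and ?Q = "\<lambda>w. \<Sum>k\<in>K. (\<Sum>i<n. y0 i w * X (i, Inr k) w)\<^sup>2"
    and ?b = "\<lambda>j w. \<bar>(\<Sum>i<n. X (i, Inl j) w * y1 i w) / n\<bar>" and ?k = "\<lambda>w. \<bar>(\<Sum>i<n. y0 i w * y1 i w) / n\<bar>"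
    and ?e = "exp (- real n * \<eta>\<^sup>2 / 8)"
  have sJ: "(\<Sum>a\<in>?J. f a) = (\<Sum>j\<in>{1..m}. f (Inl j)) + (\<Sum>k<p. f (Inr k))" for f :: "_ \<Rightarrow> real"
    by (simp add: sum.Plus)
  have sK: "(\<Sum>k<p. if k \<in> K then f k else 0) = (\<Sum>k\<in>K. f k)" "(\<Sum>k<p. if k \<in> K then 0 else f k) = (\<Sum>k\<in>{..<p} - K. f k)" for f :: "_ \<Rightarrow> real"
    using K(1) by (auto simp: sum.If_cases Int_absorb1 Diff_eq Compl_eq intro!: sum.cong)
  have s1: "(\<Sum>j\<in>{1..m}. if j = 1 then f j else 0) = f 1" for f :: "_ \<Rightarrow> real"
    using m_pos by simp
  have y0: "(\<Sum>a\<in>?J. g0 a * X (i, a) w) = y0 i w" for i w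
  proof -
    have "(\<Sum>a\<in>?J. g0 a * X (i, a) w) = (\<Sum>j\<in>{1..m}. if j = 1 then r1 * X (i, Inl j) w else 0)
       + (\<Sum>k<p. if k \<in> K then 0 else sigma * (X (i, Inr k) w * dir k))"
      unfolding sJ g0_def by (intro arg_cong2[where f = "(+)"] sum.cong refl) auto
    then show ?thesis unfolding s1 sK y0_def by (simp add: sum_distrib_left)
  qed
  have y1: "(\<Sum>a\<in>?J. g1 a * X (i, a) w) = y1 i w" for i w
  proof -
    have "(\<Sum>a\<in>?J. g1 a * X (i, a) w) = (\<Sum>k<p. if k \<in> K then sigma * (X (i, Inr k) w * dir k) else 0)"
      unfolding sJ g1_def by (simp, intro sum.cong refl) auto
    then show ?thesis unfolding sK y1_def by (simp add: sum_distrib_left)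
  qed
  have g0g1: "(\<Sum>a\<in>?J. g0 a * g1 a) = 0"
    by (rule sum.neutral) (auto simp: g0_def g1_def split: sum.split)
  have N0: "(\<Sum>a\<in>?J. (g0 a)\<^sup>2) = r1\<^sup>2 + sigma\<^sup>2 * (1 - (\<Sum>k\<in>K. (dir k)\<^sup>2))"
  proof -
    have "(\<Sum>a\<in>?J. (g0 a)\<^sup>2) = (\<Sum>j\<in>{1..m}. if j = 1 then r1\<^sup>2 else 0) + (\<Sum>k<p. if k \<in> K then 0 else sigma\<^sup>2 * (dir k)\<^sup>2)"
      unfolding sJ g0_def by (intro arg_cong2[where f = "(+)"] sum.cong refl) (auto simp: power_mult_distrib)
    then show ?thesis unfolding s1 sK by (simp add: sum_distrib_left[symmetric] dirC)
  qed
  have N1: "(\<Sum>a\<in>?J. (g1 a)\<^sup>2) = sigma\<^sup>2 * (\<Sum>k\<in>K. (dir k)\<^sup>2)"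
  proof -
    have "(\<Sum>a\<in>?J. (g1 a)\<^sup>2) = (\<Sum>k<p. if k \<in> K then sigma\<^sup>2 * (dir k)\<^sup>2 else 0)"
      unfolding sJ g1_def by (simp, intro sum.cong refl) (auto simp: power_mult_distrib)
    then show ?thesis unfolding sK by (simp add: sum_distrib_left[symmetric])
  qed
  have L1: "L2_set g1 ?J \<le> sigma"
  proof -
    have "sigma\<^sup>2 * (\<Sum>k\<in>K. (dir k)\<^sup>2) \<le> sigma\<^sup>2 * 1" using K(3) by (intro mult_left_mono) auto
    then show ?thesis unfolding L2_set_def N1 using sigma_pos by (intro real_le_lsqrt) (auto simp: dirK)
  qed
  have L0: "L2_set g0 ?J \<le> r1 + sigma"
  proof -
    have "sigma\<^sup>2 * (1 - (\<Sum>k\<in>K. (dir k)\<^sup>2)) \<le> sigma\<^sup>2 * 1" using dirK by (intro mult_left_mono) auto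
    moreover have "0 \<le> 2 * r1 * sigma" using r1 sigma_pos by simp
    ultimately have "r1\<^sup>2 + sigma\<^sup>2 * (1 - (\<Sum>k\<in>K. (dir k)\<^sup>2)) \<le> (r1 + sigma)\<^sup>2"
      unfolding power2_sum by linarith
    moreover have "0 \<le> r1\<^sup>2 + sigma\<^sup>2 * (1 - (\<Sum>k\<in>K. (dir k)\<^sup>2))" using K(3) by (intro add_nonneg_nonneg mult_nonneg_nonneg) auto
    ultimately show ?thesis unfolding L2_set_def N0 using r1 sigma_pos by (intro real_le_lsqrt) auto
  qed
  have y0m: "y0 i \<in> borel_measurable M" if "i < n" for i
    unfolding y0_def using that m_pos by (intro borel_measurable_add borel_measurable_times borel_measurable_sum borel_measurable_const XV XZ) auto
  have y1m: "y1 i \<in> borel_measurable M" if "i < n" for i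
    unfolding y1_def using that K(1) by (intro borel_measurable_times borel_measurable_sum borel_measurable_const XZ) auto
  have e1: "except_prob M (4 * ?e) (\<lambda>w. ?b j w \<le> \<eta> * sigma)"
    if j: "j \<in> {1..m}" for j
  proof (rule except_prob_mono)
    let ?g = "\<lambda>(a :: nat + nat). if a = Inl j then 1 else 0 :: real"
    have in_J: "Inl j \<in> ?J" using j by auto
    have s: "(\<Sum>a\<in>?J. ?g a * X (i, a) w) = X (i, Inl j) w" for i w
      by (rule sum_indicator_column[OF finJ in_J])
    have g: "(\<Sum>a\<in>?J. ?g a * g1 a) = 0" using sum_indicator_column(1)[OF finJ in_J, of g1] by (simp add: g1_def)
    have "prob {w\<in>space M. \<eta> * (L2_set ?g ?J * L2_set g1 ?J) <
       \<bar>(\<Sum>i<n. (\<Sum>a\<in>?J. ?g a * X (i, a) w) * (\<Sum>a\<in>?J. g1 a * X (i, a) w)) / n - (\<Sum>a\<in>?J. ?g a * g1 a)\<bar>}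
     \<le> 4 * ?e"
      by (rule gaussian_bilinear_concentration[OF X finJ n_pos \<eta>])
    then have "prob {w\<in>space M. \<eta> * L2_set g1 ?J < ?b j w} \<le> 4 * ?e"
      unfolding s y1 g sum_indicator_column(2)[OF finJ in_J] by (simp only: mult_1 diff_zero)
    then show "except_prob M (4 * ?e) (\<lambda>w. ?b j w \<le> \<eta> * L2_set g1 ?J)"
      using j by (intro except_prob_leI borel_measurable_abs borel_measurable_divide borel_measurable_sum borel_measurable_times
          borel_measurable_const XV y1m) auto
    show "?b j w \<le> \<eta> * L2_set g1 ?J \<Longrightarrow> ?b j w \<le> \<eta> * sigma" for w
      using mult_left_mono[OF L1, of \<eta>] \<eta> by linarith
  qed simp
  have e2: "except_prob M (4 * ?e) (\<lambda>w. ?k w \<le> \<eta> * ((r1 + sigma) * sigma))"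
  proof (rule except_prob_mono)
    have "prob {w\<in>space M. \<eta> * (L2_set g0 ?J * L2_set g1 ?J) <
       \<bar>(\<Sum>i<n. (\<Sum>a\<in>?J. g0 a * X (i, a) w) * (\<Sum>a\<in>?J. g1 a * X (i, a) w)) / n - (\<Sum>a\<in>?J. g0 a * g1 a)\<bar>}
     \<le> 4 * ?e"
      by (rule gaussian_bilinear_concentration[OF X finJ n_pos \<eta>])
    then have "prob {w\<in>space M. \<eta> * (L2_set g0 ?J * L2_set g1 ?J) < ?k w} \<le> 4 * ?e"
      unfolding y0 y1 g0g1 by (simp only: diff_zero)
    then show "except_prob M (4 * ?e) (\<lambda>w. ?k w \<le> \<eta> * (L2_set g0 ?J * L2_set g1 ?J))"
      by (intro except_prob_leI borel_measurable_abs borel_measurable_divide borel_measurable_sum borel_measurable_times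
          borel_measurable_const y0m y1m) auto
    have "L2_set g0 ?J * L2_set g1 ?J \<le> (r1 + sigma) * sigma"
      using L0 L1 r1 sigma_pos by (intro mult_mono) (auto simp: L2_set_nonneg)
    from mult_left_mono[OF this, of \<eta>]
    show "?k w \<le> \<eta> * (L2_set g0 ?J * L2_set g1 ?J) \<Longrightarrow> ?k w \<le> \<eta> * ((r1 + sigma) * sigma)" for w
      using \<eta> by linarith
  qed simp
  have e3: "except_prob M (2 * exp (- real n / 32)) (\<lambda>w. real n * (sigma\<^sup>2 / 4) \<le> ?N w)"
  proof (rule except_prob_mono)
    define N where "N = r1\<^sup>2 + sigma\<^sup>2 * (1 - (\<Sum>k\<in>K. (dir k)\<^sup>2))"
    have "prob {w\<in>space M. 1/2 * (\<Sum>a\<in>?J. (g0 a)\<^sup>2) < \<bar>(\<Sum>i<n. (\<Sum>a\<in>?J. g0 a * X (i, a) w)\<^sup>2) / n - (\<Sum>a\<in>?J. (g0 a)\<^sup>2)\<bar>}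
      \<le> 2 * exp (- real n * (1/2)\<^sup>2 / 8)"
      by (rule gaussian_quadratic_concentration[OF X finJ n_pos]) auto
    moreover have "- real n * (1/2)\<^sup>2 / 8 = - real n / 32" by (simp add: power2_eq_square)
    ultimately have "prob {w\<in>space M. 1/2 * N < \<bar>?N w / n - N\<bar>} \<le> 2 * exp (- real n / 32)"
      unfolding y0 N0 N_def by (simp only:)
    then show "except_prob M (2 * exp (- real n / 32)) (\<lambda>w. \<bar>?N w / n - N\<bar> \<le> 1/2 * N)"
      by (intro except_prob_leI borel_measurable_abs borel_measurable_divide borel_measurable_sum borel_measurable_power
          borel_measurable_diff borel_measurable_const y0m) auto
    have "sigma\<^sup>2 * (1/2) \<le> sigma\<^sup>2 * (1 - (\<Sum>k\<in>K. (dir k)\<^sup>2))" using K(3) by (intro mult_left_mono) auto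
    then have N: "sigma\<^sup>2 / 2 \<le> N" unfolding N_def using zero_le_power2[of r1] by linarith
    show "real n * (sigma\<^sup>2 / 4) \<le> ?N w" if "\<bar>?N w / n - N\<bar> \<le> 1/2 * N" for w
    proof -
      have "sigma\<^sup>2 / 4 \<le> ?N w / n" using that N by linarith
      then show ?thesis using n_pos by (simp add: le_divide_eq mult.commute)
    qed
  qed simp
  have e4: "except_prob M (exp (- c * n / 32))
    (\<lambda>w. 0 < ?N w \<longrightarrow> card K / 4 * ?N w \<le> ?Q w)"
  proof (rule except_prob_mono)
    let ?K = "Inr ` K :: (nat + nat) set"
    have KJ: "?K \<subseteq> ?J" using K(1) by auto
    have y0': "(\<Sum>a\<in>?J - ?K. g0 a * X (i, a) w) = y0 i w" for i w
    proof -
      have "(\<Sum>a\<in>?J. g0 a * X (i, a) w) = (\<Sum>a\<in>?J - ?K. g0 a * X (i, a) w)"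
        by (rule sum.mono_neutral_right) (use finJ in \<open>auto simp: g0_def\<close>)
      then show ?thesis using y0 by simp
    qed
    have sKK: "(\<Sum>k\<in>?K. f k) = (\<Sum>k\<in>K. f (Inr k))" for f :: "_ \<Rightarrow> real"
      by (subst sum.reindex) auto
    have cK: "card ?K = card K" by (simp add: card_image)
    \<comment> \<open>Lower tail with \<theta> = -1 and t = card K / 4: the factor 3^(- card K / 2)
      is at most exp (- card K / 2) and outweighs exp (card K / 4). The first block consists of all
      columns outside \<open>K\<close>, which carry the whole support of \<open>g0\<close>.\<close>
    have "prob {w\<in>space M. 0 < (\<Sum>i<n. (\<Sum>a\<in>?J - ?K. g0 a * X (i, a) w)\<^sup>2) \<and>
       (-1) * (card K / 4) * (\<Sum>i<n. (\<Sum>a\<in>?J - ?K. g0 a * X (i, a) w)\<^sup>2) \<le> (-1) * (\<Sum>k\<in>?K. (\<Sum>i<n. (\<Sum>a\<in>?J - ?K. g0 a * X (i, a) w) * X (i, k) w)\<^sup>2)}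
      \<le> exp (- (-1) * (card K / 4)) * (1 - 2 * (-1)) powr (- real (card ?K) / 2)"
      by (rule projected_columns_tail[OF X _ _ KJ]) (use finK finJ in auto)
    also have "\<dots> \<le> exp (- c * n / 32)"
    proof -
      have "(1::real) \<le> ln 3" using e_less_272 ln_ge_iff[of 3 1] by simp
      then have "real (card K) / 2 * 1 \<le> real (card K) / 2 * ln 3" by (intro mult_left_mono) auto
      moreover have "c * n / 32 \<le> card K / 4" using pc K(2) by simp
      ultimately have "card K / 4 + - real (card K) / 2 * ln 3 \<le> - c * n / 32" by simp
      then show ?thesis unfolding cK by (simp add: powr_def exp_add[symmetric])
    qed
    finally have *: "prob {w\<in>space M. 0 < ?N w \<and>
       (-1) * (card K / 4) * ?N w \<le> (-1) * ?Q w} \<le> exp (- c * n / 32)"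
      unfolding y0' sKK .
    have Nm: "(\<lambda>w. \<Sum>i<n. (y0 i w)\<^sup>2) \<in> borel_measurable M"
      by (intro borel_measurable_sum borel_measurable_power y0m) auto
    have Qm: "(\<lambda>w. \<Sum>k\<in>K. (\<Sum>i<n. y0 i w * X (i, Inr k) w)\<^sup>2) \<in> borel_measurable M"
      using K(1) by (intro borel_measurable_sum borel_measurable_power borel_measurable_times y0m XZ) auto
    have "{w\<in>space M. 0 < N w \<and> (-1) * (card K / 4) * N w \<le> (-1) * Q w} \<in> sets M"
      if "N \<in> borel_measurable M" "Q \<in> borel_measurable M" for N Q :: "_ \<Rightarrow> real" using that by measurable
    from this[OF Nm Qm] * show "except_prob M (exp (- c * n / 32))
        (\<lambda>w. \<not> (0 < ?N w \<and> (-1) * (card K / 4) * ?N w \<le> (-1) * ?Q w))"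
      by (intro except_probI) (simp_all only: not_not)
  qed auto
  have e1': "except_prob M (real (card {1..m}) * (4 * ?e)) (\<lambda>w. \<forall>j\<in>{1..m}. ?b j w \<le> \<eta> * sigma)"
    by (intro except_prob_ball e1) auto
  define b where "b = (4 * real m + 4) * ?e + 2 * exp (- real n / 32) + exp (- c * n / 32)"
  have "except_prob M b (\<lambda>w. w \<in> A \<or> w \<in> A')"
  proof (rule except_prob_mono[OF except_prob_conj[OF except_prob_conj[OF except_prob_conj[OF e1' e2] e3] e4]])
    show "real (card {1..m}) * (4 * ?e) + 4 * ?e + 2 * exp (- real n / 32) + exp (- c * n / 32) \<le> b"
      by (simp add: b_def algebra_simps)
    fix w assume w: "w \<in> space M"
      and H: "(((\<forall>j\<in>{1..m}. ?b j w \<le> \<eta> * sigma) \<and>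
         ?k w \<le> \<eta> * ((r1 + sigma) * sigma)) \<and>
         real n * (sigma\<^sup>2 / 4) \<le> ?N w) \<and>
         (0 < ?N w \<longrightarrow> card K / 4 * ?N w \<le> ?Q w)"
    define Q where "Q = ?Q w"
    have N: "real n * (sigma\<^sup>2 / 4) \<le> ?N w" using H by blast
    moreover have "0 < real n * (sigma\<^sup>2 / 4)" using n_pos sigma_pos by simp
    ultimately have "card K / 4 * ?N w \<le> Q" using H unfolding Q_def by linarith
    moreover have "(c * n / 32) * (real n * (sigma\<^sup>2 / 4)) \<le> card K / 4 * ?N w"
      using N pc K(2) c by (intro mult_mono) auto
    ultimately have "(c * n / 32) * (real n * (sigma\<^sup>2 / 4)) \<le> Q" by linarith
    \<comment> \<open>The factors are card K \<ge> c n / 8, a quarter of it for the projected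
      energy, and n \<sigma>^2 / 4 for the squared length of y0. Together they give \<sigma>^2 c /
      128, which is rounded down to a square with 144 = 12^2.\<close>
    then have "(sigma * sqrt c / 12)\<^sup>2 \<le> Q / n\<^sup>2"
    proof -
      assume a: "(c * n / 32) * (real n * (sigma\<^sup>2 / 4)) \<le> Q"
      have "(sigma * sqrt c / 12)\<^sup>2 = sigma\<^sup>2 * c / 144" using c by (simp add: power_divide power_mult_distrib)
      also have "\<dots> \<le> sigma\<^sup>2 * c / 128" using c by (intro divide_left_mono) auto
      also have "\<dots> = (c * n / 32) * (real n * (sigma\<^sup>2 / 4)) / n\<^sup>2" using n_pos by (simp add: power2_eq_square)
      also have "\<dots> \<le> Q / n\<^sup>2" using a by (intro divide_right_mono) auto
      finally show ?thesis .
    qed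
    moreover have "L2_set (\<lambda>k. (\<Sum>i<n. y0 i w * X (i, Inr k) w) / n) K = sqrt (Q / n\<^sup>2)"
      unfolding L2_set_def Q_def power_divide sum_divide_distrib[symmetric] of_nat_power ..
    ultimately have L: "sigma * sqrt c / 12 \<le> L2_set (\<lambda>k. (\<Sum>i<n. y0 i w * X (i, Inr k) w) / n) K"
      by (simp only: real_le_rsqrt)
    have "(\<Sum>j\<in>{1..m}. vnorm p (rho j) * ?b j w) \<le> (\<Sum>j\<in>{1..m}. vnorm p (rho j) * (\<eta> * sigma))"
      using H by (intro sum_mono mult_left_mono) auto
    also have "\<dots> = total * (\<eta> * sigma)" by (simp add: total_def sum_distrib_right)
    finally have B: "(\<Sum>j\<in>{1..m}. vnorm p (rho j) * ?b j w) \<le> total * (\<eta> * sigma)" .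
    have C: "?k w \<le> \<eta> * ((r1 + sigma) * sigma)" using H by blast
    let ?R = "vnorm p (resid (\<lambda>i j. X (i, Inl j) w) (\<lambda>i k. X (i, Inr k) w))"
    let ?R' = "vnorm p (resid (\<lambda>i j. X (i, Inl j) w) (\<lambda>i k. (if k \<in> K then -1 else 1) * X (i, Inr k) w))"
    have "2 * sigma * L2_set (\<lambda>k. (\<Sum>i<n. y0 i w * X (i, Inr k) w) / n) K
        - 2 * (\<Sum>j\<in>{1..m}. vnorm p (rho j) * ?b j w)
        - 4 * ?k w \<le> ?R + ?R'"
      using resid_flip_lower[OF K(1), of "\<lambda>i j. X (i, Inl j) w" "\<lambda>i k. X (i, Inr k) w"]
      unfolding y0_def y1_def r1_def .
    moreover have "2 * sigma * (sigma * sqrt c / 12) \<le> 2 * sigma * L2_set (\<lambda>k. (\<Sum>i<n. y0 i w * X (i, Inr k) w) / n) K"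
      using L sigma_pos by (intro mult_left_mono) auto
    moreover have "2 * sigma * (sigma * sqrt c / 12) = 4 * ?\<delta>" by (simp add: power2_eq_square)
    moreover have "\<eta> * (2 * total * sigma + 4 * (r1 + sigma) * sigma) = 2 * (total * (\<eta> * sigma)) + 4 * (\<eta> * ((r1 + sigma) * sigma))"
      by (simp add: algebra_simps)
    moreover have "sigma\<^sup>2 * sqrt c / 12 = 2 * ?\<delta>" by simp
    ultimately have "2 * ?\<delta> \<le> ?R + ?R'" using B C small unfolding r1_def[symmetric] by linarith
    then have "?\<delta> \<le> ?R \<or> ?\<delta> \<le> ?R'" by linarith
    then show "w \<in> A \<or> w \<in> A'" using w by (auto simp: A_def A'_def)
  qed
  then obtain E where E: "E \<in> sets M" "prob E \<le> b" "\<forall>w\<in>space M - E. w \<in> A \<or> w \<in> A'"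
    by (auto simp: except_prob_def)
  have "1 = prob (space M)" by (simp add: prob_space)
  also have "\<dots> \<le> prob (E \<union> (A \<union> A'))"
    using E AM A'M by (intro finite_measure_mono) auto
  also have "\<dots> \<le> prob E + (prob A + prob A')"
    using measure_Un_le[OF E(1), of "A \<union> A'"] measure_Un_le[OF AM A'M] AM A'M by simp
  also have "prob A' = prob A"
    unfolding A_def A'_def by (rule resid_norm_flip_law[OF assms(1) X, symmetric])
  finally show "1 - ((4 * real m + 4) * ?e + 2 * exp (- real n / 32) + exp (- c * n / 32)) \<le> 2 * prob A"
    using E(2) by (simp add: b_def)
qed

end

section \<open>Asymptotics\<close>

definition tail_bound :: "real \<Rightarrow> real \<Rightarrow> nat \<Rightarrow> real" where
  "tail_bound c \<eta> n = 4 * (c * n)\<^sup>2 * exp (- real n * \<eta>\<^sup>2 / 8) + c * n * exp (- c * n / 8)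
     + 2 * (c * n + 2)\<^sup>2 * (97/100) powr (c * n)"

text \<open>The extra factor n^2 makes the tail eventually smaller than 1 / n^2, hence summable as
  Borel-Cantelli requires.\<close>

lemma tail_bound_quadratic_decay:
  assumes "c > 0" "\<eta> > 0"
  shows "(\<lambda>n. (real n)\<^sup>2 * tail_bound c \<eta> n) \<longlonglongrightarrow> 0"
proof -
  define d e f where "d = \<eta>\<^sup>2 / 8" and "e = c / 8" and "f = - ln (97/100) * c"
  have "ln (97/100 :: real) < 0" by simp
  then have "d > 0" "e > 0" "f > 0" using assms by (auto simp: d_def e_def f_def mult_neg_pos)
  then have "(\<lambda>n. (real n)\<^sup>2 * (4 * (c * n)\<^sup>2 * exp (- (d * real n)))) \<longlonglongrightarrow> 0"
    "(\<lambda>n. (real n)\<^sup>2 * (c * n * exp (- (e * real n)))) \<longlonglongrightarrow> 0"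
    "(\<lambda>n. (real n)\<^sup>2 * (2 * (c * n + 2)\<^sup>2 * exp (- (f * real n)))) \<longlonglongrightarrow> 0"
    using assms(1) by real_asymp+
  from tendsto_add[OF tendsto_add[OF this(1,2)] this(3)]
  have "(\<lambda>n. (real n)\<^sup>2 * (4 * (c * n)\<^sup>2 * exp (- (d * real n)) + c * n * exp (- (e * real n))
      + 2 * (c * n + 2)\<^sup>2 * exp (- (f * real n)))) \<longlonglongrightarrow> 0"
    by (simp add: distrib_left)
  moreover have "tail_bound c \<eta> n = 4 * (c * n)\<^sup>2 * exp (- (d * real n)) + c * n * exp (- (e * real n))
      + 2 * (c * n + 2)\<^sup>2 * exp (- (f * real n))" for n
    by (simp add: tail_bound_def d_def e_def f_def powr_def mult_ac)
  ultimately show ?thesis by simp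
qed

lemma tail_bound_nonneg: "c > 0 \<Longrightarrow> 0 \<le> tail_bound c \<eta> n"
  unfolding tail_bound_def by (intro add_nonneg_nonneg mult_nonneg_nonneg) auto

lemma summable_tail_bound:
  assumes "c > 0" "\<eta> > 0"
  shows "summable (tail_bound c \<eta>)"
proof (rule summable_comparison_test_ev)
  have "eventually (\<lambda>n. (real n)\<^sup>2 * tail_bound c \<eta> n < 1) sequentially"
    using tail_bound_quadratic_decay[OF assms] by (rule order_tendstoD) simp
  then show "eventually (\<lambda>n. norm (tail_bound c \<eta> n) \<le> inverse ((real n)\<^sup>2)) sequentially"
    using eventually_gt_at_top[of 0]
  proof eventually_elim
    case (elim n)
    then show ?case using tail_bound_nonneg[OF assms(1), of \<eta> n] by (simp add: field_simps)
  qed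
  show "summable (\<lambda>n. inverse ((real n)\<^sup>2))"
    using inverse_power_summable[of 2, where 'a = real] by simp
qed

lemma tail_bound_tendsto_0: "c > 0 \<Longrightarrow> \<eta> > 0 \<Longrightarrow> tail_bound c \<eta> \<longlonglongrightarrow> 0"
  by (rule summable_LIMSEQ_zero[OF summable_tail_bound])

lemma (in prob_space) AE_eventually_except_prob:
  assumes "eventually (\<lambda>n. except_prob M (B n) (P n)) sequentially" "summable B"
  shows "AE w in M. eventually (\<lambda>n. P n w) sequentially"
proof -
  obtain N where N: "\<And>n. n \<ge> N \<Longrightarrow> except_prob M (B n) (P n)"
    using assms(1) by (auto simp: eventually_sequentially)
  then have "\<exists>E\<in>sets M. n \<ge> N \<longrightarrow> prob E \<le> B n \<and> (\<forall>w\<in>space M - E. P n w)" for n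
    by (cases "n \<ge> N") (auto simp: except_prob_def)
  then obtain E where E: "\<And>n. E n \<in> sets M"
    "\<And>n. n \<ge> N \<Longrightarrow> prob (E n) \<le> B n \<and> (\<forall>w\<in>space M - E n. P n w)" by metis
  have "summable (\<lambda>n. prob (E n))"
    using E(2) by (intro summable_comparison_test_ev[OF _ assms(2)])
      (auto simp: eventually_sequentially)
  then have "AE w in M. eventually (\<lambda>n. w \<in> space M - E n) sequentially"
    using E(1) by (intro borel_cantelli_AE1) (auto simp: emeasure_eq_measure)
  then show ?thesis
  proof eventually_elim
    case (elim w)
    then show ?case using eventually_ge_at_top[of N] by eventually_elim (use E(2) in auto)
  qed
qed

text \<open>Put q = sqrt c. For q \<le> 1/3 twice the norm bound is affordable, because 2.4 q^2
  \<le> 0.8 q; for larger q the value 1 in the minimum is, because 1 \<le> 4.4 q.\<close>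

lemma norm_bound_le: "0 \<le> c \<Longrightarrow> norm_bound c + min (norm_bound c) 1 \<le> 8 * sqrt c + 4 * c"
proof -
  assume c: "0 \<le> c"
  define q where "q = sqrt c"
  have q: "q \<ge> 0" "c = q * q" using c by (auto simp: q_def)
  show ?thesis
  proof (cases "q \<le> 1/3")
    case True
    then have "q * q \<le> q * (1/3)" using q by (intro mult_left_mono) auto
    then show ?thesis unfolding norm_bound_def q_def[symmetric] q(2) by (auto simp: min_def)
  next
    case False
    then show ?thesis using q(1) zero_le_square[of q] unfolding norm_bound_def q_def[symmetric] q(2) by (auto simp: min_def)
  qed
qed

text \<open>First n tends to infinity with c' = c + 1/(N+1) and \<eta> = 1/(N+1) fixed, and only
  then N. The strict excess of c' over c makes p \<le> c' n hold for all large n, and it keeps c'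
  positive when c = 0.\<close>

lemma limsup_le_of_bounds:
  fixes s gap tot :: "nat \<Rightarrow> real" and g T c \<sigma> :: real
  assumes gap: "gap \<longlonglongrightarrow> g" "g > 0" and tot: "tot \<longlonglongrightarrow> T"
    and bnd: "\<And>N. eventually (\<lambda>n. gap n * s n \<le> 2 * (1 / real (Suc N)) * (tot n)\<^sup>2 + 4 * \<sigma> * sqrt (c + 1 / real (Suc N)) * tot n
       + \<sigma>\<^sup>2 * (norm_bound (c + 1 / real (Suc N)) + min (norm_bound (c + 1 / real (Suc N))) 1)) sequentially"
    and c: "c \<ge> 0" and \<sigma>: "\<sigma> > 0"
  shows "limsup (\<lambda>n. ereal (s n)) \<le> ereal (4 * \<sigma> * sqrt c / g * (T + (2 + sqrt c) * \<sigma>))"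
proof -
  define G where "G \<eta> c t = 2 * \<eta> * t\<^sup>2 + 4 * \<sigma> * sqrt c * t + \<sigma>\<^sup>2 * (norm_bound c + min (norm_bound c) 1)" for \<eta> c t :: real
  have le: "limsup (\<lambda>n. ereal (s n)) \<le> ereal (G (1 / real (Suc N)) (c + 1 / real (Suc N)) T / g)" for N
  proof -
    have "eventually (\<lambda>n. gap n > 0) sequentially" using gap by (rule order_tendstoD)
    with bnd[of N] have "eventually (\<lambda>n. ereal (s n) \<le> ereal (G (1 / real (Suc N)) (c + 1 / real (Suc N)) (tot n) / gap n)) sequentially"
    proof eventually_elim
      case (elim n) then show ?case by (simp add: G_def le_divide_eq mult.commute[of "s n"])
    qed
    then have "limsup (\<lambda>n. ereal (s n)) \<le> limsup (\<lambda>n. ereal (G (1 / real (Suc N)) (c + 1 / real (Suc N)) (tot n) / gap n))"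
      by (rule Limsup_mono)
    also have "\<dots> = ereal (G (1 / real (Suc N)) (c + 1 / real (Suc N)) T / g)"
    proof (rule lim_imp_Limsup)
      show "(\<lambda>n. ereal (G (1 / real (Suc N)) (c + 1 / real (Suc N)) (tot n) / gap n)) \<longlonglongrightarrow> ereal (G (1 / real (Suc N)) (c + 1 / real (Suc N)) T / g)"
        unfolding G_def using gap by (intro tendsto_intros tot) auto
    qed simp
    finally show ?thesis .
  qed
  have inv: "(\<lambda>N. 1 / real (Suc N)) \<longlonglongrightarrow> 0" by (rule LIMSEQ_Suc[OF lim_1_over_n])
  have cN: "(\<lambda>N. c + 1 / real (Suc N)) \<longlonglongrightarrow> c" using tendsto_add[OF tendsto_const inv, of c] by simp
  have nb: "(\<lambda>N. norm_bound (c + 1 / real (Suc N))) \<longlonglongrightarrow> norm_bound c"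
    unfolding norm_bound_def by (intro tendsto_intros cN)
  have "(\<lambda>N. G (1 / real (Suc N)) (c + 1 / real (Suc N)) T / g) \<longlonglongrightarrow> G 0 c T / g"
    unfolding G_def using gap(2) by (intro tendsto_intros inv cN nb) auto
  then have "limsup (\<lambda>n. ereal (s n)) \<le> ereal (G 0 c T / g)"
    using le by (intro LIMSEQ_le_const[of "\<lambda>N. ereal (G (1 / real (Suc N)) (c + 1 / real (Suc N)) T / g)"]) auto
  also have "G 0 c T / g \<le> 4 * \<sigma> * sqrt c / g * (T + (2 + sqrt c) * \<sigma>)"
  proof -
    have "G 0 c T \<le> 4 * \<sigma> * sqrt c * T + \<sigma>\<^sup>2 * (8 * sqrt c + 4 * c)"
      unfolding G_def using norm_bound_le[OF c] by (auto intro!: mult_left_mono)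
    also have "\<dots> = 4 * \<sigma> * sqrt c * (T + (2 + sqrt c) * \<sigma>)"
      using c by (simp add: algebra_simps power2_eq_square)
    finally show ?thesis using gap(2) by (simp add: divide_right_mono)
  qed
  finally show ?thesis by simp
qed

lemma vangle_bounds: "0 \<le> vangle p u v" "vangle p u v \<le> pi"
proof -
  have "0 \<le> \<bar>vdot p u v\<bar> / (vnorm p u * vnorm p v)" by simp
  moreover have "\<bar>vdot p u v\<bar> / (vnorm p u * vnorm p v) \<le> 1"
    using vdot_abs_le[of p u v] by (intro divide_le_eq_1[THEN iffD2]) (auto simp: less_le zero_le_mult_iff)
  ultimately show "0 \<le> vangle p u v" "vangle p u v \<le> pi"
    unfolding vangle_def by (intro arccos_lbound arccos_ubound; linarith)+
qed

text \<open>A single coordinate and the total sum are both Lipschitz with constant 1 for the l1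
  distance. Each \<open>a n\<close> has finite support, which makes the differences summable and the
  series in \<open>lim\<close> meaningful.\<close>

lemma l1_norm_convergence:
  fixes a :: "nat \<Rightarrow> nat \<Rightarrow> real" and v :: "nat \<Rightarrow> real" and k :: "nat \<Rightarrow> nat"
  assumes fin: "\<And>n j. k n \<le> j \<Longrightarrow> a n j = 0" and v: "summable (\<lambda>j. \<bar>v j\<bar>)"
    and lim: "(\<lambda>n. \<Sum>j. \<bar>a n j - v j\<bar>) \<longlonglongrightarrow> 0"
  shows "(\<lambda>n. a n j) \<longlonglongrightarrow> v j" and "(\<lambda>n. \<Sum>j<k n. a n j) \<longlonglongrightarrow> (\<Sum>j. v j)"
proof -
  have sa: "summable (a n)" for n
    by (rule summable_finite[of "{..<k n}"]) (auto simp: fin)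
  have saa: "summable (\<lambda>j. \<bar>a n j\<bar>)" for n
    by (rule summable_finite[of "{..<k n}"]) (auto simp: fin)
  have sv: "summable v" using v by (rule summable_rabs_cancel)
  have sd: "summable (\<lambda>j. \<bar>a n j - v j\<bar>)" for n
  proof (rule summable_comparison_test_ev[OF _ summable_add[OF saa v]])
    show "eventually (\<lambda>j. norm \<bar>a n j - v j\<bar> \<le> \<bar>a n j\<bar> + \<bar>v j\<bar>) sequentially"
      by (intro always_eventually allI) auto
  qed
  have "\<bar>a n j - v j\<bar> \<le> (\<Sum>j. \<bar>a n j - v j\<bar>)" for n
    using sum_le_suminf[OF sd, of "{j}" n] by simp
  then have "(\<lambda>n. a n j - v j) \<longlonglongrightarrow> 0"
    by (intro Lim_null_comparison[OF _ lim] always_eventually) auto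
  then show "(\<lambda>n. a n j) \<longlonglongrightarrow> v j" by (rule LIM_zero_cancel)
  have sum: "(\<Sum>j<k n. a n j) = (\<Sum>j. a n j)" for n
    by (rule suminf_finite[symmetric]) (auto simp: fin)
  have "\<bar>(\<Sum>j<k n. a n j) - (\<Sum>j. v j)\<bar> \<le> (\<Sum>j. \<bar>a n j - v j\<bar>)" for n
    unfolding sum suminf_diff[OF sa sv] by (rule summable_rabs[OF sd])
  then have "(\<lambda>n. (\<Sum>j<k n. a n j) - (\<Sum>j. v j)) \<longlonglongrightarrow> 0"
    by (intro Lim_null_comparison[OF _ lim] always_eventually) auto
  then show "(\<lambda>n. \<Sum>j<k n. a n j) \<longlonglongrightarrow> (\<Sum>j. v j)" by (rule LIM_zero_cancel)
qed

theorem theorem3: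
  fixes M :: "'w measure"
    and p m :: "nat \<Rightarrow> nat"
    and rho :: "nat \<Rightarrow> nat \<Rightarrow> (nat \<Rightarrow> real)"
    and sigma c :: real
    and varrho :: "nat \<Rightarrow> real"
    and V :: "nat \<Rightarrow> nat \<Rightarrow> nat \<Rightarrow> 'w \<Rightarrow> real"
    and Z :: "nat \<Rightarrow> nat \<Rightarrow> nat \<Rightarrow> 'w \<Rightarrow> real"
    and rhohat :: "nat \<Rightarrow> 'w \<Rightarrow> (nat \<Rightarrow> real)"
  assumes M: "prob_space M"
    and m_pos: "\<And>n. 1 \<le> m n"
    and m_le_p: "\<And>n. m n \<le> p n"
    and orth: "\<And>n i j. i \<in> {1..m n} \<Longrightarrow> j \<in> {1..m n} \<Longrightarrow> i \<noteq> j \<Longrightarrow>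
                  vdot (p n) (rho n i) (rho n j) = 0"
    and ord1: "\<And>n. vnorm (p n) (rho n 1) > (if 2 \<le> m n then vnorm (p n) (rho n 2) else 0)"
    and ord2: "\<And>n j. 2 \<le> j \<Longrightarrow> j < m n \<Longrightarrow> vnorm (p n) (rho n j) \<ge> vnorm (p n) (rho n (Suc j))"
    and sigma_pos: "sigma > 0"
    and V_normal: "\<And>n i j. i < n \<Longrightarrow> j \<in> {1..m n} \<Longrightarrow>
                     distributed M lborel (V n i j) std_normal_density"
    and Z_normal: "\<And>n i k. i < n \<Longrightarrow> k < p n \<Longrightarrow>
                     distributed M lborel (Z n i k) std_normal_density"
    and indep: "\<And>n. prob_space.indep_vars M (\<lambda>_. borel)
                  (\<lambda>idx. case idx of Inl (i, j) \<Rightarrow> V n i j | Inr (i, k) \<Rightarrow> Z n i k)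
                  ({(i, j). i < n \<and> j \<in> {1..m n}} <+> {(i, k). i < n \<and> k < p n})"
    and varrho_l1: "summable (\<lambda>j. \<bar>varrho (Suc j)\<bar>)"
    and norms_l1: "(\<lambda>n. \<Sum>j. \<bar>(if Suc j \<le> m n then vnorm (p n) (rho n (Suc j)) else 0)
                              - varrho (Suc j)\<bar>) \<longlonglongrightarrow> 0"
    and ratio: "(\<lambda>n. real (p n) / real n) \<longlonglongrightarrow> c"
    and c_nonneg: "c \<ge> 0"
    and rhohat: "\<And>n w. w \<in> space M \<Longrightarrow> is_top_unit_eigvec (p n)
                   (sample_cov n (\<lambda>i k. (\<Sum>j\<in>{1..m n}. V n i j w * rho n j k) + sigma * Z n i k w))
                   (rhohat n w)"
  shows "((varrho 1 ^ 2 > varrho 2 ^ 2 \<and>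
          4 * sigma * sqrt c / (varrho 1 ^ 2 - varrho 2 ^ 2)
            * ((\<Sum>j. varrho (Suc j)) + (2 + sqrt c) * sigma) \<le> 4 / 5)
         \<longrightarrow> (AE w in M. limsup (\<lambda>n. ereal (sin (vangle (p n) (rhohat n w) (rho n 1))))
                 \<le> ereal (4 * sigma * sqrt c / (varrho 1 ^ 2 - varrho 2 ^ 2)
                          * ((\<Sum>j. varrho (Suc j)) + (2 + sqrt c) * sigma))))
         \<and> (c > 0 \<and> (\<forall>n. (\<lambda>w. vangle (p n) (rhohat n w) (rho n 1)) \<in> borel_measurable M)
         \<longrightarrow> liminf (\<lambda>n. ereal (integral\<^sup>L M (\<lambda>w. vangle (p n) (rhohat n w) (rho n 1)))) > 0)"
proof -
  interpret prob_space M by (rule M)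
  define r where "r n j = vnorm (p n) (rho n j)" for n j
  define tot where "tot n = (\<Sum>j\<in>{1..m n}. r n j)" for n
  define X where "X n t = (case snd t of Inl j \<Rightarrow> V n (fst t) j | Inr k \<Rightarrow> Z n (fst t) k)" for n and t :: "nat \<times> (nat + nat)"
  have X_simps: "X n (i, Inl j) = V n i j" "X n (i, Inr k) = Z n i k" for n i j k
    by (simp_all add: X_def)
  let ?wb = "\<lambda>c \<eta> n w. spiked_design.well_behaved (p n) (m n) n c \<eta> (\<lambda>i j. X n (i, Inl j) w) (\<lambda>i k. X n (i, Inr k) w)"
  have stdn: "std_normals M (X n) ({..<n} \<times> ({1..m n} <+> {..<p n}))" for n
  proof -
    let ?F = "\<lambda>idx. case idx of Inl (i, j) \<Rightarrow> V n i j | Inr (i, k) \<Rightarrow> Z n i k"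
    let ?I = "{(i, j). i < n \<and> j \<in> {1..m n}} <+> {(i, k). i < n \<and> k < p n}"
    define f :: "nat \<times> (nat + nat) \<Rightarrow> (nat \<times> nat) + (nat \<times> nat)"
      where "f t = (case snd t of Inl j \<Rightarrow> Inl (fst t, j) | Inr k \<Rightarrow> Inr (fst t, k))" for t
    have "distributed M lborel (?F idx) std_normal_density" if "idx \<in> ?I" for idx
      using that V_normal Z_normal by auto
    then have "std_normals M ?F ?I" using indep[of n] by (auto simp: std_normals_def)
    then have "std_normals M (\<lambda>t. ?F (f t)) ({..<n} \<times> ({1..m n} <+> {..<p n}))"
      by (rule std_normals_reindex) (auto simp: inj_on_def f_def split: sum.splits)
    moreover have "(\<lambda>t. ?F (f t)) = X n"
      by (auto simp: X_def f_def fun_eq_iff split: sum.splits)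
    ultimately show ?thesis by simp
  qed
  have design: "spiked_design (p n) (m n) n (rho n) sigma" if "n > 0" for n
  proof
    show "0 < vnorm (p n) (rho n 1)" using ord1[of n] by (auto split: if_splits intro: le_less_trans[OF vnorm_nonneg])
  qed (use that m_pos orth sigma_pos in auto)
  have tot_eq: "spiked_design.total (p n) (m n) (rho n) = tot n" if "n > 0" for n
    unfolding spiked_design.total_def[OF design[OF that]] tot_def r_def ..
  have top: "is_top_unit_eigvec (p n) (sample_cov n (spiked_design.obs (m n) (rho n) sigma (\<lambda>i j. X n (i, Inl j) w) (\<lambda>i k. X n (i, Inr k) w))) (rhohat n w)"
    if "w \<in> space M" "n > 0" for n w
    using rhohat[OF that(1), of n] unfolding X_simps spiked_design.obs_def[OF design[OF that(2)], abs_def] .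
  \<comment> \<open>The index is shifted by one: \<open>a n 0\<close> is the norm of the first
    spike, and \<open>a n 1\<close> that of the second or 0 if there is none. The latter is the
    bound \<open>R\<close> on all further spikes, and it converges to the second limit in either
    case.\<close>
  define a where "a n j = (if Suc j \<le> m n then vnorm (p n) (rho n (Suc j)) else 0)" for n j
  have a_fin: "a n j = 0" if "m n \<le> j" for n j using that by (simp add: a_def)
  note a_lim = l1_norm_convergence[where k = m, OF a_fin varrho_l1 norms_l1[folded a_def]]
  have tot_lim: "tot \<longlonglongrightarrow> (\<Sum>j. varrho (Suc j))"
  proof -
    have "tot n = (\<Sum>j<m n. a n j)" for n
      unfolding tot_def r_def One_nat_def sum.atLeast1_atMost_eq a_def by (rule sum.cong) auto
    then have "tot = (\<lambda>n. \<Sum>j<m n. a n j)" by (rule ext)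
    then show ?thesis using a_lim(2) by simp
  qed
  have r1: "r n 1 = a n 0" for n using m_pos[of n] by (simp add: a_def r_def)
  have r_le: "r n j \<le> a n 1" if j: "j \<in> {2..m n}" for n j
  proof -
    have "2 \<le> j" "j \<le> m n" using j by auto
    then have "r n j \<le> r n 2"
    proof (induction j rule: dec_induct)
      case (step i) then show ?case using ord2[of i n] by (simp add: r_def)
    qed simp
    then show ?thesis using \<open>2 \<le> j\<close> \<open>j \<le> m n\<close> by (simp add: a_def r_def numeral_2_eq_2)
  qed
  have p_le: "eventually (\<lambda>n. real (p n) \<le> c' * n) sequentially" if "c < c'" for c'
    using order_tendstoD(2)[OF ratio that] eventually_gt_at_top[of 0]
    by eventually_elim (simp add: divide_less_eq)
  have n_large: "eventually (\<lambda>n. b \<le> c' * real n) sequentially" if "c' > 0" for b c' :: real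
    using that by real_asymp
  have good: "eventually (\<lambda>n. except_prob M (tail_bound c' \<eta> n)
      (\<lambda>w. ?wb c' \<eta> n w)) sequentially"
    if "c < c'" "0 < \<eta>" "\<eta> \<le> 1" for c' \<eta>
    using p_le[OF that(1)] n_large[of c' 200, OF le_less_trans[OF c_nonneg that(1)]] eventually_gt_at_top[of 0]
  proof eventually_elim
    case (elim n)
    then show ?case
      using spiked_design.well_behaved_except[OF design M stdn m_le_p _ elim(1,2) that(2,3)] c_nonneg that(1)
      by (simp add: tail_bound_def)
  qed
  show ?thesis
  proof (intro conjI impI)
    let ?g = "varrho 1 ^ 2 - varrho 2 ^ 2"
    assume "varrho 1 ^ 2 > varrho 2 ^ 2 \<and>
          4 * sigma * sqrt c / (varrho 1 ^ 2 - varrho 2 ^ 2)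
            * ((\<Sum>j. varrho (Suc j)) + (2 + sqrt c) * sigma) \<le> 4 / 5"
    then have g: "?g > 0" by simp
    have gap_lim: "(\<lambda>n. (r n 1)\<^sup>2 - (a n 1)\<^sup>2) \<longlonglongrightarrow> ?g"
      unfolding r1 using a_lim(1)[of 0] a_lim(1)[of 1]
      by (intro tendsto_intros) (simp_all add: numeral_2_eq_2)
    \<comment> \<open>One null set has to serve all perturbations of c and \<eta>, which is why they
      run through a sequence.\<close>
    have "AE w in M. \<forall>N. eventually (\<lambda>n. ?wb (c + 1 / real (Suc N)) (1 / real (Suc N)) n w) sequentially"
      unfolding AE_all_countable
    proof
      fix N
      show "AE w in M. eventually (\<lambda>n. ?wb (c + 1 / real (Suc N)) (1 / real (Suc N)) n w) sequentially"
        by (rule AE_eventually_except_prob[OF good summable_tail_bound]) (use c_nonneg in \<open>auto simp: add_nonneg_pos\<close>)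
    qed
    then show "AE w in M. limsup (\<lambda>n. ereal (sin (vangle (p n) (rhohat n w) (rho n 1))))
                 \<le> ereal (4 * sigma * sqrt c / ?g * ((\<Sum>j. varrho (Suc j)) + (2 + sqrt c) * sigma))"
      using AE_space
    proof eventually_elim
      case (elim w)
      show ?case
      proof (rule limsup_le_of_bounds[OF gap_lim g tot_lim _ c_nonneg sigma_pos])
        fix N
        have "eventually (\<lambda>n. ?wb (c + 1 / real (Suc N)) (1 / real (Suc N)) n w) sequentially" using elim(1) by blast
        then show "eventually (\<lambda>n. ((r n 1)\<^sup>2 - (a n 1)\<^sup>2) * sin (vangle (p n) (rhohat n w) (rho n 1))
            \<le> 2 * (1 / real (Suc N)) * (tot n)\<^sup>2 + 4 * sigma * sqrt (c + 1 / real (Suc N)) * tot n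
              + sigma\<^sup>2 * (norm_bound (c + 1 / real (Suc N)) + min (norm_bound (c + 1 / real (Suc N))) 1)) sequentially"
          using eventually_gt_at_top[of 0]
        proof eventually_elim
          case (elim n)
          show ?case
            using spiked_design.well_behaved_sin_le[OF design[OF elim(2)] elim(1) r_le[unfolded r_def] top[OF \<open>w \<in> space M\<close> elim(2)]]
            unfolding tot_eq[OF elim(2)] r_def .
        qed
      qed
    qed
  next
    let ?\<theta> = "\<lambda>n w. vangle (p n) (rhohat n w) (rho n 1)"
    assume "c > 0 \<and> (\<forall>n. (\<lambda>w. ?\<theta> n w) \<in> borel_measurable M)"
    then have c: "c > 0" and meas: "\<And>n. ?\<theta> n \<in> borel_measurable M" by auto
    \<comment> \<open>An eventual bound for \<open>tot n\<close>, and thereby for the norm of the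
      first spike; the absolute value makes its positivity immediate.\<close>
    define P where "P = \<bar>\<Sum>j. varrho (Suc j)\<bar> + 1"
    have P: "P > 0" by (simp add: P_def)
    have tot_P: "eventually (\<lambda>n. tot n < P) sequentially"
      by (rule order_tendstoD(2)[OF tot_lim]) (auto simp: P_def)
    define \<delta> where "\<delta> = sigma\<^sup>2 * sqrt c / 24"
    have \<delta>: "\<delta> > 0" using c sigma_pos by (simp add: \<delta>_def)
    define D where "D = 2 * P * sigma + 4 * (P + sigma) * sigma"
    have D: "D > 0" using P sigma_pos by (simp add: D_def add_pos_pos)
    \<comment> \<open>\<open>D\<close> dominates the coefficient of \<eta> in the smallness
      condition of \<open>resid_large_prob\<close>, whose right side is 2 \<delta>.\<close>
    define \<eta> where "\<eta> = min 1 (2 * \<delta> / D)"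
    have \<eta>: "0 < \<eta>" "\<eta> \<le> 1" using \<delta> D by (auto simp: \<eta>_def)
    have \<eta>D: "\<eta> * D \<le> 2 * \<delta>"
    proof -
      have "\<eta> * D \<le> (2 * \<delta> / D) * D" using D by (intro mult_right_mono) (auto simp: \<eta>_def)
      then show ?thesis using D by simp
    qed
    \<comment> \<open>The constant of \<open>well_behaved_form_upper\<close> with 2 c for c and P
      for the total. The summand \<delta> secures \<delta> \<le> K, so the argument of arccos below
      lies between 0 and 1.\<close>
    define K where "K = 2 * P\<^sup>2 + 4 * sigma * sqrt (2 * c) * P + sigma\<^sup>2 * (1 + norm_bound (2 * c)) + \<delta>"
    have nb: "norm_bound (2 * c) \<ge> 0" using c by (simp add: norm_bound_def)
    have K: "\<delta> \<le> K" "K > 0" using \<delta> P sigma_pos c nb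
      by (auto simp: K_def intro!: add_nonneg_nonneg add_nonneg_pos mult_nonneg_nonneg)
    define \<epsilon> where "\<epsilon> = arccos (1 - \<delta>\<^sup>2 / (8 * K\<^sup>2))"
    have \<epsilon>: "\<epsilon> > 0"
    proof -
      have "\<delta>\<^sup>2 \<le> K\<^sup>2" using K \<delta> by (intro power_mono) auto
      then have "\<delta>\<^sup>2 \<le> 8 * K\<^sup>2" using zero_le_power2[of K] by linarith
      then have "\<delta>\<^sup>2 / (8 * K\<^sup>2) \<le> 1" using K by (simp add: divide_le_eq)
      moreover have "0 < \<delta>\<^sup>2 / (8 * K\<^sup>2)" using K \<delta> by simp
      ultimately have "arccos 1 < \<epsilon>" unfolding \<epsilon>_def by (intro arccos_less_arccos) linarith+
      then show ?thesis by simp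
    qed
    define B where "B n = (4 * (2 * c * n) + 4) * exp (- real n * \<eta>\<^sup>2 / 8) + 2 * exp (- real n / 32) + exp (- c * n / 32)" for n
    have B_lim: "B \<longlonglongrightarrow> 0"
    proof -
      define d e where "d = \<eta>\<^sup>2 / 8" and "e = c / 32"
      have "d > 0" "e > 0" using \<eta> c by (auto simp: d_def e_def)
      then have "(\<lambda>n. (4 * (2 * c * n) + 4) * exp (- (d * real n))) \<longlonglongrightarrow> 0" "(\<lambda>n. 2 * exp (- real n / 32)) \<longlonglongrightarrow> 0"
        "(\<lambda>n. exp (- (e * real n))) \<longlonglongrightarrow> 0"
        using c by real_asymp+
      from tendsto_add[OF tendsto_add[OF this(1,2)] this(3)] show ?thesis
        by (simp add: B_def[abs_def] d_def e_def mult_ac)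
    qed
    have c2: "c < 2 * c" "0 < 2 * c" using c by auto
    \<comment> \<open>The margin 3/4 pays for rounding: 8 (p div 2) \<ge> 4 (p - 1) \<ge> 3 c n - 4
      \<ge> c n once c n \<ge> 2. The levels 1/4 and 1/8 that follow give A probability at least
      3/8, and A without the exceptional set at least 1/4.\<close>
    have "eventually (\<lambda>n. 3 / 4 * c < real (p n) / real n) sequentially"
      using ratio by (rule order_tendstoD) (use c in simp)
    moreover have "eventually (\<lambda>n. B n < 1/4) sequentially" using B_lim by (rule order_tendstoD) simp
    moreover have "eventually (\<lambda>n. tail_bound (2 * c) \<eta> n < 1/8) sequentially"
      using tail_bound_tendsto_0[OF c2(2) \<eta>(1)] by (rule order_tendstoD) simp
    ultimately have "eventually (\<lambda>n. ereal (\<epsilon> / 4) \<le> ereal (integral\<^sup>L M (?\<theta> n))) sequentially"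
      using p_le[OF c2(1)] n_large[OF c, of 2] good[OF c2(1) \<eta>] tot_P eventually_gt_at_top[of 0]
    proof eventually_elim
      case (elim n)
      note n = elim(8)
      interpret sd: spiked_design "p n" "m n" n "rho n" sigma by (rule design[OF n])
      have p_low: "c * n \<le> 8 * real (p n div 2)"
      proof -
        have "3 / 4 * c * n \<le> p n" using elim(1) n by (simp add: less_divide_eq)
        moreover have "real (p n) \<le> 2 * real (p n div 2) + 1" by linarith
        ultimately show ?thesis using elim(5) by linarith
      qed
      have r1_le: "vnorm (p n) (rho n 1) \<le> tot n"
        unfolding tot_def r_def using m_pos[of n] by (intro member_le_sum) auto
      have total_eq: "sd.total = tot n" by (rule tot_eq[OF n])
      have tot0: "0 \<le> tot n" using sd.total_nonneg by (simp add: total_eq)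
      have small: "\<eta> * (2 * sd.total * sigma + 4 * (vnorm (p n) (rho n 1) + sigma) * sigma) \<le> sigma\<^sup>2 * sqrt c / 12"
      proof -
        have "2 * sd.total * sigma + 4 * (vnorm (p n) (rho n 1) + sigma) * sigma \<le> D"
          unfolding D_def total_eq using elim(7) r1_le sigma_pos by (intro add_mono mult_right_mono mult_left_mono) auto
        then have "\<eta> * (2 * sd.total * sigma + 4 * (vnorm (p n) (rho n 1) + sigma) * sigma) \<le> \<eta> * D"
          using \<eta> by (intro mult_left_mono) auto
        then show ?thesis using \<eta>D unfolding \<delta>_def by linarith
      qed
      define A where "A = {w\<in>space M. sigma\<^sup>2 * sqrt c / 24 \<le> vnorm (p n) (sd.resid (\<lambda>i j. X n (i, Inl j) w) (\<lambda>i k. X n (i, Inr k) w))}"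
      note A = sd.resid_large_prob[OF M stdn c p_low \<eta> small, folded A_def]
      obtain E where E: "E \<in> sets M" "prob E \<le> tail_bound (2 * c) \<eta> n"
        "\<And>w. w \<in> space M - E \<Longrightarrow> sd.well_behaved (2 * c) \<eta> (\<lambda>i j. X n (i, Inl j) w) (\<lambda>i k. X n (i, Inr k) w)"
        using elim(6) unfolding except_prob_def by blast
      have "(4 * real (m n) + 4) * exp (- real n * \<eta>\<^sup>2 / 8) \<le> (4 * (2 * c * n) + 4) * exp (- real n * \<eta>\<^sup>2 / 8)"
        using elim(4) m_le_p[of n] by (intro mult_right_mono) auto
      then have "1 - B n \<le> 2 * prob A" using A(2) unfolding B_def by linarith
      then have "3/8 \<le> prob A" using elim(2) by simp
      moreover have "prob A \<le> prob (A - E) + prob E"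
      proof -
        have "prob A \<le> prob ((A - E) \<union> E)" using A(1) E(1) by (intro finite_measure_mono) auto
        also have "\<dots> \<le> prob (A - E) + prob E" using A(1) E(1) by (intro measure_Un_le) auto
        finally show ?thesis .
      qed
      ultimately have pAE: "1/4 \<le> prob (A - E)" using E(2) elim(3) by simp
      have angle: "\<epsilon> \<le> ?\<theta> n w" if w: "w \<in> A - E" for w
      proof -
        have ws: "w \<in> space M - E" using w by (auto simp: A_def)
        let ?V = "\<lambda>i j. X n (i, Inl j) w" and ?Z = "\<lambda>i k. X n (i, Inr k) w"
        have dir: "sd.dir = (\<lambda>k. 1 / vnorm (p n) (rho n 1) * rho n 1 k)" by (auto simp: sd.dir_def)
        have "vdot (p n) y (mat_vec (p n) (sample_cov n (sd.obs ?V ?Z)) y) \<le> K * vdot (p n) y y" for y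
        proof -
          have "vdot (p n) y (mat_vec (p n) (sample_cov n (sd.obs ?V ?Z)) y) \<le>
            (2 * sd.total\<^sup>2 + 4 * sigma * sqrt (2 * c) * sd.total + sigma\<^sup>2 * (1 + norm_bound (2 * c))) * vdot (p n) y y"
            using sd.well_behaved_form_upper[OF E(3)[OF ws] \<eta>(2)] c by simp
          also have "\<dots> \<le> K * vdot (p n) y y"
          proof (rule mult_right_mono)
            have "(tot n)\<^sup>2 \<le> P\<^sup>2" using elim(7) tot0 by (intro power_mono) auto
            moreover have "4 * sigma * sqrt (2 * c) * tot n \<le> 4 * sigma * sqrt (2 * c) * P"
              using elim(7) sigma_pos c by (intro mult_left_mono) auto
            ultimately show "2 * sd.total\<^sup>2 + 4 * sigma * sqrt (2 * c) * sd.total + sigma\<^sup>2 * (1 + norm_bound (2 * c)) \<le> K"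
              unfolding total_eq K_def using \<delta> by linarith
          qed simp
          finally show ?thesis .
        qed
        moreover have "\<delta> \<le> vnorm (p n) (\<lambda>k. mat_vec (p n) (sample_cov n (sd.obs ?V ?Z)) sd.dir k
            - vdot (p n) sd.dir (mat_vec (p n) (sample_cov n (sd.obs ?V ?Z)) sd.dir) * sd.dir k)"
          using w unfolding A_def \<delta>_def sd.resid_def[abs_def] by simp
        ultimately show ?thesis
          unfolding \<epsilon>_def using ws
          by (intro vangle_lower_bound[OF top[OF _ n] sd.dir_unit sd.rho1_pos dir _ \<delta> K(1)]) auto
      qed
      have AE: "A - E \<in> sets M" using A(1) E(1) by auto
      have int: "integrable M (?\<theta> n)"
        using vangle_bounds[of "p n"] by (intro integrable_const_bound[where B = pi] meas) (auto simp: abs_of_nonneg)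
      have "\<epsilon> / 4 \<le> \<epsilon> * prob (A - E)" using pAE \<epsilon> by simp
      also have "\<dots> = (\<integral>w. \<epsilon> * indicator (A - E) w \<partial>M)" using AE by simp
      also have "\<dots> \<le> (\<integral>w. ?\<theta> n w \<partial>M)"
      proof (rule integral_mono)
        show "integrable M (\<lambda>w. \<epsilon> * indicator (A - E) w)"
          using AE by (intro integrable_mult_right integrable_real_indicator) (auto simp: emeasure_eq_measure)
        show "\<epsilon> * indicator (A - E) w \<le> ?\<theta> n w" if "w \<in> space M" for w
          using angle[of w] vangle_bounds(1)[of "p n"] by (auto simp: indicator_def)
      qed (rule int)
      finally show ?case by simp
    qed
    then have "ereal (\<epsilon> / 4) \<le> liminf (\<lambda>n. ereal (integral\<^sup>L M (?\<theta> n)))"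
      by (rule Liminf_bounded)
    moreover have "0 < ereal (\<epsilon> / 4)" using \<epsilon> by simp
    ultimately show "0 < liminf (\<lambda>n. ereal (integral\<^sup>L M (?\<theta> n)))" by (rule less_le_trans[rotated])
  qed
qed

end
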